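(* Let $X\subseteq\mathbb{C}^n$ be an affine variety over $\mathbb{C}$. For every $a\in X$ there is a nonsingular point $\xi$ of ${}^{*}X$ (that is, $\xi\in{}^{*}(X_{\mathrm{ns}})$, where $X_{\mathrm{ns}}$ is the set of nonsingular points of $X$) with $\xi\in h_X(a)$.
   Context: Nonstandard setting: ${}^{*}$ denotes an enlargement of a superstructure over a set containing $\mathbb{C}$ and $\mathbb{R}$; so the transfer principle holds, and every standard family of sets with the finite intersection property has enlargements with a common point. ${}^{*}X$ is the enlargement of $X$. The halo of $a\in X$ is $h_X(a)=\bigcap_{U\ni a}{}^{*}U$, where $U$ ranges over the subsets of $X$ that contain $a$ and are open in the usual (Euclidean) topology; equivalently, it is the set of points of ${}^{*}X$ infinitely close to $a$. *)

theory Defs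
  imports
    "HOL-Analysis.Analysis"
    "HOL-Library.Poly_Mapping"
    "HOL-Library.Extended_Nat"
begin

section \<open>Affine varieties and their nonsingular points\<close>

text \<open>
  A polynomial in indeterminates indexed by \<open>'i\<close> is a finitely supported map from monomials
  (exponent vectors) to coefficients; the multiplication of \<^typ>\<open>('i \<Rightarrow>\<^sub>0 nat) \<Rightarrow>\<^sub>0 complex\<close>
  is convolution, so this type is the polynomial ring.
\<close>

type_synonym 'i cpoly = "('i \<Rightarrow>\<^sub>0 nat) \<Rightarrow>\<^sub>0 complex"

definition peval :: "'i cpoly \<Rightarrow> ('i \<Rightarrow> complex) \<Rightarrow> complex" where
  "peval p x = (\<Sum>m\<in>Poly_Mapping.keys p.
     Poly_Mapping.lookup p m * (\<Prod>i\<in>Poly_Mapping.keys m. x i ^ Poly_Mapping.lookup m i))"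

definition zero_locus :: "'n cpoly set \<Rightarrow> (complex^'n) set" where
  "zero_locus F = {x. \<forall>p\<in>F. peval p (($) x) = 0}"

definition affine_variety :: "(complex^'n) set \<Rightarrow> bool" where
  "affine_variety X \<longleftrightarrow> (\<exists>F. X = zero_locus F)"

definition vanishing_ideal :: "(complex^'n) set \<Rightarrow> 'n cpoly set" where
  "vanishing_ideal X = {p. \<forall>x\<in>X. peval p (($) x) = 0}"

definition irreducible_variety :: "(complex^'n) set \<Rightarrow> bool" where
  "irreducible_variety Z \<longleftrightarrow> affine_variety Z \<and> Z \<noteq> {} \<and>
     (\<forall>A B. affine_variety A \<longrightarrow> affine_variety B \<longrightarrow> Z = A \<union> B \<longrightarrow> Z = A \<or> Z = B)"

definition irreducible_component :: "(complex^'n) set \<Rightarrow> (complex^'n) set \<Rightarrow> bool" where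
  "irreducible_component X Z \<longleftrightarrow> irreducible_variety Z \<and> Z \<subseteq> X \<and>
     (\<forall>Z'. irreducible_variety Z' \<longrightarrow> Z \<subseteq> Z' \<longrightarrow> Z' \<subseteq> X \<longrightarrow> Z' = Z)"

text \<open>
  The classes of \<open>f 0, \<dots>, f (d - 1)\<close> in the coordinate ring \<open>\<complex>[x] / I(Z)\<close> are algebraically
  independent over \<open>\<complex>\<close>: no nonzero polynomial \<open>q\<close> in \<open>d\<close> indeterminates has
  \<open>q(f 0, \<dots>, f (d - 1)) \<in> I(Z)\<close>.
\<close>

definition alg_independent_on :: "(complex^'n) set \<Rightarrow> nat \<Rightarrow> (nat \<Rightarrow> 'n cpoly) \<Rightarrow> bool" where
  "alg_independent_on Z d f \<longleftrightarrow>
     (\<forall>q :: nat cpoly. (\<forall>m\<in>Poly_Mapping.keys q. Poly_Mapping.keys m \<subseteq> {..<d}) \<longrightarrow>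
        (\<forall>x\<in>Z. peval q (\<lambda>j. peval (f j) (($) x)) = 0) \<longrightarrow> q = 0)"

text \<open>
  The dimension of an irreducible variety is the transcendence degree over \<open>\<complex>\<close> of its coordinate
  ring, an integral domain, or what is the same of its function field. The dimension of a variety
  at a point is the largest dimension of an irreducible component through the point. A point is
  nonsingular if the Zariski tangent space there has this dimension.
\<close>

definition variety_dim :: "(complex^'n) set \<Rightarrow> enat" where
  "variety_dim Z = Sup {enat d | d. \<exists>f. alg_independent_on Z d f}"

definition local_dim :: "(complex^'n) set \<Rightarrow> complex^'n \<Rightarrow> enat" where
  "local_dim X a = Sup {variety_dim Z | Z. irreducible_component X Z \<and> a \<in> Z}"

definition partial :: "'n::finite \<Rightarrow> 'n cpoly \<Rightarrow> complex^'n \<Rightarrow> complex" where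
  "partial i p a = deriv (\<lambda>t. peval p (($) (a + axis i t))) 0"

definition tangent_space :: "(complex^'n) set \<Rightarrow> complex^'n \<Rightarrow> (complex^'n) set" where
  "tangent_space X a = {v. \<forall>p\<in>vanishing_ideal X. (\<Sum>i\<in>UNIV. partial i p a * v $ i) = 0}"

definition nonsingular_points :: "(complex^'n) set \<Rightarrow> (complex^'n) set" where
  "nonsingular_points X = {a\<in>X. enat (vec.dim (tangent_space X a)) = local_dim X a}"


section \<open>Superstructures and enlargements\<close>

text \<open>
  A superstructure over a set \<open>S\<close> of atoms is given by a binary relation \<open>E\<close> on a type, where
  \<open>E x y\<close> stands for \<open>x \<in> y\<close>: every subset of the level \<open>V\<^sub>k(S)\<close> is the extension of exactly one
  element that is not an atom, and \<open>V\<^sub>k\<^sub>+\<^sub>1(S)\<close> consists of \<open>V\<^sub>k(S)\<close> and these elements.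

  The union of all finite levels, i.e. the classical superstructure, is the case \<open>h = \<infinity>\<close>. For
  infinite \<open>S\<close> it has at least \<open>\<beth>\<^sub>\<omega>\<close> elements, and HOL cannot prove that there is a type so large.
  A finite height \<open>h\<close> gives the truncated superstructure \<open>V\<^sub>h(S)\<close>, which HOL can construct.
\<close>

primrec level :: "('u \<Rightarrow> 'u \<Rightarrow> bool) \<Rightarrow> 'u set \<Rightarrow> nat \<Rightarrow> 'u set" where
  "level E S 0 = S"
| "level E S (Suc k) = level E S k \<union> {x. x \<notin> S \<and> {y. E y x} \<subseteq> level E S k}"

definition universe :: "('u \<Rightarrow> 'u \<Rightarrow> bool) \<Rightarrow> 'u set \<Rightarrow> enat \<Rightarrow> 'u set" where
  "universe E S h = (\<Union>k\<in>{k. enat k \<le> h}. level E S k)"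

definition superstructure :: "('u \<Rightarrow> 'u \<Rightarrow> bool) \<Rightarrow> 'u set \<Rightarrow> enat \<Rightarrow> bool" where
  "superstructure E S h \<longleftrightarrow>
     (\<forall>s\<in>S. \<forall>y. \<not> E y s) \<and>
     (\<forall>k A. enat (Suc k) \<le> h \<longrightarrow> A \<subseteq> level E S k \<longrightarrow> (\<exists>!x. x \<notin> S \<and> {y. E y x} = A))"

text \<open>The element of the superstructure whose extension is \<open>A\<close>.\<close>

definition coll :: "('u \<Rightarrow> 'u \<Rightarrow> bool) \<Rightarrow> 'u set \<Rightarrow> 'u set \<Rightarrow> 'u" where
  "coll E S A = (THE x. x \<notin> S \<and> {y. E y x} = A)"

text \<open>
  Bounded formulas of the language of set theory. Variables are numbered; \<open>BAll i j \<phi>\<close> is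
  \<open>\<forall>v\<^sub>i \<in> v\<^sub>j. \<phi>\<close>.
\<close>

datatype bformula =
    Eq nat nat
  | Mem nat nat
  | Neg bformula
  | Conj bformula bformula
  | BAll nat nat bformula

primrec sat :: "('u \<Rightarrow> 'u \<Rightarrow> bool) \<Rightarrow> bformula \<Rightarrow> (nat \<Rightarrow> 'u) \<Rightarrow> bool" where
  "sat E (Eq i j) v \<longleftrightarrow> v i = v j"
| "sat E (Mem i j) v \<longleftrightarrow> E (v i) (v j)"
| "sat E (Neg \<phi>) v \<longleftrightarrow> \<not> sat E \<phi> v"
| "sat E (Conj \<phi> \<psi>) v \<longleftrightarrow> sat E \<phi> v \<and> sat E \<psi> v"
| "sat E (BAll i j \<phi>) v \<longleftrightarrow> (\<forall>y. E y (v j) \<longrightarrow> sat E \<phi> (v(i := y)))"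

text \<open>
  A nonstandard embedding maps the superstructure over \<open>S\<close> into the superstructure over
  \<open>S' = \<^sup>*S\<close> and satisfies the transfer principle. The usual identification of an atom \<open>s\<close> with
  \<open>\<^sup>*s\<close> is not made, so the two superstructures may live on different types.
\<close>

definition transfer_principle ::
  "('u \<Rightarrow> 'u \<Rightarrow> bool) \<Rightarrow> 'u set \<Rightarrow> ('v \<Rightarrow> 'v \<Rightarrow> bool) \<Rightarrow> enat \<Rightarrow> ('u \<Rightarrow> 'v) \<Rightarrow> bool" where
  "transfer_principle E S E' h star \<longleftrightarrow>
     (\<forall>\<phi> v. (\<forall>i. v i \<in> universe E S h) \<longrightarrow> (sat E \<phi> v \<longleftrightarrow> sat E' \<phi> (\<lambda>i. star (v i))))"

definition fip :: "('u \<Rightarrow> 'u \<Rightarrow> bool) \<Rightarrow> 'u \<Rightarrow> bool" where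
  "fip E F \<longleftrightarrow> (\<forall>G. G \<subseteq> {A. E A F} \<longrightarrow> finite G \<longrightarrow> G \<noteq> {} \<longrightarrow> (\<exists>y. \<forall>A\<in>G. E y A))"

definition enlargement ::
  "('u \<Rightarrow> 'u \<Rightarrow> bool) \<Rightarrow> 'u set \<Rightarrow> ('v \<Rightarrow> 'v \<Rightarrow> bool) \<Rightarrow> 'v set \<Rightarrow> enat \<Rightarrow> ('u \<Rightarrow> 'v) \<Rightarrow> bool"
  where
  "enlargement E S E' S' h star \<longleftrightarrow>
     superstructure E S h \<and> superstructure E' S' h \<and>
     star ` universe E S h \<subseteq> universe E' S' h \<and>
     star (coll E S S) = coll E' S' S' \<and>
     transfer_principle E S E' h star \<and>
     (\<forall>F\<in>universe E S h. fip E F \<longrightarrow> (\<exists>\<xi>. \<forall>A. E A F \<longrightarrow> E' \<xi> (star A)))"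


section \<open>Subsets of affine space inside a superstructure\<close>

text \<open>
  The injection \<open>c\<close> identifies \<open>\<complex>\<close>, and with it the subset \<open>\<real>\<close>, with a set of atoms. A point \<open>x\<close>
  of \<open>\<complex>\<^sup>n\<close> is the function \<open>{(1, x\<^sub>1), \<dots>, (n, x\<^sub>n)}\<close>, a set of Kuratowski pairs of atoms; the
  coordinates are numbered by \<open>idx\<close>. Kuratowski pairs of atoms lie in level 2, points in level 3,
  sets of points in level 4 and families of such sets in level 5.
\<close>

definition kpair :: "('u \<Rightarrow> 'u \<Rightarrow> bool) \<Rightarrow> 'u set \<Rightarrow> 'u \<Rightarrow> 'u \<Rightarrow> 'u" where
  "kpair E S a b = coll E S {coll E S {a}, coll E S {a, b}}"

definition point_code ::
  "('u \<Rightarrow> 'u \<Rightarrow> bool) \<Rightarrow> 'u set \<Rightarrow> (complex \<Rightarrow> 'u) \<Rightarrow> ('n::finite \<Rightarrow> nat) \<Rightarrow> complex^'n \<Rightarrow> 'u" where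
  "point_code E S c idx x = coll E S (range (\<lambda>i. kpair E S (c (of_nat (idx i))) (c (x $ i))))"

definition set_code ::
  "('u \<Rightarrow> 'u \<Rightarrow> bool) \<Rightarrow> 'u set \<Rightarrow> (complex \<Rightarrow> 'u) \<Rightarrow> ('n::finite \<Rightarrow> nat) \<Rightarrow> (complex^'n) set \<Rightarrow> 'u"
  where
  "set_code E S c idx A = coll E S (point_code E S c idx ` A)"

text \<open>The set \<open>\<^sup>*A\<close>, for \<open>A \<subseteq> \<complex>\<^sup>n\<close>.\<close>

definition star_set ::
  "('u \<Rightarrow> 'u \<Rightarrow> bool) \<Rightarrow> 'u set \<Rightarrow> ('v \<Rightarrow> 'v \<Rightarrow> bool) \<Rightarrow> ('u \<Rightarrow> 'v) \<Rightarrow>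
     (complex \<Rightarrow> 'u) \<Rightarrow> ('n::finite \<Rightarrow> nat) \<Rightarrow> (complex^'n) set \<Rightarrow> 'v set" where
  "star_set E S E' star c idx A = {\<xi>. E' \<xi> (star (set_code E S c idx A))}"

definition halo ::
  "('u \<Rightarrow> 'u \<Rightarrow> bool) \<Rightarrow> 'u set \<Rightarrow> ('v \<Rightarrow> 'v \<Rightarrow> bool) \<Rightarrow> ('u \<Rightarrow> 'v) \<Rightarrow>
     (complex \<Rightarrow> 'u) \<Rightarrow> ('n::finite \<Rightarrow> nat) \<Rightarrow> (complex^'n) set \<Rightarrow> complex^'n \<Rightarrow> 'v set" where
  "halo E S E' star c idx X a =
     (\<Inter>U\<in>{U. openin (top_of_set X) U \<and> a \<in> U}. star_set E S E' star c idx U)"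

end

theory Submission
  imports Defs "Jordan_Normal_Form.Char_Poly"
begin

text \<open>
  By the enlargement property it suffices that the nonsingular points are dense in \<open>X\<close> for the
  Euclidean topology. Let \<open>Z\<close> be an irreducible component through \<open>a\<close> and let \<open>f\<close> be a Noether
  normalization of \<open>Z\<close>, with values in affine \<open>d\<close>-space. The minimal polynomial of a regular function
  over the coordinates of \<open>f\<close> has polynomial coefficients, because a locally bounded quotient of
  polynomials is a polynomial; its roots are values of the function on the fibres, by lying over;
  and roots depend continuously on coefficients. Applied to a function that separates \<open>a\<close> from the
  rest of its fibre this shows that \<open>f\<close> is open at \<open>a\<close>: every sequence converging to \<open>f a\<close> lifts to
  a sequence in \<open>Z\<close> converging to \<open>a\<close>. Hence nonempty Zariski open subsets of \<open>Z\<close> are dense. On the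
  set where the minimal polynomials of the coordinates are separable, \<open>f\<close> identifies the
  tangent space with affine \<open>d\<close>-space, surjectivity again because curves can be lifted. The
  complex numbers are essential: over the reals the conclusion fails for umbrellas.
\<close>

no_notation vec_index (infixl "$" 100)
hide_const (open) Module.smult

section \<open>Algebras of polynomial functions\<close>

text \<open>Polynomials are treated as functions, in the closure of a set of generators under the
  ring operations. The number of variables is then a parameter and not a type; over an infinite
  field nothing is lost. Formal polynomials return only where dimension and tangent space refer to
  them. The obstacle is to make a Zariski dense set dense in the Euclidean topology. What does this
  is a fact about one variable: a monic polynomial with small constant term has a small root. To
  exploit it, a minimal polynomial must be monic with polynomial coefficients and divide every other
  relation after each specialization of the parameters, not only over the function field. This is
  why bounded quotients are studied. The other components of \<open>X\<close> are controlled by one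
  function that vanishes on them but not on all of \<open>Z\<close>; where it is nonzero, a point of
  \<open>Z\<close> lies on no other component. Derivatives enter through Hadamard's factorization
  \<open>u x - u y = (\<Sum>j. (x j - y j) * A j (x, y))\<close>, which allows limits along
  sequences of secants. The dimension of the tangent space is compared with a transcendence degree,
  whose upper bound is a count of monomials.\<close>

inductive_set fun_alg :: "('p \<Rightarrow> complex) set \<Rightarrow> ('p \<Rightarrow> complex) set"
  for G :: "('p \<Rightarrow> complex) set" where
  const: "(\<lambda>_. c) \<in> fun_alg G"
| gen: "g \<in> G \<Longrightarrow> g \<in> fun_alg G"
| add: "u \<in> fun_alg G \<Longrightarrow> v \<in> fun_alg G \<Longrightarrow> (\<lambda>x. u x + v x) \<in> fun_alg G"
| mult: "u \<in> fun_alg G \<Longrightarrow> v \<in> fun_alg G \<Longrightarrow> (\<lambda>x. u x * v x) \<in> fun_alg G"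

lemma fun_alg_uminus: "u \<in> fun_alg G \<Longrightarrow> (\<lambda>x. - u x) \<in> fun_alg G"
  using fun_alg.mult[OF fun_alg.const[of "-1"]] by simp

lemma fun_alg_diff: "u \<in> fun_alg G \<Longrightarrow> v \<in> fun_alg G \<Longrightarrow> (\<lambda>x. u x - v x) \<in> fun_alg G"
  using fun_alg.add[OF _ fun_alg_uminus] by simp

lemma fun_alg_sum: "(\<And>i. i \<in> I \<Longrightarrow> u i \<in> fun_alg G) \<Longrightarrow> (\<lambda>x. \<Sum>i\<in>I. u i x) \<in> fun_alg G"
  by (induction I rule: infinite_finite_induct) (auto intro: fun_alg.intros)

lemma fun_alg_prod: "(\<And>i. i \<in> I \<Longrightarrow> u i \<in> fun_alg G) \<Longrightarrow> (\<lambda>x. \<Prod>i\<in>I. u i x) \<in> fun_alg G"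
  by (induction I rule: infinite_finite_induct) (auto intro: fun_alg.intros)

lemma fun_alg_power: "u \<in> fun_alg G \<Longrightarrow> (\<lambda>x. u x ^ k) \<in> fun_alg G"
  by (induction k) (auto intro: fun_alg.intros)

lemma fun_alg_compose:
  assumes "u \<in> fun_alg G" and "\<And>g. g \<in> G \<Longrightarrow> (\<lambda>y. g (\<phi> y)) \<in> fun_alg H"
  shows "(\<lambda>y. u (\<phi> y)) \<in> fun_alg H"
  using assms(1) by induction (auto intro: fun_alg.intros assms(2))

lemma fun_alg_mono: "u \<in> fun_alg G \<Longrightarrow> G \<subseteq> H \<Longrightarrow> u \<in> fun_alg H"
  using fun_alg_compose[of u G "\<lambda>x. x" H] by (auto intro: fun_alg.gen)

lemmas fun_alg_intros =
  fun_alg.const fun_alg.add fun_alg.mult fun_alg_uminus fun_alg_diff fun_alg_sum fun_alg_prod fun_alg_power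

text \<open>Restriction to a polynomial curve turns questions about several variables into questions
  about the roots of one polynomial.\<close>

lemma fun_alg_along_curve:
  assumes "u \<in> fun_alg G" and "\<And>g. g \<in> G \<Longrightarrow> \<exists>P. \<forall>s. g (\<phi> s) = poly P s"
  shows "\<exists>P. \<forall>s. u (\<phi> s) = poly P s"
  using assms(1)
proof induction
  case (const c)
  show ?case by (rule exI[of _ "[:c:]"]) simp
next
  case (gen g)
  then show ?case using assms(2) by blast
next
  case (add u v)
  then obtain P Q where "\<forall>s. u (\<phi> s) = poly P s" "\<forall>s. v (\<phi> s) = poly Q s" by blast
  then show ?case by (intro exI[of _ "P + Q"]) simp
next
  case (mult u v)
  then obtain P Q where "\<forall>s. u (\<phi> s) = poly P s" "\<forall>s. v (\<phi> s) = poly Q s" by blast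
  then show ?case by (intro exI[of _ "P * Q"]) simp
qed

lemma fun_alg_continuous:
  fixes u :: "'p::topological_space \<Rightarrow> complex"
  assumes "u \<in> fun_alg G" and "\<And>g. g \<in> G \<Longrightarrow> continuous_on UNIV g"
  shows "continuous_on UNIV u"
  using assms(1) by induction (auto intro: continuous_on_add continuous_on_mult assms(2))

text \<open>On the diagonal the functions \<open>A i\<close> are the partial derivatives.\<close>

lemma fun_alg_hadamard:
  fixes g :: "'i \<Rightarrow> 'p::topological_space \<Rightarrow> complex"
  assumes "u \<in> fun_alg (g ` I)" and "finite I" and "\<And>i. i \<in> I \<Longrightarrow> continuous_on UNIV (g i)"
  shows "\<exists>A. (\<forall>i\<in>I. continuous_on UNIV (A i)) \<and>
             (\<forall>x y. u x - u y = (\<Sum>i\<in>I. (g i x - g i y) * A i (x, y)))"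
  using assms(1)
proof induction
  case (const c)
  show ?case by (rule exI[of _ "\<lambda>_ _. 0"]) simp
next
  case (gen u)
  then obtain j where j: "j \<in> I" "u = g j" by blast
  show ?case
    by (rule exI[of _ "\<lambda>i _. if i = j then 1 else 0"])
       (use j assms(2) in \<open>auto simp: if_distrib cong: if_cong\<close>)
next
  case (add u v)
  then obtain A B where
    A: "\<forall>i\<in>I. continuous_on UNIV (A i)"
       "\<And>x y. u x - u y = (\<Sum>i\<in>I. (g i x - g i y) * A i (x, y))" and
    B: "\<forall>i\<in>I. continuous_on UNIV (B i)"
       "\<And>x y. v x - v y = (\<Sum>i\<in>I. (g i x - g i y) * B i (x, y))" by blast
  show ?case
  proof (rule exI[of _ "\<lambda>i p. A i p + B i p"], intro conjI ballI allI)
    show "continuous_on UNIV (\<lambda>p. A i p + B i p)" if "i \<in> I" for i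
      using A(1) B(1) that by (auto intro: continuous_intros)
    show "u x + v x - (u y + v y) = (\<Sum>i\<in>I. (g i x - g i y) * (A i (x, y) + B i (x, y)))" for x y
      using A(2)[of x y] B(2)[of x y] by (simp add: distrib_left sum.distrib add_diff_add)
  qed
next
  case (mult u v)
  then obtain A B where
    A: "\<forall>i\<in>I. continuous_on UNIV (A i)"
       "\<And>x y. u x - u y = (\<Sum>i\<in>I. (g i x - g i y) * A i (x, y))" and
    B: "\<forall>i\<in>I. continuous_on UNIV (B i)"
       "\<And>x y. v x - v y = (\<Sum>i\<in>I. (g i x - g i y) * B i (x, y))" by blast
  have cont: "continuous_on UNIV u" "continuous_on UNIV v"
    using mult.hyps fun_alg_continuous[of _ "g ` I"] assms(3) by blast+
  \<comment> \<open>Leibniz rule for the splitting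
    \<open>(u x - u y) * v x + u y * (v x - v y)\<close>, with one factor taken at each end of the
    pair.\<close>
  show ?case
  proof (rule exI[of _ "\<lambda>i p. A i p * v (fst p) + u (snd p) * B i p"], intro conjI ballI allI)
    show "continuous_on UNIV (\<lambda>p. A i p * v (fst p) + u (snd p) * B i p)" if "i \<in> I" for i
      using A(1) B(1) that
      by (auto intro!: continuous_intros continuous_on_compose2[OF cont(1)]
          continuous_on_compose2[OF cont(2)])
    show "u x * v x - u y * v y =
      (\<Sum>i\<in>I. (g i x - g i y) * (A i (x, y) * v (fst (x, y)) + u (snd (x, y)) * B i (x, y)))" for x y
    proof -
      have "u x * v x - u y * v y = (u x - u y) * v x + u y * (v x - v y)"
        by (simp add: algebra_simps)
      also have "\<dots> = (\<Sum>i\<in>I. (g i x - g i y) * A i (x, y)) * v x +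
                       u y * (\<Sum>i\<in>I. (g i x - g i y) * B i (x, y))"
        by (simp add: A(2)[symmetric] B(2)[symmetric])
      also have "\<dots> = (\<Sum>i\<in>I. (g i x - g i y) * (A i (x, y) * v x + u y * B i (x, y)))"
        unfolding sum_distrib_left sum_distrib_right sum.distrib[symmetric]
        by (simp add: algebra_simps)
      finally show ?thesis by simp
    qed
  qed
qed

section \<open>Families of univariate polynomials\<close>

text \<open>Elements of the polynomial ring in one variable over \<open>fun_alg G\<close>, given by
  their specializations \<open>F x\<close>. The degree bound is uniform because single
  specializations may have smaller degree or vanish.\<close>

definition poly_fam :: "('p \<Rightarrow> complex) set \<Rightarrow> ('p \<Rightarrow> complex poly) set" where
  "poly_fam G = {F. (\<exists>N. \<forall>x. degree (F x) \<le> N) \<and> (\<forall>i. (\<lambda>x. coeff (F x) i) \<in> fun_alg G)}"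

lemma poly_fam_coeff: "F \<in> poly_fam G \<Longrightarrow> (\<lambda>x. coeff (F x) i) \<in> fun_alg G"
  by (simp add: poly_fam_def)

lemma poly_fam_bound:
  assumes "F \<in> poly_fam G"
  obtains N where "\<And>x i. i \<ge> N \<Longrightarrow> coeff (F x) i = 0"
proof -
  obtain N where "\<forall>x. degree (F x) \<le> N" using assms by (auto simp: poly_fam_def)
  then have "coeff (F x) i = 0" if "i \<ge> Suc N" for x i
    using that by (intro coeff_eq_0) (metis Suc_le_lessD le_less_trans)
  then show ?thesis by (rule that)
qed

lemma poly_famI:
  assumes "\<And>x i. i \<ge> N \<Longrightarrow> coeff (F x) i = 0" and "\<And>i. (\<lambda>x. coeff (F x) i) \<in> fun_alg G"
  shows "F \<in> poly_fam G"
proof -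
  have "degree (F x) \<le> N" for x by (rule degree_le) (simp add: assms(1))
  then show ?thesis using assms(2) by (auto simp: poly_fam_def)
qed

lemma poly_fam_const: "(\<lambda>_. p) \<in> poly_fam G"
  by (auto simp: poly_fam_def intro: fun_alg.const)

lemma poly_fam_add:
  assumes "F \<in> poly_fam G" "H \<in> poly_fam G"
  shows "(\<lambda>x. F x + H x) \<in> poly_fam G"
proof -
  obtain N M where "\<forall>x. degree (F x) \<le> N" "\<forall>x. degree (H x) \<le> M"
    using assms by (auto simp: poly_fam_def)
  then have "degree (F x + H x) \<le> max N M" for x
    by (meson degree_add_le le_max_iff_disj)
  then show ?thesis using assms by (auto simp: poly_fam_def intro: fun_alg.add)
qed

lemma poly_fam_mult:
  assumes "F \<in> poly_fam G" "H \<in> poly_fam G"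
  shows "(\<lambda>x. F x * H x) \<in> poly_fam G"
proof -
  obtain N M where "\<forall>x. degree (F x) \<le> N" "\<forall>x. degree (H x) \<le> M"
    using assms by (auto simp: poly_fam_def)
  then have "degree (F x * H x) \<le> N + M" for x
    by (meson add_mono degree_mult_le order_trans)
  then show ?thesis
    using assms by (auto simp: poly_fam_def coeff_mult intro!: fun_alg_intros)
qed

lemma poly_fam_sum: "(\<And>i. i \<in> I \<Longrightarrow> F i \<in> poly_fam G) \<Longrightarrow> (\<lambda>x. \<Sum>i\<in>I. F i x) \<in> poly_fam G"
  by (induction I rule: infinite_finite_induct) (auto intro: poly_fam_const poly_fam_add)

lemma poly_fam_prod: "(\<And>i. i \<in> I \<Longrightarrow> F i \<in> poly_fam G) \<Longrightarrow> (\<lambda>x. \<Prod>i\<in>I. F i x) \<in> poly_fam G"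
  by (induction I rule: infinite_finite_induct) (auto intro: poly_fam_const poly_fam_mult)

lemma fun_alg_if: "u \<in> fun_alg G \<Longrightarrow> v \<in> fun_alg G \<Longrightarrow> (\<lambda>x. if b then u x else v x) \<in> fun_alg G"
  by (cases b) auto

lemma poly_fam_monom: "u \<in> fun_alg G \<Longrightarrow> (\<lambda>x. monom (u x) k) \<in> poly_fam G"
  by (rule poly_famI[where N = "Suc k"]) (auto simp: coeff_monom fun_alg.const intro: fun_alg_if)

lemma poly_fam_pCons0: "u \<in> fun_alg G \<Longrightarrow> (\<lambda>x. [:u x:]) \<in> poly_fam G"
  using poly_fam_monom[of u G 0] by (simp add: monom_0)

lemma poly_fam_smult: "u \<in> fun_alg G \<Longrightarrow> F \<in> poly_fam G \<Longrightarrow> (\<lambda>x. smult (u x) (F x)) \<in> poly_fam G"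
  using poly_fam_mult[OF poly_fam_pCons0] by simp

lemma poly_fam_uminus: "F \<in> poly_fam G \<Longrightarrow> (\<lambda>x. - F x) \<in> poly_fam G"
  using poly_fam_smult[OF fun_alg.const[of "-1"]] by simp

lemma poly_fam_diff: "F \<in> poly_fam G \<Longrightarrow> H \<in> poly_fam G \<Longrightarrow> (\<lambda>x. F x - H x) \<in> poly_fam G"
  using poly_fam_add[OF _ poly_fam_uminus, of F G H] by simp

lemma poly_fam_compose:
  assumes "F \<in> poly_fam G" and "\<And>g. g \<in> G \<Longrightarrow> (\<lambda>y. g (\<phi> y)) \<in> fun_alg H"
  shows "(\<lambda>y. F (\<phi> y)) \<in> poly_fam H"
proof -
  obtain N where "\<And>x i. i \<ge> N \<Longrightarrow> coeff (F x) i = 0" using poly_fam_bound[OF assms(1)] by blast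
  then show ?thesis
    using fun_alg_compose[OF poly_fam_coeff[OF assms(1)] assms(2)] by (intro poly_famI[where N = N])
qed

lemma poly_fam_mono: "F \<in> poly_fam G \<Longrightarrow> G \<subseteq> H \<Longrightarrow> F \<in> poly_fam H"
  by (auto simp: poly_fam_def intro: fun_alg_mono)

lemma poly_fam_pderiv: "F \<in> poly_fam G \<Longrightarrow> (\<lambda>x. pderiv (F x)) \<in> poly_fam G"
proof -
  assume F: "F \<in> poly_fam G"
  obtain N where "\<And>x i. i \<ge> N \<Longrightarrow> coeff (F x) i = 0" using poly_fam_bound[OF F] by blast
  then show ?thesis
    by (intro poly_famI[where N = N])
       (simp_all add: coeff_pderiv fun_alg.mult fun_alg.const poly_fam_coeff[OF F] del: of_nat_Suc)
qed

lemma poly_eq_sum_lessThan: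
  fixes p :: "'a::comm_semiring_1 poly"
  assumes "\<And>i. i \<ge> N \<Longrightarrow> coeff p i = 0"
  shows "poly p x = (\<Sum>i<N. coeff p i * x ^ i)"
proof -
  have "poly p x = (\<Sum>i\<le>degree p. coeff p i * x ^ i)" by (simp add: poly_altdef)
  also have "\<dots> = (\<Sum>i<max N (Suc (degree p)). coeff p i * x ^ i)"
    by (rule sum.mono_neutral_left) (auto simp: coeff_eq_0)
  also have "\<dots> = (\<Sum>i<N. coeff p i * x ^ i)"
    by (rule sum.mono_neutral_right) (auto simp: assms)
  finally show ?thesis .
qed

lemma poly_fam_eval:
  assumes "F \<in> poly_fam G" "u \<in> fun_alg G"
  shows "(\<lambda>x. poly (F x) (u x)) \<in> fun_alg G"
proof -
  obtain N where "\<And>x i. i \<ge> N \<Longrightarrow> coeff (F x) i = 0" using poly_fam_bound[OF assms(1)] by blast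
  then have "(\<lambda>x. poly (F x) (u x)) = (\<lambda>x. \<Sum>i<N. coeff (F x) i * u x ^ i)"
    by (intro ext poly_eq_sum_lessThan)
  then show ?thesis using assms by (auto intro!: fun_alg_intros poly_fam_coeff)
qed

text \<open>Here \<open>e\<close> is a formal degree of \<open>H\<close>, and
  \<open>coeff (H x) e\<close> may vanish at some \<open>x\<close>. So a power of it multiplies
  \<open>F x\<close> instead of being divided out, and quotient and remainder depend polynomially on
  \<open>x\<close>.\<close>

lemma poly_fam_pseudo_divide:
  assumes H: "H \<in> poly_fam G" and He: "\<And>x i. i > e \<Longrightarrow> coeff (H x) i = 0"
    and F: "F \<in> poly_fam G"
  shows "\<exists>k. \<exists>Q\<in>poly_fam G. \<exists>R\<in>poly_fam G. \<forall>x.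
    smult (coeff (H x) e ^ k) (F x) = Q x * H x + R x \<and> (\<forall>i\<ge>e. coeff (R x) i = 0)"
proof -
  obtain N where "\<And>x i. i \<ge> N \<Longrightarrow> coeff (F x) i = 0" using poly_fam_bound[OF F] by blast
  then show ?thesis using F
  proof (induction N arbitrary: F)
    case 0
    then have "\<And>x. F x = 0" by (simp add: poly_eq_iff)
    then show ?case by (intro exI[of _ 0] bexI[of _ "\<lambda>_. 0"]) (auto intro: poly_fam_const)
  next
    case (Suc M)
    show ?case
    proof (cases "M < e")
      case True
      then show ?thesis using Suc.prems
        by (intro exI[of _ 0] bexI[of _ "\<lambda>_. 0"] bexI[of _ F]) (auto intro: poly_fam_const)
    next
      case False
      \<comment> \<open>One division step: \<open>L\<close> is chosen so that the coefficients of
        degree \<open>M\<close> cancel in \<open>F'\<close>.\<close>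
      define L where "L x = monom (coeff (F x) M) (M - e)" for x
      define F' where "F' x = smult (coeff (H x) e) (F x) - L x * H x" for x
      have L: "L \<in> poly_fam G" unfolding L_def
        by (intro poly_fam_monom poly_fam_coeff Suc.prems)
      have F': "F' \<in> poly_fam G" unfolding F'_def
        by (intro poly_fam_diff poly_fam_smult poly_fam_mult L H poly_fam_coeff Suc.prems)
      have "coeff (F' x) i = 0" if "i \<ge> M" for x i
      proof (cases "i = M")
        case True
        then show ?thesis using False by (simp add: F'_def L_def coeff_monom_mult)
      next
        case False
        then have "i \<ge> Suc M" using that by simp
        moreover have "i - (M - e) > e" using \<open>\<not> M < e\<close> \<open>i \<ge> Suc M\<close> by simp
        ultimately show ?thesis
          using Suc.prems(1) He by (simp add: F'_def L_def coeff_monom_mult)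
      qed
      from Suc.IH[OF this F'] obtain k Q R where
        QR: "Q \<in> poly_fam G" "R \<in> poly_fam G"
        "\<And>x. smult (coeff (H x) e ^ k) (F' x) = Q x * H x + R x"
        "\<And>x i. i \<ge> e \<Longrightarrow> coeff (R x) i = 0" by blast
      let ?Q = "\<lambda>x. Q x + smult (coeff (H x) e ^ k) (L x)"
      have "?Q \<in> poly_fam G"
        by (intro poly_fam_add poly_fam_smult fun_alg_power poly_fam_coeff H L QR)
      moreover have "smult (coeff (H x) e ^ Suc k) (F x) = ?Q x * H x + R x" for x
      proof -
        have "smult (coeff (H x) e ^ Suc k) (F x) =
          smult (coeff (H x) e ^ k) (F' x) + smult (coeff (H x) e ^ k) (L x * H x)"
          by (simp add: F'_def smult_diff_right mult.commute)
        then show ?thesis using QR(3)[of x] by (simp add: algebra_simps)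
      qed
      ultimately show ?thesis using QR(2,4)
        by (intro exI[of _ "Suc k"] bexI[of _ ?Q] bexI[of _ R] allI conjI) auto
    qed
  qed
qed

lemma poly_fam_divide_monic:
  assumes "H \<in> poly_fam G" "F \<in> poly_fam G" and "\<And>x. degree (H x) = e" "\<And>x. lead_coeff (H x) = 1"
  shows "\<exists>Q\<in>poly_fam G. \<exists>R\<in>poly_fam G. \<forall>x. F x = Q x * H x + R x \<and> (\<forall>i\<ge>e. coeff (R x) i = 0)"
  using poly_fam_pseudo_divide[of H G e F] assms by (auto simp: coeff_eq_0)

text \<open>Adjoining a generator amounts to substituting it for a variable. \<open>F\<close> need
  not be unique, since \<open>g\<close> may satisfy relations over \<open>G\<close>.\<close>

lemma fun_alg_insert:
  assumes "u \<in> fun_alg (insert g G)"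
  shows "\<exists>F\<in>poly_fam G. \<forall>x. u x = poly (F x) (g x)"
  using assms
proof induction
  case (const c)
  show ?case by (rule bexI[of _ "\<lambda>_. [:c:]"]) (auto intro: poly_fam_const)
next
  case (gen h)
  then consider "h = g" | "h \<in> G" by blast
  then show ?case
  proof cases
    case 1
    then show ?thesis by (intro bexI[of _ "\<lambda>_. [:0, 1:]"]) (auto intro: poly_fam_const)
  next
    case 2
    then show ?thesis
      by (intro bexI[of _ "\<lambda>x. [:h x:]"]) (auto intro: poly_fam_pCons0 fun_alg.gen)
  qed
next
  case (add u v)
  then obtain P Q where "P \<in> poly_fam G" "Q \<in> poly_fam G"
    "\<forall>x. u x = poly (P x) (g x)" "\<forall>x. v x = poly (Q x) (g x)" by blast
  then show ?case by (intro bexI[of _ "\<lambda>x. P x + Q x"]) (auto intro: poly_fam_add)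
next
  case (mult u v)
  then obtain P Q where "P \<in> poly_fam G" "Q \<in> poly_fam G"
    "\<forall>x. u x = poly (P x) (g x)" "\<forall>x. v x = poly (Q x) (g x)" by blast
  then show ?case by (intro bexI[of _ "\<lambda>x. P x * Q x"]) (auto intro: poly_fam_mult)
qed

section \<open>Polynomials in the first variables\<close>

text \<open>The arguments are infinite sequences of which only the first \<open>d\<close> terms
  matter. Thus \<open>d\<close> can change inside a proof, and the points carry the product topology
  of sequences.\<close>

definition crd :: "nat \<Rightarrow> ((nat \<Rightarrow> complex) \<Rightarrow> complex) set" where
  "crd d = (\<lambda>i x. x i) ` {..<d}"

lemma crd_Suc: "crd (Suc d) = insert (\<lambda>x. x d) (crd d)"
  by (simp add: crd_def lessThan_Suc)

lemma crd_mono: "d \<le> e \<Longrightarrow> crd d \<subseteq> crd e"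
  by (auto simp: crd_def)

lemma crd_var: "i < d \<Longrightarrow> (\<lambda>x. x i) \<in> fun_alg (crd d)"
  by (auto simp: crd_def intro: fun_alg.gen)

lemma crd_local:
  assumes "u \<in> fun_alg (crd d)" and "\<And>i. i < d \<Longrightarrow> x i = y i"
  shows "u x = u y"
  using assms(1) by induction (auto simp: crd_def assms(2))

lemma poly_fam_crd_local:
  assumes "F \<in> poly_fam (crd d)" and "\<And>i. i < d \<Longrightarrow> x i = y i"
  shows "F x = F y"
  using crd_local[OF poly_fam_coeff[OF assms(1)] assms(2)] by (simp add: poly_eq_iff)

lemma crd_compose:
  assumes "u \<in> fun_alg (crd d)" and "\<And>i. i < d \<Longrightarrow> (\<lambda>y. \<phi> y i) \<in> fun_alg H"
  shows "(\<lambda>y. u (\<phi> y)) \<in> fun_alg H"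
  by (rule fun_alg_compose[OF assms(1)]) (auto simp: crd_def assms(2))

lemma crd_along_curve:
  assumes "u \<in> fun_alg (crd d)" and "\<And>i. i < d \<Longrightarrow> \<exists>P. \<forall>s. \<phi> s i = poly P s"
  shows "\<exists>P. \<forall>s. u (\<phi> s) = poly P s"
  by (rule fun_alg_along_curve[OF assms(1)]) (auto simp: crd_def assms(2))

lemma crd_along_line:
  assumes "u \<in> fun_alg (crd d)"
  shows "\<exists>P. \<forall>s. u (\<lambda>i. x i + s * v i) = poly P s"
proof (rule crd_along_curve[OF assms])
  show "\<exists>P. \<forall>s. x i + s * v i = poly P s" for i
    by (rule exI[of _ "[:x i, v i:]"]) simp
qed

lemma crd_continuous: "u \<in> fun_alg (crd d) \<Longrightarrow> continuous_on UNIV u"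
  by (erule fun_alg_continuous) (auto simp: crd_def intro: continuous_on_product_coordinates)

text \<open>On the line through a point where \<open>u\<close> is nonzero and one where
  \<open>v\<close> is nonzero, both are nonzero polynomials in one variable.\<close>

lemma crd_no_zero_divisors:
  assumes "u \<in> fun_alg (crd d)" "v \<in> fun_alg (crd d)" and uv: "\<And>x. u x * v x = 0"
  shows "(\<forall>x. u x = 0) \<or> (\<forall>x. v x = 0)"
proof (rule ccontr)
  assume "\<not> ?thesis"
  then obtain x y where xy: "u x \<noteq> 0" "v y \<noteq> 0" by blast
  obtain P where P: "\<And>s. u (\<lambda>i. x i + s * (y i - x i)) = poly P s"
    using crd_along_line[OF assms(1), of x "\<lambda>i. y i - x i"] by blast
  obtain Q where Q: "\<And>s. v (\<lambda>i. x i + s * (y i - x i)) = poly Q s"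
    using crd_along_line[OF assms(2), of x "\<lambda>i. y i - x i"] by blast
  have "poly (P * Q) s = 0" for s
    using uv[of "\<lambda>i. x i + s * (y i - x i)"] P Q by simp
  then have "P * Q = 0" using poly_all_0_iff_0 by blast
  moreover have "poly P 0 \<noteq> 0" "poly Q 1 \<noteq> 0" using P[of 0] Q[of 1] xy by simp_all
  ultimately show False by auto
qed

section \<open>Divisibility from bounded quotients\<close>

lemma linear_factor:
  fixes p :: "complex poly"
  assumes "degree p \<noteq> 0"
  obtains r q where "p = [:-r, 1:] * q" "q \<noteq> 0" "degree p = Suc (degree q)" "poly p r = 0"
proof -
  obtain r where r: "poly p r = 0"
    using assms fundamental_theorem_of_algebra_alt[of p] by (metis degree_pCons_0)
  then obtain q where p: "p = [:-r, 1:] * q" by (metis dvdE poly_eq_0_iff_dvd)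
  have "q \<noteq> 0" using assms p by auto
  then have "degree p = Suc (degree q)" unfolding p using degree_mult_eq[of "[:-r, 1:]" q] by simp
  with p \<open>q \<noteq> 0\<close> show ?thesis using r by (rule that)
qed

text \<open>Every root of \<open>Q\<close> is a root of \<open>P\<close>, so a common linear factor
  can be split off. The bound survives this away from the root by cancellation and at the root by
  continuity, and the degree of \<open>Q\<close> drops.\<close>

lemma poly_dvd_if_bounded_quotient:
  fixes P Q :: "complex poly" and B :: "complex \<Rightarrow> real"
  assumes "Q \<noteq> 0" and B: "continuous_on UNIV B"
    and "\<And>s. norm (poly P s) \<le> B s * norm (poly Q s)"
  shows "Q dvd P"
  using assms(1,3)
proof (induction "degree Q" arbitrary: P Q rule: less_induct)
  case less
  show ?case
  proof (cases "degree Q = 0")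
    case True
    then have "is_unit Q" using less.prems(1) by (simp add: is_unit_iff_degree)
    then show ?thesis by (rule unit_imp_dvd)
  next
    case False
    then obtain r Q' where Q: "Q = [:-r, 1:] * Q'" "Q' \<noteq> 0" "degree Q = Suc (degree Q')" "poly Q r = 0"
      by (rule linear_factor)
    have "poly P r = 0" using less.prems(2)[of r] Q(4) by simp
    then obtain P' where "P = [:-r, 1:] * P'" by (metis dvdE poly_eq_0_iff_dvd)
    note PQ = this Q(1)
    have le: "norm (poly P' s) \<le> B s * norm (poly Q' s)" if "s \<noteq> r" for s
    proof -
      have "poly P s = (s - r) * poly P' s" "poly Q s = (s - r) * poly Q' s"
        by (simp_all add: PQ algebra_simps)
      then have "norm (s - r) * norm (poly P' s) \<le> norm (s - r) * (B s * norm (poly Q' s))"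
        using less.prems(2)[of s] by (simp add: norm_mult mult.left_commute)
      then show ?thesis using that by simp
    qed
    have "Q' dvd P'"
    proof (rule less.hyps)
      show "Q' \<noteq> 0" "degree Q' < degree Q" using Q(2,3) by simp_all
      show "norm (poly P' s) \<le> B s * norm (poly Q' s)" for s
      proof (cases "s = r")
        case True
        have "isCont B r" using B by (simp add: continuous_on_eq_continuous_at)
        then have "((\<lambda>s. B s * norm (poly Q' s) - norm (poly P' s)) \<longlongrightarrow>
                    B r * norm (poly Q' r) - norm (poly P' r)) (at r)"
          by (intro tendsto_intros) (auto simp: isCont_def poly_isCont[unfolded isCont_def])
        moreover have "\<forall>\<^sub>F s in at r. 0 \<le> B s * norm (poly Q' s) - norm (poly P' s)"
          using le by (auto simp: eventually_at_filter)
        ultimately have "0 \<le> B r * norm (poly Q' r) - norm (poly P' r)"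
          by (rule tendsto_lowerbound) simp
        then show ?thesis using True by simp
      qed (use le in auto)
    qed
    then show ?thesis unfolding PQ by (rule mult_dvd_mono[OF dvd_refl])
  qed
qed

lemma degree_lessI_coeff:
  assumes "\<And>i. i \<ge> N \<Longrightarrow> coeff p i = 0" and "N > 0"
  shows "degree p < N"
proof (cases "p = 0")
  case False
  then have "coeff p (degree p) \<noteq> 0" by simp
  then show ?thesis using assms(1) not_less by blast
qed (use assms(2) in simp)

text \<open>
  A quotient of polynomials that is locally bounded is a polynomial: this is the form in which
  the normality of affine space enters.
\<close>

lemma crd_bounded_quotient:
  fixes B :: "(nat \<Rightarrow> complex) \<Rightarrow> real"
  assumes "P \<in> fun_alg (crd d)" "Q \<in> fun_alg (crd d)" and "\<exists>x. Q x \<noteq> 0"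
    and "continuous_on UNIV B" and "\<And>x. norm (P x) \<le> B x * norm (Q x)"
  shows "\<exists>T\<in>fun_alg (crd d). \<forall>x. P x = Q x * T x"
  using assms
proof (induction d arbitrary: P Q B)
  case 0
  have eq: "u x = u (\<lambda>_. 0)" if "u \<in> fun_alg (crd 0)" for u x
    by (rule crd_local[OF that]) simp
  obtain a where "Q a \<noteq> 0" using "0.prems"(3) by blast
  moreover have "P x = P a" "Q x = Q a" for x
    using eq[OF "0.prems"(1)] eq[OF "0.prems"(2)] by metis+
  ultimately have "\<forall>x. P x = Q x * (P a / Q a)" by (metis nonzero_mult_div_cancel_left times_divide_eq_right)
  then show ?case by (rule rev_bexI[OF fun_alg.const])
next
  case (Suc d)
  obtain PF QF where F: "PF \<in> poly_fam (crd d)" "QF \<in> poly_fam (crd d)"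
    "\<And>x. P x = poly (PF x) (x d)" "\<And>x. Q x = poly (QF x) (x d)"
    using fun_alg_insert[OF Suc.prems(1)[unfolded crd_Suc]]
      fun_alg_insert[OF Suc.prems(2)[unfolded crd_Suc]] by auto
  have upd: "PF (x(d := c)) = PF x" "QF (x(d := c)) = QF x" for x c
    using F(1,2) by (auto intro: poly_fam_crd_local)
  obtain N where N: "\<And>x i. i \<ge> N \<Longrightarrow> coeff (PF x) i = 0" using poly_fam_bound[OF F(1)] by blast
  obtain a where a: "Q a \<noteq> 0" using Suc.prems(3) by blast
  then have "QF a \<noteq> 0" using F(4) by auto
  then have "finite {s. poly (QF a) s = 0}" by (rule poly_roots_finite)
  then have "infinite (- {s. poly (QF a) s = 0})"
    using finite_compl infinite_UNIV_char_0[where 'a = complex] by metis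
  \<comment> \<open>Interpolation nodes: on each slice where the last variable equals
    \<open>c\<close>, \<open>Q\<close> is not identically zero, so the induction hypothesis applies
    there. \<open>N\<close> of them suffice because the coefficients of \<open>PF\<close> vanish
    from \<open>N\<close> on.\<close>
  then obtain C where C: "finite C" "card C = N" "C \<subseteq> - {s. poly (QF a) s = 0}"
    using infinite_arbitrarily_large[of _ N] by metis
  have "\<exists>T\<in>fun_alg (crd d). \<forall>x. poly (PF x) c = poly (QF x) c * T x" if "c \<in> C" for c
  proof (rule Suc.IH)
    show "(\<lambda>x. poly (PF x) c) \<in> fun_alg (crd d)" "(\<lambda>x. poly (QF x) c) \<in> fun_alg (crd d)"
      using F by (auto intro: poly_fam_eval fun_alg.const)
    show "\<exists>x. poly (QF x) c \<noteq> 0" using C(3) that by blast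
    show "continuous_on UNIV (\<lambda>x. B (x(d := c)))"
    proof (rule continuous_on_compose2[OF Suc.prems(4)])
      show "continuous_on UNIV (\<lambda>x. x(d := c))"
      proof (rule continuous_on_coordinatewise_then_product)
        show "continuous_on UNIV (\<lambda>x. (x(d := c)) i)" for i
          by (cases "i = d") (auto intro: continuous_on_product_coordinates)
      qed
    qed simp
    show "norm (poly (PF x) c) \<le> B (x(d := c)) * norm (poly (QF x) c)" for x
      using Suc.prems(5)[of "x(d := c)"] unfolding F(3,4) upd fun_upd_same .
  qed
  then obtain T where T: "\<And>c. c \<in> C \<Longrightarrow> T c \<in> fun_alg (crd d)"
    "\<And>c x. c \<in> C \<Longrightarrow> poly (PF x) c = poly (QF x) c * T c x" by metis
  \<comment> \<open>Lagrange interpolation, in the last variable, of the quotients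
    \<open>T c\<close> on the slices.\<close>
  define L where "L x = (\<Sum>c\<in>C. smult (T c x) (\<Prod>c'\<in>C - {c}. smult (1 / (c - c')) [:-c', 1:]))" for x
  have L: "L \<in> poly_fam (crd d)" unfolding L_def
    by (intro poly_fam_sum poly_fam_smult poly_fam_const T)
  have polyL: "poly (L x) c = T c x" if "c \<in> C" for x c
  proof -
    have "poly (\<Prod>c'\<in>C - {b}. smult (1 / (b - c')) [:-c', 1:]) c = (if b = c then 1 else 0)"
      if "b \<in> C" for b
    proof (cases "b = c")
      case True
      have "poly (smult (1 / (c - c')) [:-c', 1:]) c = 1" if "c' \<in> C - {c}" for c'
        using that by (auto simp: divide_simps)
      then show ?thesis using True unfolding poly_prod by (simp add: prod.neutral)
    next
      case False
      then show ?thesis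
        using \<open>c \<in> C\<close> C(1) unfolding poly_prod by (auto intro!: prod_zero)
    qed
    then have "poly (L x) c = (\<Sum>b\<in>C. T b x * (if b = c then 1 else 0))"
      by (simp add: L_def poly_sum cong: sum.cong)
    then show ?thesis using C(1) that by (simp add: if_distrib cong: if_cong)
  qed
  have degL: "degree (L x) < N" if "N > 0" for x
  proof -
    have "degree (L x) \<le> N - 1" unfolding L_def
    proof (rule degree_sum_le[OF C(1)])
      fix c assume c: "c \<in> C"
      have "degree (smult (T c x) (\<Prod>c'\<in>C - {c}. smult (1 / (c - c')) [:-c', 1:]))
        \<le> degree (\<Prod>c'\<in>C - {c}. smult (1 / (c - c')) [:-c', 1:])" by (rule degree_smult_le)
      also have "\<dots> \<le> (\<Sum>c'\<in>C - {c}. degree (smult (1 / (c - c')) [:-c', 1:]))"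
        by (rule degree_prod_sum_le[unfolded o_def, OF finite_Diff[OF C(1)]])
      also have "\<dots> \<le> (\<Sum>c'\<in>C - {c}. 1)" by (intro sum_mono) simp
      also have "\<dots> = N - 1" using c C by simp
      finally show "degree (smult (T c x) (\<Prod>c'\<in>C - {c}. smult (1 / (c - c')) [:-c', 1:])) \<le> N - 1" .
    qed
    then show ?thesis using that by simp
  qed
  define W where "W x = poly (L x) (x d)" for x
  have W: "W \<in> fun_alg (crd (Suc d))" unfolding W_def
    using poly_fam_mono[OF L] by (intro poly_fam_eval crd_var) (auto simp: crd_Suc)
  \<comment> \<open>For these \<open>x\<close> the result in one variable makes \<open>PF x\<close>
    a multiple of \<open>QF x\<close>. Unless \<open>N = 0\<close>, the quotient has degree below
    \<open>N\<close> and the values \<open>T c x\<close> at the nodes, so it is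
    \<open>L x\<close>.\<close>
  have generic: "P x = Q x * W x" if ne: "\<And>c. c \<in> C \<Longrightarrow> poly (QF x) c \<noteq> 0" for x
  proof (cases "N = 0")
    case True
    then have "PF x = 0" "C = {}" using N C by (auto simp: poly_eq_iff)
    then show ?thesis by (simp add: F W_def L_def)
  next
    case False
    then obtain c0 where "c0 \<in> C" using C by fastforce
    then have q: "QF x \<noteq> 0" using ne by auto
    have "QF x dvd PF x"
    proof (rule poly_dvd_if_bounded_quotient[OF q, where B = "\<lambda>s. B (x(d := s))"])
      show "continuous_on UNIV (\<lambda>s. B (x(d := s)))"
      proof (rule continuous_on_compose2[OF Suc.prems(4)])
        show "continuous_on UNIV (\<lambda>s. x(d := s))"
        proof (rule continuous_on_coordinatewise_then_product)
          show "continuous_on UNIV (\<lambda>s. (x(d := s)) i)" for i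
            by (cases "i = d") auto
        qed
      qed simp
      show "norm (poly (PF x) s) \<le> B (x(d := s)) * norm (poly (QF x) s)" for s
        using Suc.prems(5)[of "x(d := s)"] unfolding F(3,4) upd fun_upd_same .
    qed
    then obtain t where t: "PF x = QF x * t" by blast
    have "degree (PF x) < N" using N False by (intro degree_lessI_coeff) auto
    then have "degree t < N"
      using t q False by (cases "t = 0") (auto simp: degree_mult_eq)
    moreover have "poly t c = poly (L x) c" if "c \<in> C" for c
      using T(2)[OF that, of x] ne[OF that] polyL[OF that] t by simp
    ultimately have "t = L x" using degL False C by (intro poly_eqI_degree[of C]) auto
    then show ?thesis by (simp add: F W_def t)
  qed
  define D where "D x = P x - Q x * W x" for x
  have D: "D \<in> fun_alg (crd (Suc d))" unfolding D_def
    by (intro fun_alg_intros Suc.prems W)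
  \<comment> \<open>This product is nonzero exactly at the \<open>x\<close> covered by
    \<open>generic\<close>; as it is not identically zero, the identity extends to all
    \<open>x\<close>.\<close>
  define M where "M x = (\<Prod>c\<in>C. poly (QF x) c)" for x
  have M: "M \<in> fun_alg (crd (Suc d))" unfolding M_def
    using poly_fam_mono[OF F(2)] by (intro fun_alg_intros poly_fam_eval) (auto simp: crd_Suc)
  have "M a \<noteq> 0" using C by (auto simp: M_def)
  moreover have "D x * M x = 0" for x
  proof (cases "M x = 0")
    case False
    then show ?thesis using generic[of x] C(1) by (auto simp: M_def D_def)
  qed simp
  ultimately have "\<forall>x. D x = 0" using crd_no_zero_divisors[OF D M] by blast
  then show ?case using W by (auto simp: D_def)
qed

section \<open>Monomials\<close>

text \<open>Grouping by the power of a new variable \<open>v\<close> gives a polynomial in one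
  variable that vanishes everywhere, so each group vanishes by itself. The exponents within a group
  are still told apart by the remaining variables.\<close>

lemma monomials_independent:
  fixes c :: "(nat \<Rightarrow> nat) \<Rightarrow> complex"
  assumes "finite V" "finite K" and "\<And>\<alpha> \<beta>. \<alpha> \<in> K \<Longrightarrow> \<beta> \<in> K \<Longrightarrow> (\<forall>i\<in>V. \<alpha> i = \<beta> i) \<Longrightarrow> \<alpha> = \<beta>"
    and "\<And>x. (\<Sum>\<alpha>\<in>K. c \<alpha> * (\<Prod>i\<in>V. x i ^ \<alpha> i)) = 0" and "\<alpha> \<in> K"
  shows "c \<alpha> = 0"
  using assms
proof (induction V arbitrary: K \<alpha> rule: finite_induct)
  case empty
  then have "K = {\<alpha>}" by auto
  then show ?case using empty.prems(3) by simp
next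
  case (insert v V)
  define K' where "K' = {\<beta>\<in>K. \<beta> v = \<alpha> v}"
  show ?case
  proof (rule insert.IH)
    show "finite K'" "\<alpha> \<in> K'" using insert.prems by (auto simp: K'_def)
    show "\<beta> = \<gamma>" if "\<beta> \<in> K'" "\<gamma> \<in> K'" "\<forall>i\<in>V. \<beta> i = \<gamma> i" for \<beta> \<gamma>
      using that insert.prems(2) by (auto simp: K'_def)
    show "(\<Sum>\<alpha>\<in>K'. c \<alpha> * (\<Prod>i\<in>V. x i ^ \<alpha> i)) = 0" for x
    proof -
      define p where "p = (\<Sum>\<beta>\<in>K. monom (c \<beta> * (\<Prod>i\<in>V. x i ^ \<beta> i)) (\<beta> v))"
      have "poly p y = 0" for y
      proof -
        have "(\<Prod>i\<in>V. (x(v := y)) i ^ \<beta> i) = (\<Prod>i\<in>V. x i ^ \<beta> i)" for \<beta>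
          using insert.hyps(2) by (intro prod.cong) auto
        then show ?thesis
          using insert.prems(3)[of "x(v := y)"] insert.hyps
          by (simp add: p_def poly_sum poly_monom mult_ac)
      qed
      then have "p = 0" using poly_all_0_iff_0 by blast
      then have "coeff p (\<alpha> v) = 0" by simp
      then show ?thesis
        unfolding p_def coeff_sum coeff_monom K'_def sum.inter_filter[OF insert.prems(1)] .
    qed
  qed
qed

section \<open>Evaluation of formal polynomials\<close>

definition monom_eval :: "('i \<Rightarrow>\<^sub>0 nat) \<Rightarrow> ('i \<Rightarrow> complex) \<Rightarrow> complex" where
  "monom_eval m x = (\<Prod>i\<in>Poly_Mapping.keys m. x i ^ Poly_Mapping.lookup m i)"

lemma monom_eval_superset:
  assumes "finite J" "Poly_Mapping.keys m \<subseteq> J"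
  shows "monom_eval m x = (\<Prod>i\<in>J. x i ^ Poly_Mapping.lookup m i)"
  unfolding monom_eval_def using assms
  by (intro prod.mono_neutral_left) (auto simp: in_keys_iff)

lemma monom_eval_add: "monom_eval (m + m') x = monom_eval m x * monom_eval m' x"
proof -
  let ?J = "Poly_Mapping.keys m \<union> Poly_Mapping.keys m'"
  have "Poly_Mapping.keys (m + m') \<subseteq> ?J" by (rule keys_add)
  then show ?thesis
    by (simp add: monom_eval_superset[of ?J] lookup_add power_add prod.distrib)
qed

lemma peval_superset:
  assumes "finite K" "Poly_Mapping.keys p \<subseteq> K"
  shows "peval p x = (\<Sum>m\<in>K. Poly_Mapping.lookup p m * monom_eval m x)"
  unfolding peval_def monom_eval_def[symmetric] using assms
  by (intro sum.mono_neutral_left) (auto simp: in_keys_iff)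

lemma peval_add: "peval (p + q) x = peval p x + peval q x"
proof -
  let ?K = "Poly_Mapping.keys p \<union> Poly_Mapping.keys q"
  have "Poly_Mapping.keys (p + q) \<subseteq> ?K" by (rule keys_add)
  then show ?thesis
    by (simp add: peval_superset[of ?K] lookup_add sum.distrib distrib_right)
qed

lemma peval_0 [simp]: "peval 0 x = 0"
  by (simp add: peval_def)

lemma peval_sum: "peval (\<Sum>i\<in>I. p i) x = (\<Sum>i\<in>I. peval (p i) x)"
  by (induction I rule: infinite_finite_induct) (auto simp: peval_add)

lemma peval_single: "peval (Poly_Mapping.single m c) x = c * monom_eval m x"
  by (subst peval_superset[of "{m}"]) auto

lemma poly_mapping_as_sum:
  "p = (\<Sum>m\<in>Poly_Mapping.keys p. Poly_Mapping.single m (Poly_Mapping.lookup p m))"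
  by (rule poly_mapping_eqI)
     (auto simp: lookup_sum lookup_single when_def in_keys_iff if_distrib cong: if_cong)

lemma peval_mult: "peval (p * q) x = peval p x * peval q x"
proof -
  have "p * q = (\<Sum>m\<in>Poly_Mapping.keys p. \<Sum>m'\<in>Poly_Mapping.keys q.
    Poly_Mapping.single (m + m') (Poly_Mapping.lookup p m * Poly_Mapping.lookup q m'))"
    using sum_product[of "\<lambda>m. Poly_Mapping.single m (Poly_Mapping.lookup p m)" "Poly_Mapping.keys p"
        "\<lambda>m. Poly_Mapping.single m (Poly_Mapping.lookup q m)" "Poly_Mapping.keys q"]
    by (simp add: mult_single flip: poly_mapping_as_sum)
  then have "peval (p * q) x = (\<Sum>m\<in>Poly_Mapping.keys p. \<Sum>m'\<in>Poly_Mapping.keys q.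
    (Poly_Mapping.lookup p m * Poly_Mapping.lookup q m') * (monom_eval m x * monom_eval m' x))"
    by (simp add: peval_sum peval_single monom_eval_add)
  also have "\<dots> = peval p x * peval q x"
    by (simp add: peval_def monom_eval_def[symmetric] sum_product mult_ac)
  finally show ?thesis .
qed

lemma peval_in_fun_alg:
  assumes "\<And>m. m \<in> Poly_Mapping.keys p \<Longrightarrow> Poly_Mapping.keys m \<subseteq> J"
  shows "peval p \<in> fun_alg ((\<lambda>i x. x i) ` J)"
proof -
  have "peval p = (\<lambda>x. \<Sum>m\<in>Poly_Mapping.keys p.
     Poly_Mapping.lookup p m * (\<Prod>i\<in>Poly_Mapping.keys m. x i ^ Poly_Mapping.lookup m i))"
    by (rule ext) (simp add: peval_def)
  also have "\<dots> \<in> fun_alg ((\<lambda>i x. x i) ` J)"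
    using assms by (intro fun_alg_intros) (auto intro: fun_alg.gen)
  finally show ?thesis .
qed

text \<open>The way back to formal polynomials keeps track of the variables that occur, since
  algebraic independence speaks of polynomials in \<open>d\<close> indeterminates.\<close>

lemma fun_alg_imp_peval:
  assumes "u \<in> fun_alg ((\<lambda>i x. x i) ` J)"
  shows "\<exists>p. u = peval p \<and> (\<forall>m\<in>Poly_Mapping.keys p. Poly_Mapping.keys m \<subseteq> J)"
  using assms
proof induction
  case (const c)
  show ?case
    by (rule exI[of _ "Poly_Mapping.single 0 c"]) (auto simp: peval_single monom_eval_def)
next
  case (gen u)
  then obtain i where "i \<in> J" "u = (\<lambda>x. x i)" by blast
  then show ?case
    by (intro exI[of _ "Poly_Mapping.single (Poly_Mapping.single i 1) 1"])
       (auto simp: peval_single monom_eval_def)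
next
  case (add u v)
  then obtain p q where "u = peval p" "v = peval q"
    "\<forall>m\<in>Poly_Mapping.keys p. Poly_Mapping.keys m \<subseteq> J"
    "\<forall>m\<in>Poly_Mapping.keys q. Poly_Mapping.keys m \<subseteq> J" by blast
  then show ?case using keys_add[of p q]
    by (intro exI[of _ "p + q"]) (auto simp: peval_add)
next
  case (mult u v)
  then obtain p q where pq: "u = peval p" "v = peval q"
    "\<forall>m\<in>Poly_Mapping.keys p. Poly_Mapping.keys m \<subseteq> J"
    "\<forall>m\<in>Poly_Mapping.keys q. Poly_Mapping.keys m \<subseteq> J" by blast
  have "Poly_Mapping.keys m \<subseteq> J" if "m \<in> Poly_Mapping.keys (p * q)" for m
  proof -
    have "m \<in> {a + b |a b. a \<in> Poly_Mapping.keys p \<and> b \<in> Poly_Mapping.keys q}"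
      using keys_mult that by (rule subsetD)
    then obtain a b where "m = a + b" "a \<in> Poly_Mapping.keys p" "b \<in> Poly_Mapping.keys q"
      by auto
    then show ?thesis using pq(3,4) keys_add[of a b] by blast
  qed
  then show ?case using pq by (intro exI[of _ "p * q"]) (auto simp: peval_mult)
qed

lemma peval_crd:
  fixes q :: "nat cpoly"
  assumes "\<forall>m\<in>Poly_Mapping.keys q. Poly_Mapping.keys m \<subseteq> {..<d}"
  shows "peval q x = (\<Sum>m\<in>Poly_Mapping.keys q. Poly_Mapping.lookup q m * (\<Prod>i<d. x i ^ Poly_Mapping.lookup m i))"
proof -
  have "monom_eval m x = (\<Prod>i<d. x i ^ Poly_Mapping.lookup m i)" if "m \<in> Poly_Mapping.keys q" for m
    using assms that by (intro monom_eval_superset) auto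
  then show ?thesis by (simp add: peval_superset[of "Poly_Mapping.keys q"] cong: sum.cong)
qed

text \<open>Evaluation is injective by the independence of monomials. As exponents are functions
  there, the coefficients are transported along the injective
  \<open>Poly_Mapping.lookup\<close>.\<close>

lemma peval_eq_0_imp:
  fixes q :: "nat cpoly"
  assumes "\<forall>m\<in>Poly_Mapping.keys q. Poly_Mapping.keys m \<subseteq> {..<d}" and "\<And>x. peval q x = 0"
  shows "q = 0"
proof (rule ccontr)
  assume "q \<noteq> 0"
  then obtain m where m: "m \<in> Poly_Mapping.keys q" by (metis keys_eq_empty ex_in_conv)
  have inj: "inj_on Poly_Mapping.lookup (Poly_Mapping.keys q)" by (rule inj_onI) (rule poly_mapping_eqI, simp)
  have "Poly_Mapping.lookup q (the_inv_into (Poly_Mapping.keys q) Poly_Mapping.lookup (Poly_Mapping.lookup m)) = 0"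
  proof (rule monomials_independent[where V = "{..<d}" and K = "Poly_Mapping.lookup ` Poly_Mapping.keys q" and
      c = "\<lambda>\<alpha>. Poly_Mapping.lookup q (the_inv_into (Poly_Mapping.keys q) Poly_Mapping.lookup \<alpha>)"])
    fix \<alpha> \<beta> assume "\<alpha> \<in> Poly_Mapping.lookup ` Poly_Mapping.keys q"
      "\<beta> \<in> Poly_Mapping.lookup ` Poly_Mapping.keys q" and eq: "\<forall>i\<in>{..<d}. \<alpha> i = \<beta> i"
    then obtain a b where ab: "\<alpha> = Poly_Mapping.lookup a" "\<beta> = Poly_Mapping.lookup b"
      "a \<in> Poly_Mapping.keys q" "b \<in> Poly_Mapping.keys q" by blast
    show "\<alpha> = \<beta>"
    proof
      fix i
      have "i \<notin> Poly_Mapping.keys a" "i \<notin> Poly_Mapping.keys b" if "\<not> i < d"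
        using assms(1) ab(3,4) that by blast+
      then show "\<alpha> i = \<beta> i" using eq ab by (cases "i < d") (auto simp: in_keys_iff)
    qed
  next
    show "(\<Sum>\<alpha>\<in>Poly_Mapping.lookup ` Poly_Mapping.keys q.
      Poly_Mapping.lookup q (the_inv_into (Poly_Mapping.keys q) Poly_Mapping.lookup \<alpha>) * (\<Prod>i<d. x i ^ \<alpha> i)) = 0" for x
      using assms(2)[of x] peval_crd[OF assms(1), of x]
      by (simp add: sum.reindex[OF inj] the_inv_into_f_f[OF inj])
  qed (use m in auto)
  then show False using m by (simp add: the_inv_into_f_f[OF inj] in_keys_iff)
qed

text \<open>All coefficients are nonzero, so that the homogeneous part of top degree can be read off
  from the exponents and is seen to be nonzero.\<close>

lemma crd_monomials:
  assumes "u \<in> fun_alg (crd d)"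
  shows "\<exists>K c. finite K \<and> (\<forall>\<alpha>\<in>K. \<forall>i\<ge>d. \<alpha> i = 0) \<and> (\<forall>\<alpha>\<in>K. c \<alpha> \<noteq> 0) \<and>
    (\<forall>x. u x = (\<Sum>\<alpha>\<in>K. c \<alpha> * (\<Prod>i<d. x i ^ \<alpha> i)))"
proof -
  obtain q where q: "u = peval q" "\<forall>m\<in>Poly_Mapping.keys q. Poly_Mapping.keys m \<subseteq> {..<d}"
    using fun_alg_imp_peval assms unfolding crd_def by blast
  have inj: "inj_on Poly_Mapping.lookup (Poly_Mapping.keys q)" by (rule inj_onI) (rule poly_mapping_eqI, simp)
  let ?K = "Poly_Mapping.lookup ` Poly_Mapping.keys q"
  let ?c = "\<lambda>\<alpha>. Poly_Mapping.lookup q (the_inv_into (Poly_Mapping.keys q) Poly_Mapping.lookup \<alpha>)"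
  have "\<forall>x. u x = (\<Sum>\<alpha>\<in>?K. ?c \<alpha> * (\<Prod>i<d. x i ^ \<alpha> i))"
    by (simp add: q(1) peval_crd[OF q(2)] sum.reindex[OF inj] the_inv_into_f_f[OF inj])
  moreover have "\<forall>\<alpha>\<in>?K. \<forall>i\<ge>d. \<alpha> i = 0"
  proof (intro ballI allI impI)
    fix \<alpha> i assume "\<alpha> \<in> ?K" "d \<le> i"
    then obtain m where "m \<in> Poly_Mapping.keys q" "\<alpha> = Poly_Mapping.lookup m" by blast
    moreover from this have "i \<notin> Poly_Mapping.keys m" using q(2) \<open>d \<le> i\<close> by force
    ultimately show "\<alpha> i = 0" by (simp add: in_keys_iff)
  qed
  moreover have "\<forall>\<alpha>\<in>?K. ?c \<alpha> \<noteq> 0" by (auto simp: the_inv_into_f_f[OF inj] in_keys_iff)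
  ultimately show ?thesis by (intro exI[of _ ?K] exI[of _ ?c]) auto
qed

section \<open>Top coefficients and monic directions\<close>

lemma coeff_mult_at_bounds:
  assumes "degree p \<le> m" "degree q \<le> n"
  shows "coeff (p * q) (m + n) = coeff p m * coeff q n"
proof -
  have "coeff (p * q) (m + n) = (\<Sum>i\<in>{m}. coeff p i * coeff q (m + n - i))"
    unfolding coeff_mult
  proof (rule sum.mono_neutral_right)
    show "\<forall>i\<in>{..m + n} - {m}. coeff p i * coeff q (m + n - i) = 0"
    proof
      fix i assume "i \<in> {..m + n} - {m}"
      then have "i > m \<or> m + n - i > n" by auto
      then show "coeff p i * coeff q (m + n - i) = 0"
        using assms by (metis coeff_eq_0 le_less_trans mult_zero_left mult_zero_right)
    qed
  qed auto
  then show ?thesis by simp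
qed

text \<open>Bounds \<open>n i\<close> replace degrees: the coefficient at the sum of the bounds is
  multiplicative even if some factor has smaller degree, as happens when an entry of a direction
  vector is 0.\<close>

lemma coeff_prod_at_bounds:
  assumes "\<And>i. i \<in> I \<Longrightarrow> degree (p i) \<le> n i"
  shows "degree (\<Prod>i\<in>I. p i) \<le> (\<Sum>i\<in>I. n i) \<and>
         coeff (\<Prod>i\<in>I. p i) (\<Sum>i\<in>I. n i) = (\<Prod>i\<in>I. coeff (p i) (n i))"
  using assms
proof (induction I rule: infinite_finite_induct)
  case (insert j I)
  then have IH: "degree (\<Prod>i\<in>I. p i) \<le> (\<Sum>i\<in>I. n i)"
    "coeff (\<Prod>i\<in>I. p i) (\<Sum>i\<in>I. n i) = (\<Prod>i\<in>I. coeff (p i) (n i))" and j: "degree (p j) \<le> n j"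
    by auto
  have "degree (p j * (\<Prod>i\<in>I. p i)) \<le> n j + (\<Sum>i\<in>I. n i)"
    using degree_mult_le[of "p j" "\<Prod>i\<in>I. p i"] IH(1) j by linarith
  then show ?case using insert.hyps IH coeff_mult_at_bounds[OF j IH(1)] by simp
qed auto

lemma coeff_power_at_bound:
  assumes "degree p \<le> 1"
  shows "degree (p ^ k) \<le> k \<and> coeff (p ^ k) k = coeff p 1 ^ k"
  using coeff_prod_at_bounds[of "{..<k}" "\<lambda>_. p" "\<lambda>_. 1"] assms by simp

text \<open>
  The direction \<open>v\<close> is one in which the top homogeneous part of \<open>q\<close> does not vanish.
\<close>

lemma crd_monic_direction:
  assumes q: "q \<in> fun_alg (crd (Suc d))" and "\<exists>x. q x \<noteq> 0"
  shows "\<exists>v r b. \<exists>F\<in>poly_fam (crd d). v d = 1 \<and> b \<noteq> 0 \<and>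
    (\<forall>x s. q (\<lambda>i. (if i = d then 0 else x i) + s * v i) = poly (F x) s) \<and>
    (\<forall>x. degree (F x) = r \<and> lead_coeff (F x) = b)"
proof -
  obtain K c where K: "finite K" "\<forall>\<alpha>\<in>K. \<forall>i\<ge>Suc d. \<alpha> i = 0" "\<forall>\<alpha>\<in>K. c \<alpha> \<noteq> 0"
    "\<And>x. q x = (\<Sum>\<alpha>\<in>K. c \<alpha> * (\<Prod>i<Suc d. x i ^ \<alpha> i))"
    using crd_monomials[OF q] by blast
  define N where "N \<alpha> = (\<Sum>i<Suc d. \<alpha> i)" for \<alpha> :: "nat \<Rightarrow> nat"
  have "K \<noteq> {}" using assms(2) K(4) by auto
  define r where "r = Max (N ` K)"
  have r: "N \<alpha> \<le> r" if "\<alpha> \<in> K" for \<alpha> using K(1) that by (simp add: r_def)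
  obtain \<alpha>0 where \<alpha>0: "\<alpha>0 \<in> K" "N \<alpha>0 = r"
    using Max_in[of "N ` K"] K(1) \<open>K \<noteq> {}\<close> unfolding r_def by fastforce
  define K' where "K' = {\<alpha>\<in>K. N \<alpha> = r}"
  define g where "g x = (\<Sum>\<alpha>\<in>K'. c \<alpha> * (\<Prod>i<Suc d. x i ^ \<alpha> i))" for x
  have g: "g \<in> fun_alg (crd (Suc d))" unfolding g_def
    by (intro fun_alg_intros crd_var) auto
  have "\<not> (\<forall>x. g x = 0)"
  proof
    assume "\<forall>x. g x = 0"
    then have "c \<alpha>0 = 0"
    proof (intro monomials_independent[of "{..<Suc d}" K' c \<alpha>0])
      fix \<alpha> \<beta> assume *: "\<alpha> \<in> K'" "\<beta> \<in> K'" "\<forall>i\<in>{..<Suc d}. \<alpha> i = \<beta> i"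
      show "\<alpha> = \<beta>"
      proof
        have "\<alpha> i = 0 \<and> \<beta> i = 0" if "i \<ge> Suc d" for i using * K(2) that by (auto simp: K'_def)
        then show "\<alpha> i = \<beta> i" for i using *(3) by (metis lessThan_iff not_less)
      qed
    qed (use K(1) \<alpha>0 in \<open>auto simp: K'_def g_def\<close>)
    then show False using K(3) \<alpha>0(1) by blast
  qed
  moreover have "\<not> (\<forall>x::nat \<Rightarrow> complex. x d = 0)"
    by (auto intro!: exI[of _ "\<lambda>_. 1"])
  \<comment> \<open>\<open>w d\<close> has to be nonzero as well, so that \<open>w\<close> can be
    scaled to \<open>v d = 1\<close>. Since \<open>g\<close> is homogeneous of degree
    \<open>r\<close>, it stays nonzero.\<close>
  ultimately obtain w where w: "g w * w d \<noteq> 0"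
    using crd_no_zero_divisors[OF g, of "\<lambda>x. x d"] crd_var[of d "Suc d"] by blast
  define v where "v i = w i / w d" for i
  have "g w = w d ^ r * g v"
  proof -
    have "(\<Prod>i<Suc d. w i ^ \<alpha> i) = w d ^ r * (\<Prod>i<Suc d. v i ^ \<alpha> i)" if "\<alpha> \<in> K'" for \<alpha>
    proof -
      have "(\<Prod>i<Suc d. w i ^ \<alpha> i) = (\<Prod>i<Suc d. w d ^ \<alpha> i * v i ^ \<alpha> i)"
        using w by (intro prod.cong) (auto simp: v_def power_divide)
      also have "\<dots> = w d ^ (\<Sum>i<Suc d. \<alpha> i) * (\<Prod>i<Suc d. v i ^ \<alpha> i)"
        unfolding prod.distrib power_sum ..
      also have "(\<Sum>i<Suc d. \<alpha> i) = r" using that by (simp add: K'_def N_def)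
      finally show ?thesis .
    qed
    then show ?thesis unfolding g_def by (simp add: sum_distrib_left mult_ac del: prod.lessThan_Suc)
  qed
  then have b: "g v \<noteq> 0" using w by auto
  have vd: "v d = 1" using w by (simp add: v_def)
  \<comment> \<open>Coordinate \<open>i\<close> of the line in direction \<open>v\<close> through
    \<open>x\<close> with entry \<open>d\<close> set to 0, as a polynomial in the line parameter.
    Only the linear coefficient \<open>v i\<close>, free of \<open>x\<close>, enters the top
    coefficient, so the leading coefficient of \<open>F x\<close> is the constant
    \<open>g v\<close>.\<close>
  define L where "L i x = [:if i = d then 0 else x i, v i:]" for i :: nat and x :: "nat \<Rightarrow> complex"
  define F where "F x = (\<Sum>\<alpha>\<in>K. smult (c \<alpha>) (\<Prod>i<Suc d. L i x ^ \<alpha> i))" for x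
  have Lfam: "(\<lambda>x. L i x) \<in> poly_fam (crd d)" if "i < Suc d" for i
  proof -
    have "(\<lambda>x. L i x) = (\<lambda>x. [:if i = d then 0 else x i:] + [:0, v i:])" by (simp add: L_def)
    also have "\<dots> \<in> poly_fam (crd d)"
      using that crd_var[of i d]
      by (cases "i = d") (auto intro!: poly_fam_add poly_fam_const poly_fam_pCons0 simp del: add_pCons)
    finally show ?thesis .
  qed
  have "(\<lambda>x. L i x ^ k) \<in> poly_fam (crd d)" if "i < Suc d" for i k
    using poly_fam_prod[of "{..<k}" "\<lambda>_. L i"] Lfam[OF that] by simp
  then have F: "F \<in> poly_fam (crd d)" unfolding F_def
    by (intro poly_fam_sum poly_fam_smult poly_fam_prod fun_alg.const) auto
  have ev: "q (\<lambda>i. (if i = d then 0 else x i) + s * v i) = poly (F x) s" for x s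
    by (simp add: K(4) F_def poly_sum poly_prod poly_power L_def del: prod.lessThan_Suc)
  have mon: "degree (\<Prod>i<Suc d. L i x ^ \<alpha> i) \<le> N \<alpha> \<and>
    coeff (\<Prod>i<Suc d. L i x ^ \<alpha> i) (N \<alpha>) = (\<Prod>i<Suc d. v i ^ \<alpha> i)" for x \<alpha>
  proof -
    have "degree (L i x ^ \<alpha> i) \<le> \<alpha> i \<and> coeff (L i x ^ \<alpha> i) (\<alpha> i) = v i ^ \<alpha> i" for i
      using coeff_power_at_bound[of "L i x" "\<alpha> i"] by (simp add: L_def)
    then show ?thesis
      using coeff_prod_at_bounds[of "{..<Suc d}" "\<lambda>i. L i x ^ \<alpha> i" \<alpha>] by (simp add: N_def del: prod.lessThan_Suc)
  qed
  have deg: "degree (F x) \<le> r" for x unfolding F_def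
  proof (rule degree_sum_le[OF K(1)])
    show "degree (smult (c \<alpha>) (\<Prod>i<Suc d. L i x ^ \<alpha> i)) \<le> r" if "\<alpha> \<in> K" for \<alpha>
      using mon[of x \<alpha>] r[OF that] degree_smult_le[of "c \<alpha>"] by (meson order_trans)
  qed
  have top: "coeff (F x) r = g v" for x
  proof -
    have "coeff (F x) r = (\<Sum>\<alpha>\<in>K. c \<alpha> * coeff (\<Prod>i<Suc d. L i x ^ \<alpha> i) r)"
      by (simp add: F_def coeff_sum del: prod.lessThan_Suc)
    also have "\<dots> = (\<Sum>\<alpha>\<in>K. if N \<alpha> = r then c \<alpha> * (\<Prod>i<Suc d. v i ^ \<alpha> i) else 0)"
    proof (rule sum.cong[OF refl])
      fix \<alpha> assume \<alpha>: "\<alpha> \<in> K"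
      have "coeff (\<Prod>i<Suc d. L i x ^ \<alpha> i) r = 0" if "N \<alpha> \<noteq> r"
        using mon[of x \<alpha>] r[OF \<alpha>] that by (intro coeff_eq_0) linarith
      then show "c \<alpha> * coeff (\<Prod>i<Suc d. L i x ^ \<alpha> i) r =
        (if N \<alpha> = r then c \<alpha> * (\<Prod>i<Suc d. v i ^ \<alpha> i) else 0)" using mon[of x \<alpha>] by auto
    qed
    also have "\<dots> = g v" unfolding g_def K'_def sum.inter_filter[OF K(1)] ..
    finally show ?thesis .
  qed
  have "degree (F x) = r" for x
    using deg[of x] top[of x] b by (metis le_antisym le_degree)
  then show ?thesis using F vd b ev top
    by (intro exI[of _ v] exI[of _ r] exI[of _ "g v"] bexI[of _ F]) auto
qed

section \<open>Hilbert's basis theorem\<close>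

definition fun_ideal :: "('p \<Rightarrow> complex) set \<Rightarrow> nat \<Rightarrow> (nat \<Rightarrow> 'p \<Rightarrow> complex) \<Rightarrow> ('p \<Rightarrow> complex) set" where
  "fun_ideal G m p = {\<lambda>x. \<Sum>i<m. u i x * p i x | u. \<forall>i. u i \<in> fun_alg G}"

text \<open>Equivalent to all ideals being finitely generated. A sequence of elements is what
  Hilbert's argument and a descending chain of varieties produce.\<close>

definition noetherian :: "('p \<Rightarrow> complex) set \<Rightarrow> bool" where
  "noetherian G \<longleftrightarrow> (\<forall>p. (\<forall>i. p i \<in> fun_alg G) \<longrightarrow> (\<exists>m. p m \<in> fun_ideal G m p))"

lemma fun_idealI: "(\<And>i. u i \<in> fun_alg G) \<Longrightarrow> (\<lambda>x. \<Sum>i<m. u i x * p i x) \<in> fun_ideal G m p"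
  by (auto simp: fun_ideal_def)

lemma fun_ideal_cong: "(\<And>i. i < m \<Longrightarrow> p i = q i) \<Longrightarrow> fun_ideal G m p = fun_ideal G m q"
  by (simp add: fun_ideal_def)

lemma fun_ideal_mono:
  assumes "m \<le> n"
  shows "fun_ideal G m p \<subseteq> fun_ideal G n p"
proof
  fix w assume "w \<in> fun_ideal G m p"
  then obtain u where u: "\<forall>i. u i \<in> fun_alg G" "w = (\<lambda>x. \<Sum>i<m. u i x * p i x)"
    by (auto simp: fun_ideal_def)
  have "w = (\<lambda>x. \<Sum>i<n. (if i < m then u i x else 0) * p i x)"
  proof
    fix x
    show "w x = (\<Sum>i<n. (if i < m then u i x else 0) * p i x)"
      unfolding u(2) using assms by (intro sum.mono_neutral_cong_left) auto
  qed
  also have "\<dots> \<in> fun_ideal G n p"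
    using u(1) by (intro fun_idealI fun_alg_if fun_alg.const) auto
  finally show "w \<in> fun_ideal G n p" .
qed

lemma fun_ideal_zero: "(\<lambda>_. 0) \<in> fun_ideal G m p"
  using fun_idealI[of "\<lambda>_ _. 0" G p m] by (simp add: fun_alg.const)

lemma fun_ideal_add: "v \<in> fun_ideal G m p \<Longrightarrow> w \<in> fun_ideal G m p \<Longrightarrow> (\<lambda>x. v x + w x) \<in> fun_ideal G m p"
proof -
  assume "v \<in> fun_ideal G m p" "w \<in> fun_ideal G m p"
  then obtain a b where "\<forall>i. a i \<in> fun_alg G" "v = (\<lambda>x. \<Sum>i<m. a i x * p i x)"
    "\<forall>i. b i \<in> fun_alg G" "w = (\<lambda>x. \<Sum>i<m. b i x * p i x)" by (auto simp: fun_ideal_def)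
  then show ?thesis
    using fun_idealI[of "\<lambda>i x. a i x + b i x" G p m]
    by (simp add: fun_alg.add sum.distrib distrib_right)
qed

lemma fun_ideal_mult: "c \<in> fun_alg G \<Longrightarrow> w \<in> fun_ideal G m p \<Longrightarrow> (\<lambda>x. c x * w x) \<in> fun_ideal G m p"
proof -
  assume "c \<in> fun_alg G" "w \<in> fun_ideal G m p"
  then obtain b where "\<forall>i. b i \<in> fun_alg G" "w = (\<lambda>x. \<Sum>i<m. b i x * p i x)"
    by (auto simp: fun_ideal_def)
  then show ?thesis
    using fun_idealI[of "\<lambda>i x. c x * b i x" G p m] \<open>c \<in> fun_alg G\<close>
    by (simp add: fun_alg.mult sum_distrib_left mult.assoc)
qed

lemma fun_ideal_sum:
  "(\<And>i. i \<in> I \<Longrightarrow> w i \<in> fun_ideal G m p) \<Longrightarrow> (\<lambda>x. \<Sum>i\<in>I. w i x) \<in> fun_ideal G m p"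
  by (induction I rule: infinite_finite_induct) (auto intro: fun_ideal_zero fun_ideal_add)

lemma fun_ideal_gen: "i < m \<Longrightarrow> p i \<in> fun_ideal G m p"
proof -
  assume i: "i < m"
  have "p i x = (\<Sum>j<m. (if j = i then 1 else 0) * p j x)" for x
  proof -
    have "(\<Sum>j<m. (if j = i then 1 else 0) * p j x) = (\<Sum>j<m. if j = i then p j x else 0)"
      by (rule sum.cong) auto
    then show ?thesis using i by simp
  qed
  then have "p i = (\<lambda>x. \<Sum>j<m. (if j = i then 1 else 0) * p j x)" by blast
  also have "\<dots> \<in> fun_ideal G m p" by (intro fun_idealI fun_alg_if fun_alg.const)
  finally show ?thesis .
qed

lemma fun_ideal_subset:
  assumes "\<And>i. i < m \<Longrightarrow> q i \<in> fun_ideal G n p"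
  shows "fun_ideal G m q \<subseteq> fun_ideal G n p"
proof
  fix w assume "w \<in> fun_ideal G m q"
  then obtain b where b: "\<forall>i. b i \<in> fun_alg G" "w = (\<lambda>x. \<Sum>i<m. b i x * q i x)"
    by (auto simp: fun_ideal_def)
  show "w \<in> fun_ideal G n p" unfolding b(2)
    using b(1) assms by (intro fun_ideal_sum fun_ideal_mult) auto
qed

lemma noetherian_empty: "noetherian {}"
proof -
  have const: "\<exists>c. u = (\<lambda>_. c)" if "u \<in> fun_alg {}" for u :: "'a \<Rightarrow> complex"
    using that by induction auto
  show ?thesis unfolding noetherian_def
  proof (intro allI impI)
    fix p :: "nat \<Rightarrow> 'a \<Rightarrow> complex" assume "\<forall>i. p i \<in> fun_alg {}"
    then have "\<forall>i. \<exists>c. p i = (\<lambda>_. c)" using const by blast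
    from choice[OF this] obtain c where c: "\<And>i. p i = (\<lambda>_. c i)" by blast
    show "\<exists>m. p m \<in> fun_ideal {} m p"
    proof (cases "c 0 = 0")
      case True
      then show ?thesis using fun_ideal_zero[of "{}" 0 p] by (intro exI[of _ 0]) (simp add: c)
    next
      case False
      have "p 1 = (\<lambda>x. c 1 / c 0 * p 0 x)" using False by (simp add: c)
      also have "\<dots> \<in> fun_ideal {} 1 p"
        by (intro fun_ideal_mult fun_ideal_gen fun_alg.const) simp
      finally show ?thesis by (rule exI)
    qed
  qed
qed

text \<open>Hilbert's argument. In the ideal \<open>J\<close> of a bad sequence, elements
  \<open>q m\<close> of least degree outside the ideal of the earlier ones are picked. A relation
  between leading coefficients lowers the degree of one of them modulo the earlier ones, against its
  choice.\<close>

lemma noetherian_insert: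
  fixes g :: "'p \<Rightarrow> complex"
  assumes "noetherian G"
  shows "noetherian (insert g G)"
proof (rule ccontr)
  let ?A = "fun_alg (insert g G)"
  let ?I = "fun_ideal (insert g G)"
  assume "\<not> noetherian (insert g G)"
  then obtain p where p: "\<And>i. p i \<in> ?A" "\<And>m. p m \<notin> ?I m p"
    by (auto simp: noetherian_def)
  define J where "J = (\<Union>m. ?I m p)"
  define bnd where "bnd k w \<longleftrightarrow> (\<exists>B\<in>poly_fam G. (\<forall>x. \<forall>i\<ge>k. coeff (B x) i = 0) \<and>
    (\<forall>x. w x = poly (B x) (g x)))" for k w
  \<comment> \<open>A strict degree bound, hence one more than a degree, minimized over all ways to
    write \<open>w\<close> as a polynomial in \<open>g\<close>, since these need not be
    unique.\<close>
  define dg where "dg w = (LEAST k. bnd k w)" for w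
  have I_alg: "w \<in> ?A" if "w \<in> ?I m p" for w m
    using that p(1) by (auto simp: fun_ideal_def intro!: fun_alg_intros)
  have bnd_dg: "bnd (dg w) w" if "w \<in> J" for w
  proof -
    have "w \<in> ?A" using that I_alg by (auto simp: J_def)
    then obtain B where B: "B \<in> poly_fam G" "\<forall>x. w x = poly (B x) (g x)"
      using fun_alg_insert[of w g G] by blast
    obtain N where "\<And>x i. i \<ge> N \<Longrightarrow> coeff (B x) i = 0" using poly_fam_bound[OF B(1)] by blast
    then have "bnd N w" unfolding bnd_def using B by blast
    then show ?thesis unfolding dg_def by (rule LeastI)
  qed
  define P where "P q m w \<longleftrightarrow> w \<in> J \<and> w \<notin> ?I m q \<and> (\<forall>w'\<in>J. w' \<notin> ?I m q \<longrightarrow> dg w \<le> dg w')" for q m w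
  have "\<exists>q. \<forall>m. P q m (q m)"
  proof (rule dependent_wf_choice[OF wf_less])
    show "P f m r = P h m r" if "\<And>z. (z, m) \<in> {(x, y). x < y} \<Longrightarrow> f z = h z" for f h m r
      unfolding P_def using that fun_ideal_cong[of m f h "insert g G"] by simp
    show "\<exists>r. P q m r" if q: "\<And>y. (y, m) \<in> {(x, y). x < y} \<Longrightarrow> P q y (q y)" for m q
    proof -
      have "\<forall>i\<in>{..<m}. \<exists>M. q i \<in> ?I M p" using q by (auto simp: P_def J_def)
      then obtain M where M: "\<And>i. i < m \<Longrightarrow> q i \<in> ?I (M i) p" by (metis lessThan_iff)
      define N where "N = (\<Sum>i<m. M i)"
      have "?I m q \<subseteq> ?I N p"
      proof (rule fun_ideal_subset)
        show "q i \<in> ?I N p" if "i < m" for i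
          using M[OF that] fun_ideal_mono[of "M i" N] member_le_sum[of i "{..<m}" M] that
          by (auto simp: N_def)
      qed
      \<comment> \<open>The earlier \<open>q i\<close> are combinations of the \<open>p j\<close>
        with \<open>j < N\<close>, so \<open>p N\<close> is still outside their ideal.\<close>
      then have "p N \<notin> ?I m q" using p(2) by blast
      moreover have "p N \<in> J" using fun_ideal_gen[of N "Suc N" p] by (auto simp: J_def)
      ultimately have "p N \<in> J \<and> p N \<notin> ?I m q" by blast
      from ex_has_least_nat[of "\<lambda>w. w \<in> J \<and> w \<notin> ?I m q", OF this, of dg]
      show ?thesis unfolding P_def by blast
    qed
  qed
  then obtain q where q: "\<And>m. q m \<in> J" "\<And>m. q m \<notin> ?I m q"
    "\<And>m w. w \<in> J \<Longrightarrow> w \<notin> ?I m q \<Longrightarrow> dg (q m) \<le> dg w"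
    unfolding P_def by blast
  have dg_mono: "dg (q i) \<le> dg (q m)" if "i \<le> m" for i m
    using q(1)[of m] q(2)[of m] q(3)[of "q m" i] fun_ideal_mono[OF that] by blast
  have "\<forall>m. \<exists>B\<in>poly_fam G. (\<forall>x. \<forall>i\<ge>dg (q m). coeff (B x) i = 0) \<and> (\<forall>x. q m x = poly (B x) (g x))"
    using bnd_dg[OF q(1)] unfolding bnd_def by blast
  then obtain B where B: "\<And>m. B m \<in> poly_fam G" "\<And>m x i. i \<ge> dg (q m) \<Longrightarrow> coeff (B m x) i = 0"
    "\<And>m x. q m x = poly (B m x) (g x)" by metis
  have dg_pos: "dg (q m) > 0" for m
  proof (rule ccontr)
    assume "\<not> dg (q m) > 0"
    then have "B m x = 0" for x using B(2)[of m] by (simp add: poly_eq_iff)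
    then have "q m = (\<lambda>_. 0)" using B(3) by (simp add: fun_eq_iff)
    then show False using q(2)[of m] fun_ideal_zero by metis
  qed
  \<comment> \<open>As \<open>dg\<close> is a strict bound and positive here, the leading
    coefficient sits one place below it.\<close>
  define lc where "lc m x = coeff (B m x) (dg (q m) - 1)" for m x
  have "lc m \<in> fun_alg G" for m unfolding lc_def[abs_def] by (rule poly_fam_coeff[OF B(1)])
  then obtain m where "lc m \<in> fun_ideal G m lc" using assms unfolding noetherian_def by blast
  then obtain u where "\<forall>i. u i \<in> fun_alg G" "lc m = (\<lambda>x. \<Sum>i<m. u i x * lc i x)"
    by (auto simp: fun_ideal_def)
  then have u: "u i \<in> fun_alg G" "lc m x = (\<Sum>i<m. u i x * lc i x)" for i x
    by simp_all
  \<comment> \<open>Powers of \<open>g\<close> raise the earlier elements to the degree of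
    \<open>q m\<close>; the relation between the leading coefficients cancels the top term.\<close>
  define C where "C x = B m x - (\<Sum>i<m. smult (u i x) (monom 1 (dg (q m) - dg (q i)) * B i x))" for x
  define w where "w x = q m x - (\<Sum>i<m. u i x * g x ^ (dg (q m) - dg (q i)) * q i x)" for x
  have C: "C \<in> poly_fam G" unfolding C_def
    by (intro poly_fam_diff poly_fam_sum poly_fam_smult poly_fam_mult poly_fam_const B u)
  have wC: "w x = poly (C x) (g x)" for x
    by (simp add: w_def C_def poly_sum poly_monom B(3) mult.assoc)
  have coeffC: "coeff (C x) i = 0" if i: "i \<ge> dg (q m) - 1" for x i
  proof -
    have "coeff (monom 1 (dg (q m) - dg (q j)) * B j x) i =
      (if i = dg (q m) - 1 then lc j x else 0)" if "j < m" for j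
    proof -
      have le: "dg (q j) \<le> dg (q m)" using dg_mono that by simp
      show ?thesis
      proof (cases "i = dg (q m) - 1")
        case True
        then show ?thesis using le dg_pos[of j] by (simp add: coeff_monom_mult lc_def)
      next
        case False
        then have "i - (dg (q m) - dg (q j)) \<ge> dg (q j)" using le i by simp
        then show ?thesis using False B(2) by (simp add: coeff_monom_mult)
      qed
    qed
    then have "coeff (C x) i = coeff (B m x) i - (\<Sum>j<m. u j x * (if i = dg (q m) - 1 then lc j x else 0))"
      by (simp add: C_def coeff_sum)
    moreover have "coeff (B m x) i = 0" if "i \<noteq> dg (q m) - 1" using that i B(2) by simp
    ultimately show ?thesis
      using u(2)[of x] by (cases "i = dg (q m) - 1") (simp_all add: lc_def)
  qed
  have "bnd (dg (q m) - 1) w" unfolding bnd_def using C wC coeffC by blast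
  then have "dg w \<le> dg (q m) - 1" unfolding dg_def by (rule Least_le)
  then have "dg w < dg (q m)" using dg_pos[of m] by simp
  define r where "r x = (\<Sum>i<m. u i x * g x ^ (dg (q m) - dg (q i)) * q i x)" for x
  have ug: "(\<lambda>x. u i x * g x ^ k) \<in> ?A" for i k
    by (intro fun_alg.mult fun_alg_power fun_alg_mono[OF u(1)] fun_alg.gen) auto
  have r: "r \<in> ?I m q"
    unfolding r_def by (intro fun_ideal_sum fun_ideal_mult ug fun_ideal_gen) auto
  have neg: "(\<lambda>x. - v x) \<in> ?I k q'" if "v \<in> ?I k q'" for v k q'
    using fun_ideal_mult[OF fun_alg.const[of "-1"] that] by simp
  have "w \<notin> ?I m q"
  proof
    assume "w \<in> ?I m q"
    from fun_ideal_add[OF this r] have "q m \<in> ?I m q" by (simp add: w_def r_def)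
    then show False using q(2) by blast
  qed
  moreover have "w \<in> J"
  proof -
    have "\<forall>i. \<exists>M. q i \<in> ?I M p" using q(1) by (auto simp: J_def)
    then obtain M where M: "\<And>i. q i \<in> ?I (M i) p" by metis
    define N where "N = (\<Sum>i<Suc m. M i)"
    have N: "q i \<in> ?I N p" if "i < Suc m" for i
      using M[of i] fun_ideal_mono[of "M i" N] member_le_sum[of i "{..<Suc m}" M] that
      by (auto simp: N_def simp del: sum.lessThan_Suc)
    have "r \<in> ?I N p" using r fun_ideal_subset[of m q "insert g G" N p] N by auto
    then have "(\<lambda>x. q m x + - r x) \<in> ?I N p" using N[of m] neg by (intro fun_ideal_add) auto
    moreover have "(\<lambda>x. q m x + - r x) = w" by (simp add: fun_eq_iff w_def r_def)
    ultimately show ?thesis by (auto simp: J_def)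
  qed
  ultimately have "dg (q m) \<le> dg w" by (rule q(3)[rotated])
  then show False using \<open>dg w < dg (q m)\<close> by simp
qed

lemma noetherian_finite: "finite G \<Longrightarrow> noetherian G"
  by (induction G rule: finite_induct) (auto intro: noetherian_empty noetherian_insert)

section \<open>Affine varieties and their components\<close>

definition vcrd :: "(complex^'n \<Rightarrow> complex) set" where
  "vcrd = range (\<lambda>i z. z $ i)"

lemma vcrd_var: "(\<lambda>z. z $ i) \<in> fun_alg vcrd"
  by (auto simp: vcrd_def intro: fun_alg.gen)

lemma peval_in_vcrd: "(\<lambda>z. peval p (($) z)) \<in> fun_alg vcrd"
  by (rule fun_alg_compose[OF peval_in_fun_alg[of p UNIV]]) (auto intro: vcrd_var)

lemma vcrd_imp_peval:
  fixes u :: "complex^'n::finite \<Rightarrow> complex"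
  assumes "u \<in> fun_alg vcrd"
  shows "\<exists>p. u = (\<lambda>z. peval p (($) z))"
proof -
  have "(\<lambda>x. u (\<chi> i. x i)) \<in> fun_alg ((\<lambda>i x. x i) ` UNIV)"
    by (rule fun_alg_compose[OF assms]) (auto simp: vcrd_def intro: fun_alg.gen)
  then obtain p where "(\<lambda>x. u (\<chi> i. x i)) = peval p" using fun_alg_imp_peval by blast
  then have "u z = peval p (($) z)" for z by (metis vec_nth_inverse vec_lambda_eta)
  then show ?thesis by blast
qed

text \<open>Closedness as separation from every outside point: unions are then handled by products
  of functions, and no ideals have to be computed.\<close>

lemma affine_variety_iff:
  fixes X :: "(complex^'n::finite) set"
  shows "affine_variety X \<longleftrightarrow> (\<forall>z. z \<notin> X \<longrightarrow> (\<exists>u\<in>fun_alg vcrd. (\<forall>w\<in>X. u w = 0) \<and> u z \<noteq> 0))"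
    (is "_ \<longleftrightarrow> ?R")
proof
  assume "affine_variety X"
  then obtain F where "X = zero_locus F" by (auto simp: affine_variety_def)
  then show ?R using peval_in_vcrd by (force simp: zero_locus_def)
next
  assume R: ?R
  have "X = zero_locus (vanishing_ideal X)"
  proof
    show "zero_locus (vanishing_ideal X) \<subseteq> X"
    proof
      fix z assume z: "z \<in> zero_locus (vanishing_ideal X)"
      show "z \<in> X"
      proof (rule ccontr)
        assume "z \<notin> X"
        then obtain u where u: "u \<in> fun_alg vcrd" "\<forall>w\<in>X. u w = 0" "u z \<noteq> 0" using R by blast
        then obtain p where "u = (\<lambda>z. peval p (($) z))" using vcrd_imp_peval by blast
        then show False using u z by (auto simp: zero_locus_def vanishing_ideal_def)
      qed
    qed
  qed (auto simp: zero_locus_def vanishing_ideal_def)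
  then show "affine_variety X" by (auto simp: affine_variety_def)
qed

lemma affine_variety_separate:
  fixes X :: "(complex^'n::finite) set"
  assumes "affine_variety X" "z \<notin> X"
  obtains u where "u \<in> fun_alg vcrd" "\<And>w. w \<in> X \<Longrightarrow> u w = 0" "u z \<noteq> 0"
  using assms unfolding affine_variety_iff by blast

lemma affine_variety_Un:
  fixes A B :: "(complex^'n::finite) set"
  assumes "affine_variety A" "affine_variety B"
  shows "affine_variety (A \<union> B)"
  unfolding affine_variety_iff
proof (intro allI impI)
  fix z assume "z \<notin> A \<union> B"
  then obtain u v where "u \<in> fun_alg vcrd" "\<And>w. w \<in> A \<Longrightarrow> u w = 0" "u z \<noteq> 0"
    "v \<in> fun_alg vcrd" "\<And>w. w \<in> B \<Longrightarrow> v w = 0" "v z \<noteq> 0"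
    using affine_variety_separate[OF assms(1)] affine_variety_separate[OF assms(2)] by (metis UnI1 UnI2)
  then show "\<exists>u\<in>fun_alg vcrd. (\<forall>w\<in>A \<union> B. u w = 0) \<and> u z \<noteq> 0"
    by (intro bexI[of _ "\<lambda>x. u x * v x"]) (auto intro: fun_alg.mult)
qed

lemma affine_variety_Int:
  fixes A B :: "(complex^'n::finite) set"
  assumes "affine_variety A" "affine_variety B"
  shows "affine_variety (A \<inter> B)"
  using assms unfolding affine_variety_iff by (metis Int_iff)

lemma affine_variety_empty: "affine_variety ({} :: (complex^'n::finite) set)"
  unfolding affine_variety_iff by (auto intro!: bexI[of _ "\<lambda>_. 1"] fun_alg.const)

lemma affine_variety_Union:
  fixes \<C> :: "(complex^'n::finite) set set"
  assumes "finite \<C>" "\<And>A. A \<in> \<C> \<Longrightarrow> affine_variety A"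
  shows "affine_variety (\<Union>\<C>)"
  using assms by (induction rule: finite_induct) (auto intro: affine_variety_empty affine_variety_Un)

lemma affine_variety_zeros:
  fixes u :: "complex^'n::finite \<Rightarrow> complex"
  shows "u \<in> fun_alg vcrd \<Longrightarrow> affine_variety {z. u z = 0}"
  unfolding affine_variety_iff by auto

text \<open>The zero sets of \<open>u\<close> and \<open>v\<close> cut \<open>Z\<close> into two
  closed pieces. This serves to cancel factors in relations that hold on \<open>Z\<close>.\<close>

lemma irreducible_no_zero_divisors:
  fixes Z :: "(complex^'n::finite) set"
  assumes Z: "irreducible_variety Z" and "u \<in> fun_alg vcrd" "v \<in> fun_alg vcrd"
    and "\<And>z. z \<in> Z \<Longrightarrow> u z * v z = 0"
  shows "(\<forall>z\<in>Z. u z = 0) \<or> (\<forall>z\<in>Z. v z = 0)"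
proof -
  have "affine_variety (Z \<inter> {z. u z = 0})" "affine_variety (Z \<inter> {z. v z = 0})"
    using assms by (auto simp: irreducible_variety_def intro!: affine_variety_Int affine_variety_zeros)
  moreover have "Z = (Z \<inter> {z. u z = 0}) \<union> (Z \<inter> {z. v z = 0})" using assms(4) by auto
  ultimately have "Z = Z \<inter> {z. u z = 0} \<or> Z = Z \<inter> {z. v z = 0}"
    using Z unfolding irreducible_variety_def by blast
  then show ?thesis by blast
qed

lemma irreducible_subset_Un:
  fixes Z :: "(complex^'n::finite) set"
  assumes Z: "irreducible_variety Z" and "affine_variety A" "affine_variety B" and "Z \<subseteq> A \<union> B"
  shows "Z \<subseteq> A \<or> Z \<subseteq> B"
proof -
  have "affine_variety (Z \<inter> A)" "affine_variety (Z \<inter> B)"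
    using assms by (auto simp: irreducible_variety_def intro!: affine_variety_Int)
  moreover have "Z = (Z \<inter> A) \<union> (Z \<inter> B)" using assms(4) by auto
  ultimately have "Z = Z \<inter> A \<or> Z = Z \<inter> B"
    using Z unfolding irreducible_variety_def by blast
  then show ?thesis by blast
qed

text \<open>In a strictly descending chain choose \<open>p i\<close> vanishing on
  \<open>Z (Suc i)\<close> but not at a point \<open>z i\<close> of \<open>Z i\<close>. A
  \<open>p m\<close> that is a combination of the earlier ones vanishes at \<open>z m\<close>, as
  they all vanish on \<open>Z m\<close>.\<close>

lemma wf_affine_variety:
  "wf {(A, B :: (complex^'n::finite) set). affine_variety A \<and> affine_variety B \<and> A \<subset> B}"
  unfolding wf_iff_no_infinite_down_chain
proof
  assume "\<exists>Z. \<forall>i. (Z (Suc i), Z i) \<in> {(A, B :: (complex^'n) set). affine_variety A \<and> affine_variety B \<and> A \<subset> B}"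
  then obtain Z :: "nat \<Rightarrow> (complex^'n) set" where
    "\<forall>i. affine_variety (Z (Suc i)) \<and> affine_variety (Z i) \<and> Z (Suc i) \<subset> Z i" by auto
  then have Z: "affine_variety (Z i)" "Z (Suc i) \<subset> Z i" for i by blast+
  have anti: "Z j \<subseteq> Z i" if "i \<le> j" for i j
    using that by (rule lift_Suc_antimono_le[rotated]) (use Z(2) in auto)
  have "\<forall>i. \<exists>z u. z \<in> Z i \<and> u \<in> fun_alg vcrd \<and> (\<forall>w\<in>Z (Suc i). u w = 0) \<and> u z \<noteq> 0"
    using Z unfolding affine_variety_iff by (meson psubset_imp_ex_mem DiffD1 DiffD2)
  then obtain z p where zp: "\<And>i. z i \<in> Z i" "\<And>i. p i \<in> fun_alg vcrd"
    "\<And>i w. w \<in> Z (Suc i) \<Longrightarrow> p i w = 0" "\<And>i. p i (z i) \<noteq> 0" by metis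
  have "noetherian (vcrd :: (complex^'n \<Rightarrow> complex) set)"
    by (rule noetherian_finite) (simp add: vcrd_def)
  then obtain m u where "p m = (\<lambda>x. \<Sum>i<m. u i x * p i x)"
    using zp(2) unfolding noetherian_def fun_ideal_def by blast
  moreover have "p i (z m) = 0" if "i < m" for i
    using zp(1,3) anti[of "Suc i" m] that by (meson Suc_leI subsetD)
  ultimately show False using zp(4)[of m] by simp
qed

lemma affine_variety_decomposition:
  fixes X :: "(complex^'n::finite) set"
  assumes "affine_variety X"
  shows "\<exists>\<C>. finite \<C> \<and> (\<forall>Z\<in>\<C>. irreducible_variety Z) \<and> X = \<Union>\<C>"
  using assms
proof (induction X rule: wf_induct_rule[OF wf_affine_variety])
  case (1 X)
  consider "X = {}" | "irreducible_variety X" |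
    A B where "affine_variety A" "affine_variety B" "X = A \<union> B" "X \<noteq> A" "X \<noteq> B"
    using "1.prems" by (auto simp: irreducible_variety_def)
  then show ?case
  proof cases
    case 1
    then show ?thesis by (intro exI[of _ "{}"]) auto
  next
    case 2
    then show ?thesis by (intro exI[of _ "{X}"]) auto
  next
    case (3 A B)
    then obtain \<C> \<D> where "finite \<C> \<and> (\<forall>Z\<in>\<C>. irreducible_variety Z) \<and> A = \<Union>\<C>"
      "finite \<D> \<and> (\<forall>Z\<in>\<D>. irreducible_variety Z) \<and> B = \<Union>\<D>"
      using "1.IH"[of A] "1.IH"[of B] "1.prems" by auto
    then show ?thesis using 3(3) by (intro exI[of _ "\<C> \<union> \<D>"]) auto
  qed
qed

text \<open>In a decomposition with the least number of pieces, no piece lies in the union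
  \<open>W\<close> of the others. The last clause is meant for the local dimension: at points of
  \<open>Z\<close> outside \<open>W\<close> it is the dimension of \<open>Z\<close>.\<close>

lemma component_through_point:
  fixes X :: "(complex^'n::finite) set"
  assumes "affine_variety X" "a \<in> X"
  shows "\<exists>Z W. irreducible_component X Z \<and> a \<in> Z \<and> affine_variety W \<and> X = Z \<union> W \<and> \<not> Z \<subseteq> W \<and>
    (\<forall>z\<in>Z - W. \<forall>Z'. irreducible_component X Z' \<and> z \<in> Z' \<longrightarrow> Z' = Z)"
proof -
  let ?P = "\<lambda>\<C>. finite \<C> \<and> (\<forall>Z\<in>\<C>. irreducible_variety Z) \<and> X = \<Union>\<C>"
  obtain \<C>0 where "?P \<C>0" using affine_variety_decomposition[OF assms(1)] by blast
  from ex_has_least_nat[of ?P, OF this, of card] obtain \<C> where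
    C: "finite \<C>" "\<And>Z. Z \<in> \<C> \<Longrightarrow> irreducible_variety Z" "X = \<Union>\<C>" and
    min: "\<And>\<D>. ?P \<D> \<Longrightarrow> card \<C> \<le> card \<D>" by blast
  obtain Z where Z: "Z \<in> \<C>" "a \<in> Z" using assms(2) C(3) by blast
  define W where "W = \<Union>(\<C> - {Z})"
  have aff: "affine_variety A" if "A \<in> \<C>" for A using C(2)[OF that] by (simp add: irreducible_variety_def)
  have W: "affine_variety W" unfolding W_def using C(1) aff by (intro affine_variety_Union) auto
  have XZW: "X = Z \<union> W" using C(3) Z(1) by (auto simp: W_def)
  have ZW: "\<not> Z \<subseteq> W"
  proof
    assume "Z \<subseteq> W"
    then have "?P (\<C> - {Z})" using C XZW by (auto simp: W_def)
    then have "card \<C> \<le> card (\<C> - {Z})" by (rule min)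
    then show False using card_Diff1_less[OF C(1) Z(1)] by simp
  qed
  have irr: "irreducible_variety Z" using C Z by blast
  have "Z' = Z" if Z': "irreducible_variety Z'" "Z \<subseteq> Z'" "Z' \<subseteq> X" for Z'
  proof -
    have "Z' \<subseteq> Z \<or> Z' \<subseteq> W"
      using Z' XZW W aff[OF Z(1)] by (intro irreducible_subset_Un) auto
    then show ?thesis using ZW Z'(2) by blast
  qed
  then have comp: "irreducible_component X Z"
    using irr XZW by (auto simp: irreducible_component_def)
  have "Z' = Z" if z: "z \<in> Z - W" and Z': "irreducible_component X Z'" "z \<in> Z'" for z Z'
  proof -
    have "Z' \<subseteq> Z \<or> Z' \<subseteq> W"
      using Z' XZW W aff[OF Z(1)] by (intro irreducible_subset_Un) (auto simp: irreducible_component_def)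
    then have "Z' \<subseteq> Z" using z Z' by blast
    then show ?thesis using Z'(1) irr XZW unfolding irreducible_component_def by blast
  qed
  then show ?thesis using comp Z(2) W XZW ZW by blast
qed

section \<open>Noether normalization\<close>

text \<open>The coordinate ring of \<open>Z\<close> is a finite module over the polynomials in \<open>f 0, \<dots>, f (d - 1)\<close>.\<close>

definition module_finite :: "(complex^'n::finite) set \<Rightarrow> nat \<Rightarrow> (complex^'n \<Rightarrow> nat \<Rightarrow> complex) \<Rightarrow> bool" where
  "module_finite Z d f \<longleftrightarrow> (\<forall>i<d. (\<lambda>z. f z i) \<in> fun_alg vcrd) \<and>
    (\<exists>N::nat. \<exists>m. (\<forall>k<N. m k \<in> fun_alg vcrd) \<and>
      (\<forall>u\<in>fun_alg vcrd. \<exists>a. (\<forall>k<N. a k \<in> fun_alg (crd d)) \<and>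
        (\<forall>z\<in>Z. u z = (\<Sum>k<N. a k (f z) * m k z))))"

lemma module_finite_vcrd: "module_finite Z d f \<Longrightarrow> i < d \<Longrightarrow> (\<lambda>z. f z i) \<in> fun_alg vcrd"
  by (simp add: module_finite_def)

lemma module_finite_compose:
  "module_finite Z d f \<Longrightarrow> u \<in> fun_alg (crd d) \<Longrightarrow> (\<lambda>z. u (f z)) \<in> fun_alg vcrd"
  by (erule crd_compose) (rule module_finite_vcrd)

lemma module_finiteE:
  assumes "module_finite Z d f"
  obtains N :: nat and m where "\<forall>k<N. m k \<in> fun_alg vcrd"
    "\<forall>u\<in>fun_alg vcrd. \<exists>a. (\<forall>k<N. a k \<in> fun_alg (crd d)) \<and>
        (\<forall>z\<in>Z. u z = (\<Sum>k<N. a k (f z) * m k z))"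
  using assms unfolding module_finite_def by (elim conjE exE)

lemma enumerate_finite_type:
  obtains e :: "nat \<Rightarrow> 'n::finite" and g where "\<forall>j. g j < CARD('n)" "\<forall>j. e (g j) = j"
proof -
  obtain e where e: "bij_betw e {..<CARD('n)} (UNIV :: 'n set)"
    using ex_bij_betw_nat_finite[of "UNIV :: 'n set"] by (auto simp: atLeast0LessThan)
  show ?thesis
  proof (rule that)
    show "\<forall>j. the_inv_into {..<CARD('n)} e j < CARD('n)"
      "\<forall>j. e (the_inv_into {..<CARD('n)} e j) = j"
      using e f_the_inv_into_f_bij_betw[OF e] the_inv_into_into[of e "{..<CARD('n)}" _ "{..<CARD('n)}"]
      by (auto simp: bij_betw_def)
  qed
qed

lemma module_finite_coordinates:
  fixes Z :: "(complex^'n::finite) set"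
  shows "\<exists>d f. module_finite Z d f"
proof -
  obtain e :: "nat \<Rightarrow> 'n" and g where "\<forall>j. g j < CARD('n)" "\<forall>j. e (g j) = j"
    by (rule enumerate_finite_type)
  note g = this[rule_format]
  define f where "f z i = z $ e i" for z :: "complex^'n" and i
  have "module_finite Z (CARD('n)) f"
    unfolding module_finite_def
  proof (intro conjI allI impI exI[of _ "1::nat"] exI[of _ "\<lambda>(_::nat) (_::complex^'n). 1::complex"] ballI)
    show "(\<lambda>z. f z i) \<in> fun_alg vcrd" for i by (simp add: f_def vcrd_var)
    show "(\<lambda>_. 1) \<in> fun_alg vcrd" by (rule fun_alg.const)
    fix u :: "complex^'n \<Rightarrow> complex" assume u: "u \<in> fun_alg vcrd"
    have "(\<lambda>x. u (\<chi> j. x (g j))) \<in> fun_alg (crd (CARD('n)))"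
      by (rule fun_alg_compose[OF u]) (auto simp: vcrd_def crd_var g)
    moreover have "u z = u (\<chi> j. f z (g j))" for z by (simp add: f_def g)
    ultimately show "\<exists>a. (\<forall>k<1. a k \<in> fun_alg (crd (CARD('n)))) \<and>
        (\<forall>z\<in>Z. u z = (\<Sum>k<1::nat. a k (f z) * 1))"
      by (intro exI[of _ "\<lambda>_ x. u (\<chi> j. x (g j))"]) auto
  qed
  then show ?thesis by blast
qed

text \<open>Pairs of a generator \<open>k\<close> and a power \<open>j\<close> are numbered by
  \<open>k * r + j\<close>, because \<open>module_finite\<close> keeps its generators in one
  list.\<close>

lemma sum_div_mod:
  fixes h :: "nat \<Rightarrow> nat \<Rightarrow> 'a::comm_monoid_add"
  shows "(\<Sum>l<N * r. h (l div r) (l mod r)) = (\<Sum>k<N. \<Sum>j<r. h k j)"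
proof -
  have "(\<Sum>l<N * r. h (l div r) (l mod r)) = (\<Sum>k<N. \<Sum>l\<in>{k * r..<k * r + r}. h (l div r) (l mod r))"
    by (rule sum.nat_group[symmetric])
  also have "\<dots> = (\<Sum>k<N. \<Sum>j<r. h k j)"
  proof (rule sum.cong[OF refl])
    fix k
    have "(\<Sum>l\<in>{0 + k * r..<r + k * r}. h (l div r) (l mod r)) = (\<Sum>j\<in>{0..<r}. h ((j + k * r) div r) ((j + k * r) mod r))"
      by (rule sum.shift_bounds_nat_ivl)
    also have "\<dots> = (\<Sum>j\<in>{0..<r}. h k j)" by (rule sum.cong) auto
    finally show "(\<Sum>l\<in>{k * r..<k * r + r}. h (l div r) (l mod r)) = (\<Sum>j<r. h k j)"
      by (simp add: add.commute atLeast0LessThan)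
  qed
  finally show ?thesis .
qed

text \<open>A linear change of coordinates makes the relation monic in \<open>f z d\<close> over the
  new functions. The powers of \<open>f z d\<close> below its degree \<open>r\<close>, times the old
  generators, then generate the module.\<close>

lemma module_finite_reduce:
  fixes Z :: "(complex^'n::finite) set"
  assumes fin: "module_finite Z (Suc d) f" and q: "q \<in> fun_alg (crd (Suc d))" "\<exists>x. q x \<noteq> 0"
    and q0: "\<And>z. z \<in> Z \<Longrightarrow> q (f z) = 0"
  shows "\<exists>f'. module_finite Z d f'"
proof -
  obtain v r b F where F: "F \<in> poly_fam (crd d)" and v: "v d = 1" and b: "b \<noteq> 0" and
    qF: "\<And>x s. q (\<lambda>i. (if i = d then 0 else x i) + s * v i) = poly (F x) s" and
    degF: "\<And>x. degree (F x) = r" "\<And>x. lead_coeff (F x) = b"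
    using crd_monic_direction[OF q] by blast
  define f' where "f' z i = f z i - v i * f z d" for z i
  define F1 where "F1 x = smult (1 / b) (F x)" for x
  have F1: "F1 \<in> poly_fam (crd d)" unfolding F1_def by (intro poly_fam_smult fun_alg.const F)
  have degF1: "degree (F1 x) = r" "lead_coeff (F1 x) = 1" for x
    using degF[of x] b by (auto simp: F1_def)
  \<comment> \<open>Because \<open>v d = 1\<close>, this substitution undoes the definition of
    \<open>f'\<close> and has \<open>f z d\<close> as its entry \<open>d\<close>.\<close>
  have subst: "a (\<lambda>i. (if i = d then 0 else f' z i) + f z d * v i) = a (f z)"
    if "a \<in> fun_alg (crd (Suc d))" for a z
    by (rule crd_local[OF that]) (auto simp: f'_def v)
  have F1_0: "poly (F1 (f' z)) (f z d) = 0" if "z \<in> Z" for z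
    using q0[OF that] qF[of "f' z" "f z d"] subst[OF q(1), of z] by (simp add: F1_def)
  have red: "\<exists>R\<in>poly_fam (crd d). \<forall>z\<in>Z. a (f z) = (\<Sum>j<r. coeff (R (f' z)) j * f z d ^ j)"
    if a: "a \<in> fun_alg (crd (Suc d))" for a
  proof -
    have "(\<lambda>x. a (\<lambda>i. (if i = d then 0 else x i) + x d * v i)) \<in> fun_alg (crd (Suc d))"
    proof (rule crd_compose[OF a])
      fix i assume "i < Suc d"
      then show "(\<lambda>x. (if i = d then 0 else x i) + x d * v i) \<in> fun_alg (crd (Suc d))"
        by (intro fun_alg_if fun_alg.add fun_alg.mult fun_alg.const crd_var) auto
    qed
    then obtain A where A: "A \<in> poly_fam (crd d)"
      "\<And>x. a (\<lambda>i. (if i = d then 0 else x i) + x d * v i) = poly (A x) (x d)"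
      using fun_alg_insert unfolding crd_Suc by blast
    have A': "a (\<lambda>i. (if i = d then 0 else x i) + s * v i) = poly (A x) s" for x s
    proof -
      have "A (x(d := s)) = A x" using A(1) by (rule poly_fam_crd_local) simp
      moreover have "(\<lambda>i. (if i = d then 0 else (x(d := s)) i) + (x(d := s)) d * v i) =
        (\<lambda>i. (if i = d then 0 else x i) + s * v i)" by auto
      ultimately show ?thesis using A(2)[of "x(d := s)"] by simp
    qed
    obtain Q R where QR: "R \<in> poly_fam (crd d)" "\<And>x. A x = Q x * F1 x + R x"
      "\<And>x i. i \<ge> r \<Longrightarrow> coeff (R x) i = 0"
      using poly_fam_divide_monic[OF F1 A(1) degF1] by blast
    have "a (f z) = (\<Sum>j<r. coeff (R (f' z)) j * f z d ^ j)" if "z \<in> Z" for z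
    proof -
      have "a (f z) = poly (A (f' z)) (f z d)" using A'[of "f' z" "f z d"] subst[OF a, of z] by simp
      also have "\<dots> = poly (R (f' z)) (f z d)" using F1_0[OF that] by (simp add: QR(2))
      also have "\<dots> = (\<Sum>j<r. coeff (R (f' z)) j * f z d ^ j)"
        by (rule poly_eq_sum_lessThan) (rule QR(3))
      finally show ?thesis .
    qed
    then show ?thesis using QR(1) by blast
  qed
  obtain N :: nat and m where "\<forall>k<N. m k \<in> fun_alg vcrd"
    "\<forall>u\<in>fun_alg vcrd. \<exists>a. (\<forall>k<N. a k \<in> fun_alg (crd (Suc d))) \<and>
        (\<forall>z\<in>Z. u z = (\<Sum>k<N. a k (f z) * m k z))"
    using fin by (rule module_finiteE)
  note m = this[rule_format]
  have "module_finite Z d f'"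
    unfolding module_finite_def
  proof (intro conjI exI[of _ "N * r"] exI[of _ "\<lambda>l z. m (l div r) z * f z d ^ (l mod r)"] allI impI ballI)
    show "(\<lambda>z. f' z i) \<in> fun_alg vcrd" if "i < d" for i
      unfolding f'_def using that module_finite_vcrd[OF fin]
      by (intro fun_alg_diff fun_alg.mult fun_alg.const) auto
    show "(\<lambda>z. m (l div r) z * f z d ^ (l mod r)) \<in> fun_alg vcrd" if "l < N * r" for l
      using that module_finite_vcrd[OF fin, of d]
      by (intro fun_alg.mult fun_alg_power m(1)) (auto simp: less_mult_imp_div_less)
    fix u :: "complex^'n \<Rightarrow> complex" assume "u \<in> fun_alg vcrd"
    then obtain a where a: "\<And>k. k < N \<Longrightarrow> a k \<in> fun_alg (crd (Suc d))"
      "\<And>z. z \<in> Z \<Longrightarrow> u z = (\<Sum>k<N. a k (f z) * m k z)" using m(2) by blast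
    have "\<forall>k\<in>{..<N}. \<exists>R\<in>poly_fam (crd d). \<forall>z\<in>Z. a k (f z) = (\<Sum>j<r. coeff (R (f' z)) j * f z d ^ j)"
      using red[OF a(1)] by blast
    then obtain R where R: "\<And>k. k < N \<Longrightarrow> R k \<in> poly_fam (crd d)"
      "\<And>k z. k < N \<Longrightarrow> z \<in> Z \<Longrightarrow> a k (f z) = (\<Sum>j<r. coeff (R k (f' z)) j * f z d ^ j)"
      by (metis lessThan_iff)
    have "u z = (\<Sum>l<N * r. coeff (R (l div r) (f' z)) (l mod r) * (m (l div r) z * f z d ^ (l mod r)))"
      if z: "z \<in> Z" for z
    proof -
      have "u z = (\<Sum>k<N. \<Sum>j<r. coeff (R k (f' z)) j * (m k z * f z d ^ j))"
        unfolding a(2)[OF z]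
        by (rule sum.cong[OF refl])
           (subst R(2)[OF _ z], simp, simp only: sum_distrib_right, simp only: mult_ac)
      then show ?thesis
        using sum_div_mod[of "\<lambda>k j. coeff (R k (f' z)) j * (m k z * f z d ^ j)" r N] by simp
    qed
    moreover have "(\<lambda>x. coeff (R (l div r) x) (l mod r)) \<in> fun_alg (crd d)" if "l < N * r" for l
      using that by (intro poly_fam_coeff R(1)) (simp add: less_mult_imp_div_less)
    ultimately show "\<exists>a. (\<forall>k<N * r. a k \<in> fun_alg (crd d)) \<and>
      (\<forall>z\<in>Z. u z = (\<Sum>l<N * r. a l (f' z) * (m (l div r) z * f z d ^ (l mod r))))"
      by (intro exI[of _ "\<lambda>l x. coeff (R (l div r) x) (l mod r)"]) auto
  qed
  then show ?thesis by blast
qed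

text \<open>With \<open>d\<close> chosen least, a nontrivial relation among the \<open>f i\<close>
  would allow a reduction to \<open>d - 1\<close>; for \<open>d = 0\<close> a relation is a constant
  and vanishes outright.\<close>

theorem noether_normalization:
  fixes Z :: "(complex^'n::finite) set"
  assumes "Z \<noteq> {}"
  obtains d f where "module_finite Z d f"
    "\<And>q x. q \<in> fun_alg (crd d) \<Longrightarrow> (\<And>z. z \<in> Z \<Longrightarrow> q (f z) = 0) \<Longrightarrow> q x = 0"
proof -
  define d where "d = (LEAST d. \<exists>f. module_finite Z d f)"
  have "\<exists>f. module_finite Z d f" unfolding d_def
    by (rule LeastI_ex) (rule module_finite_coordinates)
  then obtain f where f: "module_finite Z d f" by blast
  show ?thesis
  proof (rule that[OF f])
    fix q x assume q: "q \<in> fun_alg (crd d)" "\<And>z. z \<in> Z \<Longrightarrow> q (f z) = 0"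
    show "q x = 0"
    proof (cases d)
      case 0
      obtain z where "z \<in> Z" using assms by blast
      then show ?thesis using q crd_local[OF q(1), of x "f z"] 0 by simp
    next
      case (Suc d')
      show ?thesis
      proof (rule ccontr)
        assume "q x \<noteq> 0"
        then have "\<exists>f'. module_finite Z d' f'"
          using f q by (intro module_finite_reduce[of Z d' f q]) (auto simp: Suc)
        then have "d \<le> d'" unfolding d_def by (rule Least_le)
        then show False using Suc by simp
      qed
    qed
  qed
qed

section \<open>Integral equations from characteristic polynomials\<close>

lemma poly_fam_det:
  fixes A :: "'p \<Rightarrow> complex poly mat"
  assumes "\<And>x. A x \<in> carrier_mat n n" and "\<And>i j. i < n \<Longrightarrow> j < n \<Longrightarrow> (\<lambda>x. A x $$ (i, j)) \<in> poly_fam G"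
  shows "(\<lambda>x. det (A x)) \<in> poly_fam G"
proof -
  have "(\<lambda>x. det (A x)) = (\<lambda>x. \<Sum>p\<in>{p. p permutes {0..<n}}. signof p * (\<Prod>i=0..<n. A x $$ (i, p i)))"
    by (rule ext) (rule det_def'[OF assms(1)])
  also have "\<dots> \<in> poly_fam G"
  proof (intro poly_fam_sum poly_fam_mult poly_fam_const poly_fam_prod)
    fix p i assume "p \<in> {p. p permutes {0..<n}}" "i \<in> {0..<n}"
    then show "(\<lambda>x. A x $$ (i, p i)) \<in> poly_fam G"
      using permutes_in_image[of p "{0..<n}" i] by (intro assms(2)) auto
  qed
  finally show ?thesis .
qed

lemma fun_alg_det:
  fixes A :: "'p \<Rightarrow> complex mat"
  assumes "\<And>x. A x \<in> carrier_mat n n" and "\<And>i j. i < n \<Longrightarrow> j < n \<Longrightarrow> (\<lambda>x. A x $$ (i, j)) \<in> fun_alg G"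
  shows "(\<lambda>x. det (A x)) \<in> fun_alg G"
proof -
  have "(\<lambda>x. det (A x)) = (\<lambda>x. \<Sum>p\<in>{p. p permutes {0..<n}}. signof p * (\<Prod>i=0..<n. A x $$ (i, p i)))"
    by (rule ext) (rule det_def'[OF assms(1)])
  also have "\<dots> \<in> fun_alg G"
  proof (intro fun_alg_sum fun_alg.mult fun_alg.const fun_alg_prod)
    fix p i assume "p \<in> {p. p permutes {0..<n}}" "i \<in> {0..<n}"
    then show "(\<lambda>x. A x $$ (i, p i)) \<in> fun_alg G"
      using permutes_in_image[of p "{0..<n}" i] by (intro assms(2)) auto
  qed
  finally show ?thesis .
qed

text \<open>All multiplications are written on the same list of generators. The index type of
  \<open>g\<close> is free: one function leads to an integral equation, a sequence of functions to
  the monomial count for the transcendence degree.\<close>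

lemma module_finite_action:
  assumes fin: "module_finite Z d f" and g: "\<And>i. g i \<in> fun_alg vcrd"
  obtains N :: nat and a m b where
    "\<forall>i. \<forall>k<N. \<forall>l<N. a i k l \<in> fun_alg (crd d)"
    "\<forall>i. \<forall>k<N. \<forall>z\<in>Z. g i z * m k z = (\<Sum>l<N. a i k l (f z) * m l z)"
    "\<forall>k<N. b k \<in> fun_alg (crd d)" "\<forall>z\<in>Z. 1 = (\<Sum>k<N. b k (f z) * m k z)"
proof -
  obtain N :: nat and m where "\<forall>k<N. m k \<in> fun_alg vcrd"
    "\<forall>u\<in>fun_alg vcrd. \<exists>a. (\<forall>k<N. a k \<in> fun_alg (crd d)) \<and>
        (\<forall>z\<in>Z. u z = (\<Sum>k<N. a k (f z) * m k z))"
    using fin by (rule module_finiteE)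
  note m = this[rule_format]
  define a where "a i k = (SOME a. (\<forall>l<N. a l \<in> fun_alg (crd d)) \<and>
    (\<forall>z\<in>Z. g i z * m k z = (\<Sum>l<N. a l (f z) * m l z)))" for i k
  have a_ex: "(\<forall>l<N. a i k l \<in> fun_alg (crd d)) \<and>
      (\<forall>z\<in>Z. g i z * m k z = (\<Sum>l<N. a i k l (f z) * m l z))" if "k < N" for i k
    unfolding a_def using someI_ex[OF m(2)[OF fun_alg.mult[OF g m(1)[OF that]]]] .
  have a: "\<forall>i. \<forall>k<N. \<forall>l<N. a i k l \<in> fun_alg (crd d)"
    "\<forall>i. \<forall>k<N. \<forall>z\<in>Z. g i z * m k z = (\<Sum>l<N. a i k l (f z) * m l z)"
    using a_ex by simp_all
  obtain b where b: "\<forall>k<N. b k \<in> fun_alg (crd d)" "\<forall>z\<in>Z. 1 = (\<Sum>k<N. b k (f z) * m k z)"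
    using m(2)[OF fun_alg.const[of 1]] by (elim exE conjE)
  from that[OF a b] show ?thesis .
qed

text \<open>Multiplication by \<open>u\<close> is given by a matrix on the module generators, and \<open>u z\<close> is an eigenvalue.\<close>

lemma module_finite_integral:
  fixes Z :: "(complex^'n::finite) set"
  assumes fin: "module_finite Z d f" and u: "u \<in> fun_alg vcrd"
  obtains G e where "G \<in> poly_fam (crd d)" "\<And>x. degree (G x) = e" "\<And>x. lead_coeff (G x) = 1"
    "\<And>z. z \<in> Z \<Longrightarrow> poly (G (f z)) (u z) = 0"
proof -
  obtain N :: nat and a m b where
    "\<forall>i::unit. \<forall>k<N. \<forall>l<N. a i k l \<in> fun_alg (crd d)"
    "\<forall>i::unit. \<forall>k<N. \<forall>z\<in>Z. u z * m k z = (\<Sum>l<N. a i k l (f z) * m l z)"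
    "\<forall>k<N. b k \<in> fun_alg (crd d)" "\<forall>z\<in>Z. 1 = (\<Sum>k<N. b k (f z) * m k z)"
    by (rule module_finite_action[OF fin, of "\<lambda>_::unit. u", OF u])
  note a = this(1)[rule_format] and am = this(2)[THEN spec, of "()", rule_format] and b = this(4)[rule_format]
  define M where "M x = mat N N (\<lambda>(k, l). a () k l x)" for x
  have M: "M x \<in> carrier_mat N N" for x by (simp add: M_def)
  have fam: "(\<lambda>x. char_poly (M x)) \<in> poly_fam (crd d)"
    unfolding char_poly_def
  proof (rule poly_fam_det)
    show "char_poly_matrix (M x) \<in> carrier_mat N N" for x using M by simp
    fix i j assume ij: "i < N" "j < N"
    have "(\<lambda>x. char_poly_matrix (M x) $$ (i, j)) = (\<lambda>x. (if i = j then [:0, 1:] else 0) + [:- a () i j x:])"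
      using ij by (auto simp: char_poly_matrix_def M_def)
    also have "\<dots> \<in> poly_fam (crd d)"
      using ij by (intro poly_fam_add poly_fam_const poly_fam_pCons0 fun_alg_uminus a)
    finally show "(\<lambda>x. char_poly_matrix (M x) $$ (i, j)) \<in> poly_fam (crd d)" .
  qed
  show ?thesis
  proof (rule that[OF fam])
    show "degree (char_poly (M x)) = N" "lead_coeff (char_poly (M x)) = 1" for x
      using degree_monic_char_poly[OF M[of x]] by auto
    fix z assume z: "z \<in> Z"
    \<comment> \<open>An eigenvector must be nonzero; the vector of generators is, because 1 is a
      combination of its entries.\<close>
    have "\<exists>k<N. m k z \<noteq> 0"
    proof (rule ccontr)
      assume "\<not> ?thesis"
      then have "(\<Sum>k<N. b k (f z) * m k z) = 0" by (intro sum.neutral) auto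
      then show False using b[OF z] by simp
    qed
    then obtain k where k: "k < N" "m k z \<noteq> 0" by blast
    define v where "v = Matrix.vec N (\<lambda>k. m k z)"
    have "eigenvector (M (f z)) v (u z)"
      unfolding eigenvector_def
    proof (intro conjI)
      show "v \<in> carrier_vec (dim_row (M (f z)))" by (simp add: v_def M_def)
      show "v \<noteq> 0\<^sub>v (dim_row (M (f z)))"
      proof
        assume "v = 0\<^sub>v (dim_row (M (f z)))"
        then have "vec_index v k = 0" using k by (simp add: M_def)
        then show False using k by (simp add: v_def)
      qed
      show "M (f z) *\<^sub>v v = u z \<cdot>\<^sub>v v"
        by (rule eq_vecI) (auto simp: v_def M_def scalar_prod_def am[OF _ z] atLeast0LessThan)
    qed
    then show "poly (char_poly (M (f z))) (u z) = 0"
      using eigenvalue_root_char_poly[OF M] by (auto simp: eigenvalue_def)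
  qed
qed

section \<open>Lying over\<close>

text \<open>Over the complex numbers, having no common root means being coprime. Each root of
  \<open>G\<close> is forced to be a root of \<open>C\<close>, and the linear factor is
  cancelled.\<close>

lemma dvd_of_no_common_root:
  fixes G S C :: "complex poly"
  assumes "G dvd C * S" "G \<noteq> 0" and "\<And>t. poly G t = 0 \<Longrightarrow> poly S t \<noteq> 0"
  shows "G dvd C"
  using assms
proof (induction "degree G" arbitrary: G C rule: less_induct)
  case less
  show ?case
  proof (cases "degree G = 0")
    case True
    then have "is_unit G" using less.prems(2) by (simp add: is_unit_iff_degree)
    then show ?thesis by (rule unit_imp_dvd)
  next
    case False
    then obtain r G' where G': "G = [:-r, 1:] * G'" and ne: "G' \<noteq> 0"
      and deg: "degree G = Suc (degree G')" and r: "poly G r = 0"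
      by (rule linear_factor)
    have "poly (C * S) r = 0" using less.prems(1) r by (metis dvdE mult_zero_left poly_mult)
    then have "poly C r = 0" using less.prems(3)[OF r] by simp
    then obtain C' where C': "C = [:-r, 1:] * C'" by (metis dvdE poly_eq_0_iff_dvd)
    have "G' dvd C'"
    proof (rule less.hyps)
      show "G' \<noteq> 0" "degree G' < degree G" using ne deg by simp_all
      have "[:-r, 1:] * G' dvd [:-r, 1:] * (C' * S)" using less.prems(1) unfolding G' C' by (simp only: mult.assoc)
      then show "G' dvd C' * S" by (subst (asm) dvd_mult_cancel_left) auto
      show "poly S t \<noteq> 0" if "poly G' t = 0" for t
        using that less.prems(3)[of t] unfolding G' poly_mult by simp
    qed
    then show ?thesis unfolding G' C' by (rule mult_dvd_mono[OF dvd_refl])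
  qed
qed

text \<open>
  The projection of a Zariski closed set is closed if the last coordinate is integral. The
  polynomial that would separate \<open>p\<close> from the projection is the resultant of \<open>G\<close> and \<open>S\<close>, in
  the form of the determinant of multiplication by \<open>S\<close> modulo \<open>G\<close>.
\<close>

lemma integral_projection_closed:
  fixes W :: "(nat \<Rightarrow> complex) set"
  assumes G: "G \<in> poly_fam (crd k)" "\<And>x. degree (G x) = e" "\<And>x. lead_coeff (G x) = 1"
    and W: "\<And>w. w \<in> W \<Longrightarrow> poly (G w) (w k) = 0"
    and p: "\<And>T. T \<in> fun_alg (crd k) \<Longrightarrow> (\<And>w. w \<in> W \<Longrightarrow> T w = 0) \<Longrightarrow> T p = 0"
  shows "\<exists>\<zeta>. \<forall>T\<in>fun_alg (crd (Suc k)). (\<forall>w\<in>W. T w = 0) \<longrightarrow> T (p(k := \<zeta>)) = 0"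
proof (rule ccontr)
  assume "\<not> ?thesis"
  then have "\<forall>\<zeta>. \<exists>T. T \<in> fun_alg (crd (Suc k)) \<and> (\<forall>w\<in>W. T w = 0) \<and> T (p(k := \<zeta>)) \<noteq> 0" by blast
  then obtain T where T: "\<And>\<zeta>. T \<zeta> \<in> fun_alg (crd (Suc k))" "\<And>\<zeta> w. w \<in> W \<Longrightarrow> T \<zeta> w = 0"
    "\<And>\<zeta>. T \<zeta> (p(k := \<zeta>)) \<noteq> 0" by metis
  have Gne: "G x \<noteq> 0" for x using G(3)[of x] by auto
  define rt where "rt = {t. poly (G p) t = 0}"
  have rt: "finite rt" unfolding rt_def by (rule poly_roots_finite[OF Gne])
  \<comment> \<open>Every candidate value is excluded by some function; those for the finitely many
    roots of \<open>G p\<close> are merged into one. The weights leave only the summand for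
    \<open>t\<close> at \<open>p(k := t)\<close>.\<close>
  define S where "S x = (\<Sum>\<zeta>\<in>rt. T \<zeta> x * (\<Prod>\<zeta>'\<in>rt - {\<zeta>}. x k - \<zeta>'))" for x
  have S: "S \<in> fun_alg (crd (Suc k))" unfolding S_def
    by (intro fun_alg_intros T crd_var) auto
  have SW: "S w = 0" if "w \<in> W" for w using T(2)[OF that] by (simp add: S_def)
  have Sp: "S (p(k := t)) \<noteq> 0" if t: "t \<in> rt" for t
  proof -
    have "S (p(k := t)) = (\<Sum>\<zeta>\<in>rt. if \<zeta> = t then T t (p(k := t)) * (\<Prod>\<zeta>'\<in>rt - {t}. t - \<zeta>') else 0)"
      unfolding S_def
    proof (rule sum.cong[OF refl])
      fix \<zeta> assume "\<zeta> \<in> rt"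
      have "(\<Prod>\<zeta>'\<in>rt - {\<zeta>}. t - \<zeta>') = 0" if "\<zeta> \<noteq> t"
        using that t rt by (intro prod_zero) auto
      then show "T \<zeta> (p(k := t)) * (\<Prod>\<zeta>'\<in>rt - {\<zeta>}. (p(k := t)) k - \<zeta>') =
        (if \<zeta> = t then T t (p(k := t)) * (\<Prod>\<zeta>'\<in>rt - {t}. t - \<zeta>') else 0)" by auto
    qed
    also have "\<dots> = T t (p(k := t)) * (\<Prod>\<zeta>'\<in>rt - {t}. t - \<zeta>')" using t rt by simp
    also have "\<dots> \<noteq> 0" using T(3) rt by auto
    finally show ?thesis .
  qed
  obtain SF where SF: "SF \<in> poly_fam (crd k)" "\<And>x. S x = poly (SF x) (x k)"
    using fun_alg_insert[OF S[unfolded crd_Suc]] by blast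
  have SFp: "poly (SF p) t \<noteq> 0" if "poly (G p) t = 0" for t
  proof -
    have "SF (p(k := t)) = SF p" by (rule poly_fam_crd_local[OF SF(1)]) simp
    then show ?thesis using Sp[of t] that SF(2)[of "p(k := t)"] by (simp add: rt_def)
  qed
  have "\<forall>i. \<exists>Q R. R \<in> poly_fam (crd k) \<and>
    (\<forall>x. monom 1 i * SF x = Q x * G x + R x \<and> (\<forall>j\<ge>e. coeff (R x) j = 0))"
    using poly_fam_divide_monic[OF G(1) poly_fam_mult[OF poly_fam_const SF(1)] G(2,3)] by blast
  then obtain Q R where R: "\<And>i. R i \<in> poly_fam (crd k)"
    "\<And>i x. monom 1 i * SF x = Q i x * G x + R i x" "\<And>i x j. j \<ge> e \<Longrightarrow> coeff (R i x) j = 0" by metis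
  \<comment> \<open>Row \<open>i\<close> is the remainder, modulo \<open>G x\<close>, of
    \<open>SF x\<close> times the \<open>i\<close>-th power of the variable.\<close>
  define M where "M x = mat e e (\<lambda>(i, j). coeff (R i x) j)" for x
  have M: "M x \<in> carrier_mat e e" for x by (simp add: M_def)
  define D where "D x = det (M x)" for x
  have D: "D \<in> fun_alg (crd k)" unfolding D_def
    by (rule fun_alg_det[OF M]) (auto simp: M_def intro: poly_fam_coeff R(1))
  have "D w = 0" if w: "w \<in> W" for w
  proof -
    have "e > 0"
    proof (rule ccontr)
      assume "\<not> e > 0"
      then have "degree (G w) = 0" using G(2) by simp
      then obtain c where "G w = [:c:]" by (rule degree_eq_zeroE)
      then show False using W[OF w] G(3)[of w] by simp
    qed
    \<comment> \<open>At a point of \<open>W\<close> both polynomials have the root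
      \<open>w k\<close>, so the powers of \<open>w k\<close> form a kernel vector.\<close>
    define v where "v = Matrix.vec e (\<lambda>j. w k ^ j)"
    have "v \<in> carrier_vec e" by (simp add: v_def)
    moreover have "v \<noteq> 0\<^sub>v e"
    proof
      assume "v = 0\<^sub>v e"
      then have "vec_index v 0 = 0" using \<open>e > 0\<close> by simp
      then show False using \<open>e > 0\<close> by (simp add: v_def)
    qed
    moreover have "M w *\<^sub>v v = 0\<^sub>v e"
    proof (rule eq_vecI)
      fix i assume "i < dim_vec (0\<^sub>v e :: complex vec)"
      then have i: "i < e" by simp
      have "poly (R i w) (w k) = (\<Sum>j<e. coeff (R i w) j * w k ^ j)"
        by (rule poly_eq_sum_lessThan) (rule R(3))
      moreover have "poly (R i w) (w k) = 0"
      proof -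
        have "poly (monom 1 i * SF w) (w k) = 0" using SW[OF w] SF(2)[of w] by simp
        then show ?thesis using W[OF w] by (simp add: R(2))
      qed
      ultimately show "vec_index (M w *\<^sub>v v) i = vec_index (0\<^sub>v e) i"
        using i by (simp add: M_def v_def scalar_prod_def atLeast0LessThan)
    qed (simp add: M_def)
    ultimately show ?thesis
      unfolding D_def using det_0_iff_vec_prod_zero_field[OF M] by blast
  qed
  then have "D p = 0" using p[OF D] by blast
  then have "det (transpose_mat (M p)) = 0" using det_transpose[OF M] by (simp add: D_def)
  then obtain c where c: "c \<in> carrier_vec e" "c \<noteq> 0\<^sub>v e" "transpose_mat (M p) *\<^sub>v c = 0\<^sub>v e"
    using det_0_iff_vec_prod_zero_field[of "transpose_mat (M p)" e] M by auto
  have lin: "(\<Sum>i<e. vec_index c i * coeff (R i p) j) = 0" if "j < e" for j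
  proof -
    have "vec_index (transpose_mat (M p) *\<^sub>v c) j = 0" using c(3) that by simp
    then show ?thesis using that c(1)
      by (simp add: M_def scalar_prod_def atLeast0LessThan mult.commute)
  qed
  \<comment> \<open>A kernel vector of the transpose is a polynomial of degree less than
    \<open>e\<close> whose product with \<open>SF p\<close> is divisible by \<open>G p\<close>.
    Coprimality forces it to be 0.\<close>
  define C where "C = (\<Sum>i<e. monom (vec_index c i) i)"
  have "(\<Sum>i<e. smult (vec_index c i) (R i p)) = 0"
  proof (rule poly_eqI)
    fix j
    show "coeff (\<Sum>i<e. smult (vec_index c i) (R i p)) j = coeff 0 j"
      using lin[of j] R(3)[of j] by (cases "j < e") (auto simp: coeff_sum)
  qed
  moreover have "C * SF p = (\<Sum>i<e. smult (vec_index c i) (monom 1 i * SF p))"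
  proof -
    have "monom (vec_index c i) i * SF p = smult (vec_index c i) (monom 1 i * SF p)" for i
      unfolding mult_smult_left[symmetric] smult_monom by simp
    then show ?thesis by (simp add: C_def sum_distrib_right)
  qed
  ultimately have "C * SF p = (\<Sum>i<e. smult (vec_index c i) (Q i p)) * G p"
    unfolding R(2) smult_add_right sum.distrib by (simp add: sum_distrib_right)
  then have "G p dvd C * SF p" by simp
  then have "G p dvd C" using Gne SFp by (rule dvd_of_no_common_root)
  moreover have coeffC: "coeff C i = (if i < e then vec_index c i else 0)" for i
    by (simp add: C_def coeff_sum coeff_monom)
  ultimately have "C = 0"
  proof -
    assume dvd: "G p dvd C"
    show ?thesis
    proof (rule ccontr)
      assume "C \<noteq> 0"
      then have "coeff C (degree C) \<noteq> 0" by simp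
      then have "degree C < e" using coeffC[of "degree C"] by (cases "degree C < e") auto
      then show False using dvd_imp_degree_le[OF dvd \<open>C \<noteq> 0\<close>] G(2)[of p] by simp
    qed
  qed
  have "c = 0\<^sub>v e"
  proof (rule eq_vecI)
    fix i assume "i < dim_vec (0\<^sub>v e :: complex vec)"
    then show "vec_index c i = vec_index (0\<^sub>v e) i" using coeffC[of i] \<open>C = 0\<close> by simp
  qed (use c(1) in simp)
  then show False using c(2) by simp
qed

section \<open>Minimal polynomials over the coordinate functions\<close>

lemma tendsto_fun_coordinatewise:
  fixes p :: "'k \<Rightarrow> nat \<Rightarrow> complex"
  assumes "\<And>i. ((\<lambda>k. p k i) \<longlongrightarrow> q i) F"
  shows "(p \<longlongrightarrow> q) F"
proof -
  have "limitin (product_topology (\<lambda>i. euclidean) UNIV) p q F"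
    unfolding limitin_componentwise using assms by simp
  then show ?thesis by (simp add: euclidean_product_topology)
qed

lemma crd_tendsto:
  assumes u: "u \<in> fun_alg (crd d)" and "\<And>i. i < d \<Longrightarrow> ((\<lambda>k. p k i) \<longlongrightarrow> q i) F"
  shows "((\<lambda>k. u (p k)) \<longlongrightarrow> u q) F"
  using u by induction (auto simp: crd_def intro: tendsto_intros assms(2))

text \<open>Up to the leading coefficient the coefficients are elementary symmetric functions of the
  roots; splitting off one root costs a factor \<open>1 + \<rho>\<close>.\<close>

lemma coeff_bound_by_roots:
  fixes p :: "complex poly"
  assumes "\<And>t. poly p t = 0 \<Longrightarrow> norm t \<le> \<rho>" and "\<rho> \<ge> 0"
  shows "norm (coeff p i) \<le> (1 + \<rho>) ^ degree p * norm (lead_coeff p)"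
  using assms(1)
proof (induction "degree p" arbitrary: p i)
  case 0
  then have "degree p = 0" by simp
  then obtain c where "p = [:c:]" by (rule degree_eq_zeroE)
  then show ?case by (cases i) auto
next
  case (Suc n)
  then have "degree p \<noteq> 0" by simp
  then obtain r q where p: "p = [:-r, 1:] * q" and deg: "degree p = Suc (degree q)" and r: "poly p r = 0"
    by (rule linear_factor)
  have lc: "lead_coeff p = lead_coeff q" unfolding p lead_coeff_mult by simp
  have IH: "norm (coeff q j) \<le> (1 + \<rho>) ^ degree q * norm (lead_coeff q)" for j
  proof (rule Suc.hyps(1))
    show "n = degree q" using Suc.hyps(2) deg by simp
    show "norm t \<le> \<rho>" if "poly q t = 0" for t using that by (intro Suc.prems) (simp add: p)
  qed
  have "norm r \<le> \<rho>" using Suc.prems[OF r] .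
  have "p = smult (-r) q + pCons 0 q" by (simp add: p)
  then have "coeff p i = - r * coeff q i + (case i of 0 \<Rightarrow> 0 | Suc j \<Rightarrow> coeff q j)"
    by (simp add: coeff_pCons)
  then have "norm (coeff p i) \<le> norm r * norm (coeff q i) + norm (case i of 0 \<Rightarrow> 0 | Suc j \<Rightarrow> coeff q j)"
    using norm_triangle_ineq[of "- r * coeff q i" "case i of 0 \<Rightarrow> 0 | Suc j \<Rightarrow> coeff q j"]
    by (simp add: norm_mult)
  also have "norm (case i of 0 \<Rightarrow> 0 | Suc j \<Rightarrow> coeff q j) \<le> (1 + \<rho>) ^ degree q * norm (lead_coeff q)"
    using IH \<open>\<rho> \<ge> 0\<close> by (auto split: nat.split)
  also have "norm r * norm (coeff q i) \<le> \<rho> * ((1 + \<rho>) ^ degree q * norm (lead_coeff q))"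
    by (rule mult_mono[OF \<open>norm r \<le> \<rho>\<close> IH \<open>\<rho> \<ge> 0\<close>]) simp
  finally have "norm (coeff p i) \<le> (1 + \<rho>) ^ Suc (degree q) * norm (lead_coeff q)"
    by (simp add: algebra_simps)
  then show ?case using lc deg by simp
qed

text \<open>Cauchy's bound. Were it violated, \<open>norm t\<close> would exceed 1, so each lower
  term would be at most its coefficient times \<open>norm t ^ (degree G - 1)\<close>, and this power
  can be cancelled.\<close>

lemma root_bound:
  fixes G :: "complex poly"
  assumes "lead_coeff G = 1" "poly G t = 0"
  shows "norm t \<le> 1 + (\<Sum>i<degree G. norm (coeff G i))"
proof (rule ccontr)
  assume "\<not> ?thesis"
  then have t: "norm t > 1 + (\<Sum>i<degree G. norm (coeff G i))" by simp
  have t1: "norm t > 1" using t sum_nonneg[of "{..<degree G}" "\<lambda>i. norm (coeff G i)"] by simp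
  have eq: "(\<Sum>i<degree G. coeff G i * t ^ i) + t ^ degree G = 0"
    using assms unfolding poly_altdef by (simp flip: lessThan_Suc_atMost)
  have "degree G \<noteq> 0"
  proof
    assume "degree G = 0"
    then show False using eq by simp
  qed
  then obtain N where N: "degree G = Suc N" using not0_implies_Suc by blast
  have "norm t * norm t ^ N = norm (t ^ degree G)" by (simp add: N norm_mult norm_power)
  also have "t ^ degree G = - (\<Sum>i<degree G. coeff G i * t ^ i)"
    using eq by (simp add: add_eq_0_iff)
  also have "norm \<dots> \<le> (\<Sum>i<degree G. norm (coeff G i * t ^ i))"
    using norm_sum by (simp only: norm_minus_cancel)
  also have "\<dots> \<le> (\<Sum>i<degree G. norm (coeff G i) * norm t ^ N)"
    by (intro sum_mono) (auto simp: N norm_mult norm_power intro!: mult_left_mono power_increasing less_imp_le[OF t1])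
  also have "\<dots> = (\<Sum>i<degree G. norm (coeff G i)) * norm t ^ N" by (simp add: sum_distrib_right)
  finally have "norm t \<le> (\<Sum>i<degree G. norm (coeff G i))"
    by (rule mult_right_le_imp_le) (use t1 in \<open>intro zero_less_power, linarith\<close>)
  then show False using t by simp
qed

text \<open>The constant term is the product of the roots up to sign, so it dominates the power of
  the smallest one. This is the quantitative continuity of roots on which lifting rests.\<close>

lemma small_root:
  fixes p :: "complex poly"
  assumes "lead_coeff p = 1" "degree p \<noteq> 0"
  shows "\<exists>t. poly p t = 0 \<and> norm t ^ degree p \<le> norm (coeff p 0)"
proof -
  have lower: "m ^ degree q \<le> norm (poly q 0)"
    if "lead_coeff q = 1" "\<And>t. poly q t = 0 \<Longrightarrow> m \<le> norm t" "m \<ge> 0" for m and q :: "complex poly"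
    using that(1,2)
  proof (induction "degree q" arbitrary: q)
    case 0
    then have "degree q = 0" by simp
    then obtain c where "q = [:c:]" by (rule degree_eq_zeroE)
    then show ?case using "0.prems"(1) by simp
  next
    case (Suc n)
    then have "degree q \<noteq> 0" by simp
    then obtain r q' where q: "q = [:-r, 1:] * q'" and deg: "degree q = Suc (degree q')"
      and r: "poly q r = 0"
      by (rule linear_factor)
    have lc: "lead_coeff q = lead_coeff q'" unfolding q lead_coeff_mult by simp
    have IH: "m ^ degree q' \<le> norm (poly q' 0)"
    proof (rule Suc.hyps(1))
      show "n = degree q'" using Suc.hyps(2) deg by simp
      show "lead_coeff q' = 1" using Suc.prems(1) lc by simp
      show "m \<le> norm t" if "poly q' t = 0" for t using that by (intro Suc.prems) (simp add: q)
    qed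
    have "m * m ^ degree q' \<le> norm r * norm (poly q' 0)"
      using Suc.prems(2)[OF r] IH \<open>m \<ge> 0\<close> by (intro mult_mono) auto
    then show ?case unfolding deg by (simp add: q norm_mult)
  qed
  have "p \<noteq> 0" using assms(2) by auto
  then have fin: "finite {t. poly p t = 0}" by (rule poly_roots_finite)
  obtain r where "poly p r = 0"
    using fundamental_theorem_of_algebra_alt[of p] assms(2) by (metis degree_pCons_0)
  then have "{t. poly p t = 0} \<noteq> {}" by blast
  then obtain t where t: "t \<in> {t. poly p t = 0}" "\<And>s. s \<in> {t. poly p t = 0} \<Longrightarrow> norm t \<le> norm s"
    using ex_is_arg_min_if_finite[OF fin, of norm] by (auto simp: is_arg_min_linorder)
  then have "norm t ^ degree p \<le> norm (poly p 0)" by (intro lower assms(1)) auto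
  then show ?thesis using t(1) by (auto simp: poly_0_coeff_0)
qed

lemma inverse_Suc_tendsto_zero:
  "(\<lambda>k. inverse (of_nat (Suc k)) :: complex) \<longlonglongrightarrow> 0"
  by (rule tendsto_norm_zero_cancel)
     (use LIMSEQ_inverse_real_of_nat in \<open>simp add: norm_inverse del: of_nat_Suc\<close>)

text \<open>On the line from \<open>x\<close> to \<open>y\<close> the function \<open>u\<close> has
  finitely many zeros; the parameters \<open>\<tau> k\<close> avoid them after an initial
  segment.\<close>

lemma crd_generic_sequence:
  assumes u: "u \<in> fun_alg (crd d)" and y: "u y \<noteq> 0"
  shows "\<exists>s. (\<forall>k. u (s k) \<noteq> 0) \<and> (\<lambda>k. s k) \<longlonglongrightarrow> x"
proof -
  obtain P where P: "\<And>t. u (\<lambda>i. x i + t * (y i - x i)) = poly P t"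
    using crd_along_line[OF u, of x "\<lambda>i. y i - x i"] by blast
  have "poly P 1 \<noteq> 0" using P[of 1] y by simp
  then have "P \<noteq> 0" by auto
  then have fin: "finite {t. poly P t = 0}" by (rule poly_roots_finite)
  define \<tau> :: "nat \<Rightarrow> complex" where "\<tau> k = inverse (of_nat (Suc k))" for k
  have "inj \<tau>"
  proof (rule injI)
    fix k l assume "\<tau> k = \<tau> l"
    then have "(of_nat (Suc k) :: complex) = of_nat (Suc l)" unfolding \<tau>_def by (rule inverse_eq_imp_eq)
    then show "k = l" unfolding of_nat_eq_iff by simp
  qed
  with fin have "finite (\<tau> -` {t. poly P t = 0})" by (rule finite_vimageI)
  then obtain N where N: "\<forall>k\<in>\<tau> -` {t. poly P t = 0}. k \<le> N"
    unfolding finite_nat_set_iff_bounded_le by (elim exE)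
  have P0: "poly P (\<tau> (k + Suc N)) \<noteq> 0" for k
  proof
    assume "poly P (\<tau> (k + Suc N)) = 0"
    then have "k + Suc N \<le> N" using N by simp
    then show False by simp
  qed
  define s where "s k = (\<lambda>i. x i + \<tau> (k + Suc N) * (y i - x i))" for k
  have "u (s k) \<noteq> 0" for k unfolding s_def P by (rule P0)
  moreover have "s \<longlonglongrightarrow> x"
  proof (rule tendsto_fun_coordinatewise)
    fix i
    have "\<tau> \<longlonglongrightarrow> 0" unfolding \<tau>_def by (rule inverse_Suc_tendsto_zero)
    then have "(\<lambda>k. \<tau> (k + Suc N)) \<longlonglongrightarrow> 0" by (rule LIMSEQ_ignore_initial_segment)
    then have "(\<lambda>k. x i + \<tau> (k + Suc N) * (y i - x i)) \<longlonglongrightarrow> x i + 0 * (y i - x i)"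
      by (intro tendsto_intros)
    then show "(\<lambda>k. s k i) \<longlonglongrightarrow> x i" by (simp add: s_def)
  qed
  ultimately show ?thesis by blast
qed

section \<open>Monic minimal polynomials\<close>

locale normalized_variety =
  fixes Z :: "(complex^'n::finite) set" and d :: nat and f :: "complex^'n \<Rightarrow> nat \<Rightarrow> complex"
  assumes irred: "irreducible_variety Z"
    and fin: "module_finite Z d f"
    and indep: "\<And>q x. q \<in> fun_alg (crd d) \<Longrightarrow> (\<And>z. z \<in> Z \<Longrightarrow> q (f z) = 0) \<Longrightarrow> q x = 0"
begin

definition annihilates :: "((nat \<Rightarrow> complex) \<Rightarrow> complex poly) \<Rightarrow> (complex^'n \<Rightarrow> complex) \<Rightarrow> bool" where
  "annihilates S u \<longleftrightarrow> S \<in> poly_fam (crd d) \<and> (\<forall>z\<in>Z. poly (S (f z)) (u z) = 0)"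

text \<open>Division is required at every \<open>x\<close>, not only generically. So a root of
  \<open>F x\<close> over an arbitrary \<open>x\<close> is a root of every relation for
  \<open>u\<close>, which is what lifting a point needs.\<close>

definition minimal_poly :: "((nat \<Rightarrow> complex) \<Rightarrow> complex poly) \<Rightarrow> (complex^'n \<Rightarrow> complex) \<Rightarrow> bool" where
  "minimal_poly F u \<longleftrightarrow> annihilates F u \<and>
    (\<exists>e. \<forall>x. degree (F x) = e \<and> lead_coeff (F x) = 1) \<and>
    (\<forall>S. annihilates S u \<longrightarrow> (\<forall>x. F x dvd S x))"

lemma nonempty: "Z \<noteq> {}"
  using irred by (simp add: irreducible_variety_def)

lemma affine: "affine_variety Z"
  using irred by (simp add: irreducible_variety_def)

lemma poly_fam_vcrd:
  assumes "S \<in> poly_fam (crd d)" "u \<in> fun_alg vcrd"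
  shows "(\<lambda>z. poly (S (f z)) (u z)) \<in> fun_alg vcrd"
proof (rule poly_fam_eval[OF poly_fam_compose[OF assms(1)] assms(2)])
  show "(\<lambda>y. g (f y)) \<in> fun_alg vcrd" if "g \<in> crd d" for g
    using module_finite_compose[OF fin] that by (blast intro: fun_alg.gen)
qed

text \<open>Take an annihilating family \<open>S0\<close> of least formal degree \<open>e\<close>,
  with top coefficient \<open>a\<close>. Where \<open>a\<close> is nonzero, the roots of
  \<open>S0 x\<close> are roots of a monic integral equation and hence locally bounded. So the
  coefficients of \<open>S0\<close> divided by \<open>a\<close> are locally bounded, therefore
  polynomials, and give the monic \<open>F\<close>.\<close>

lemma exists_minimal_poly:
  assumes u: "u \<in> fun_alg vcrd"
  shows "\<exists>F. minimal_poly F u"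
proof -
  obtain G N where G: "G \<in> poly_fam (crd d)" "\<And>x. degree (G x) = N" "\<And>x. lead_coeff (G x) = 1"
    "\<And>z. z \<in> Z \<Longrightarrow> poly (G (f z)) (u z) = 0"
    using module_finite_integral[OF fin u] by blast
  define good where "good e \<longleftrightarrow> (\<exists>S. annihilates S u \<and> (\<forall>x. \<forall>i>e. coeff (S x) i = 0) \<and>
    (\<exists>x. coeff (S x) e \<noteq> 0))" for e
  have "good N" unfolding good_def annihilates_def
  proof (intro exI[of _ G] conjI allI impI ballI)
    show "coeff (G x) i = 0" if "i > N" for x i using that G(2)[of x] by (intro coeff_eq_0) simp
    show "\<exists>x. coeff (G x) N \<noteq> 0" using G(2,3) by (intro exI[of _ undefined]) (metis one_neq_zero)
  qed (use G in auto)
  define e where "e = (LEAST e. good e)"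
  have "good e" unfolding e_def using \<open>good N\<close> by (rule LeastI)
  have least: "\<not> good i" if "i < e" for i using that not_less_Least unfolding e_def by blast
  \<comment> \<open>The highest coefficient of \<open>R\<close> that is not identically zero would
    give a formal degree below \<open>e\<close>.\<close>
  have small: "R x = 0" if R: "annihilates R u" and deg: "\<And>x i. i \<ge> e \<Longrightarrow> coeff (R x) i = 0" for R x
  proof (rule ccontr)
    assume "R x \<noteq> 0"
    define I where "I = {i. \<exists>x. coeff (R x) i \<noteq> 0}"
    have I: "I \<subseteq> {..<e}" using deg by (auto simp: I_def not_less[symmetric])
    have "I \<noteq> {}" using \<open>R x \<noteq> 0\<close> by (auto simp: I_def poly_eq_iff)
    have finI: "finite I" using I finite_subset by blast
    define i where "i = Max I"
    have "i \<in> I" unfolding i_def using finI \<open>I \<noteq> {}\<close> by (rule Max_in)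
    have "coeff (R y) j = 0" if "j > i" for y j
    proof (rule ccontr)
      assume "coeff (R y) j \<noteq> 0"
      then have "j \<in> I" by (auto simp: I_def)
      then have "j \<le> i" unfolding i_def using finI by simp
      then show False using that by simp
    qed
    then have "good i" unfolding good_def using R \<open>i \<in> I\<close>
      by (intro exI[of _ R]) (auto simp: I_def)
    moreover have "i < e" using \<open>i \<in> I\<close> I by auto
    ultimately show False using least by blast
  qed
  obtain S0 y where S0: "annihilates S0 u" "\<And>x i. i > e \<Longrightarrow> coeff (S0 x) i = 0" "coeff (S0 y) e \<noteq> 0"
    using \<open>good e\<close> unfolding good_def by blast
  have S0fam: "S0 \<in> poly_fam (crd d)" using S0(1) by (simp add: annihilates_def)
  define a where "a x = coeff (S0 x) e" for x
  have a: "a \<in> fun_alg (crd d)" unfolding a_def[abs_def] by (rule poly_fam_coeff[OF S0fam])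
  have ay: "a y \<noteq> 0" using S0(3) by (simp add: a_def)
  obtain k Q R where QR: "Q \<in> poly_fam (crd d)" "R \<in> poly_fam (crd d)"
    "\<And>x. smult (a x ^ k) (G x) = Q x * S0 x + R x" "\<And>x i. i \<ge> e \<Longrightarrow> coeff (R x) i = 0"
    using poly_fam_pseudo_divide[OF S0fam S0(2) G(1)] unfolding a_def by blast
  have "poly (R (f z)) (u z) = 0" if "z \<in> Z" for z
  proof -
    have "poly (smult (a (f z) ^ k) (G (f z))) (u z) = 0" using G(4)[OF that] by simp
    moreover have "poly (S0 (f z)) (u z) = 0" using S0(1) that by (simp add: annihilates_def)
    ultimately show ?thesis unfolding QR(3) by simp
  qed
  then have "annihilates R u" using QR(2) by (simp add: annihilates_def)
  then have R0: "R x = 0" for x using QR(4) by (rule small)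
  define \<rho> where "\<rho> x = 1 + (\<Sum>i<N. norm (coeff (G x) i))" for x
  define B where "B x = (1 + \<rho> x) ^ e" for x
  have \<rho>0: "\<rho> x \<ge> 0" for x by (simp add: \<rho>_def sum_nonneg add_nonneg_nonneg)
  have contB: "continuous_on UNIV B" unfolding B_def \<rho>_def
    by (intro continuous_intros crd_continuous[OF poly_fam_coeff[OF G(1)]])
  have bound_generic: "norm (coeff (S0 x) i) \<le> B x * norm (a x)" if ax: "a x \<noteq> 0" for x i
  proof -
    have deg: "degree (S0 x) = e"
      using ax S0(2)[of e x] by (intro antisym degree_le le_degree) (auto simp: a_def S0(2))
    have "norm t \<le> \<rho> x" if "poly (S0 x) t = 0" for t
    proof -
      have "poly (smult (a x ^ k) (G x)) t = 0" unfolding QR(3) R0 using that by simp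
      then have "poly (G x) t = 0" using ax by simp
      then show ?thesis using root_bound[OF G(3)] unfolding G(2) \<rho>_def by blast
    qed
    then have "norm (coeff (S0 x) i) \<le> (1 + \<rho> x) ^ degree (S0 x) * norm (lead_coeff (S0 x))"
      by (rule coeff_bound_by_roots[OF _ \<rho>0])
    then show ?thesis by (simp add: deg B_def a_def)
  qed
  \<comment> \<open>Both sides are continuous, and \<open>x\<close> is a limit of points where
    \<open>a\<close> is nonzero.\<close>
  have bound: "norm (coeff (S0 x) i) \<le> B x * norm (a x)" for x i
  proof -
    obtain s where s: "\<And>k. a (s k) \<noteq> 0" "s \<longlonglongrightarrow> x"
      using crd_generic_sequence[where d = d and u = a and y = y and x = x] a ay by blast
    define h where "h x = B x * norm (a x) - norm (coeff (S0 x) i)" for x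
    have "continuous_on UNIV h" unfolding h_def
      by (intro continuous_intros contB crd_continuous[OF a] crd_continuous[OF poly_fam_coeff[OF S0fam]])
    then have "isCont h x" by (simp add: continuous_on_eq_continuous_at)
    then have "(\<lambda>k. h (s k)) \<longlonglongrightarrow> h x" using s(2) by (rule isCont_tendsto_compose)
    moreover have "h (s k) \<ge> 0" for k using bound_generic[OF s(1)] by (simp add: h_def)
    ultimately have "h x \<ge> 0" by (intro LIMSEQ_le_const) auto
    then show ?thesis by (simp add: h_def)
  qed
  have "\<exists>T\<in>fun_alg (crd d). \<forall>x. coeff (S0 x) i = a x * T x" for i
    using ay by (intro crd_bounded_quotient[OF poly_fam_coeff[OF S0fam] a _ contB bound]) blast
  then have "\<forall>i. \<exists>T. T \<in> fun_alg (crd d) \<and> (\<forall>x. coeff (S0 x) i = a x * T x)" by blast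
  from choice[OF this] obtain T where
    T: "\<And>i. T i \<in> fun_alg (crd d)" "\<And>i x. coeff (S0 x) i = a x * T i x" by blast
  define F where "F x = monom 1 e + (\<Sum>i<e. monom (T i x) i)" for x
  have F: "F \<in> poly_fam (crd d)" unfolding F_def
    by (intro poly_fam_add poly_fam_const poly_fam_sum poly_fam_monom T)
  have coeffF: "coeff (F x) i = (if i = e then 1 else if i < e then T i x else 0)" for x i
    by (auto simp: F_def coeff_sum coeff_monom)
  have degF: "degree (F x) = e" for x
    by (intro antisym degree_le le_degree) (auto simp: coeffF)
  have lcF: "lead_coeff (F x) = 1" for x by (simp add: degF coeffF)
  have S0F: "S0 x = smult (a x) (F x)" for x
  proof (rule poly_eqI)
    fix i
    show "coeff (S0 x) i = coeff (smult (a x) (F x)) i"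
      using T(2)[of x i] S0(2)[of i x] by (auto simp: coeffF a_def)
  qed
  \<comment> \<open>By independence \<open>a\<close> does not vanish identically on the image of
    \<open>Z\<close>, so it can be cancelled from the relation \<open>S0\<close>.\<close>
  have "\<forall>z\<in>Z. poly (F (f z)) (u z) = 0"
  proof -
    have "(\<forall>z\<in>Z. a (f z) = 0) \<or> (\<forall>z\<in>Z. poly (F (f z)) (u z) = 0)"
    proof (rule irreducible_no_zero_divisors[OF irred])
      show "(\<lambda>z. a (f z)) \<in> fun_alg vcrd" by (rule module_finite_compose[OF fin a])
      show "(\<lambda>z. poly (F (f z)) (u z)) \<in> fun_alg vcrd" by (rule poly_fam_vcrd[OF F u])
      show "a (f z) * poly (F (f z)) (u z) = 0" if "z \<in> Z" for z
        using S0(1) that by (simp add: annihilates_def S0F)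
    qed
    moreover have "\<not> (\<forall>z\<in>Z. a (f z) = 0)" using indep[OF a, of y] ay by blast
    ultimately show ?thesis by blast
  qed
  then have annF: "annihilates F u" using F by (simp add: annihilates_def)
  have "F x dvd S x" if S: "annihilates S u" for S x
  proof -
    have Sfam: "S \<in> poly_fam (crd d)" using S by (simp add: annihilates_def)
    obtain Q R where QR: "R \<in> poly_fam (crd d)" "\<And>x. S x = Q x * F x + R x"
      "\<And>x i. i \<ge> e \<Longrightarrow> coeff (R x) i = 0"
      using poly_fam_divide_monic[OF F Sfam degF lcF] by blast
    have "poly (R (f z)) (u z) = 0" if "z \<in> Z" for z
    proof -
      have "poly (S (f z)) (u z) = 0" "poly (F (f z)) (u z) = 0"
        using S annF that by (auto simp: annihilates_def)
      then show ?thesis by (simp add: QR(2))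
    qed
    then have "annihilates R u" using QR(1) by (simp add: annihilates_def)
    then have "R x = 0" using QR(3) by (rule small)
    then show ?thesis by (simp add: QR(2))
  qed
  then show ?thesis unfolding minimal_poly_def using annF degF lcF by blast
qed

lemma minimal_polyD:
  assumes "minimal_poly F u"
  shows "F \<in> poly_fam (crd d)" and "z \<in> Z \<Longrightarrow> poly (F (f z)) (u z) = 0"
    and "degree (F x) = degree (F y)" and "lead_coeff (F x) = 1" and "degree (F x) \<noteq> 0"
    and "annihilates S u \<Longrightarrow> F x dvd S x"
proof -
  obtain e where e: "\<And>x. degree (F x) = e" "\<And>x. lead_coeff (F x) = 1"
    using assms unfolding minimal_poly_def by blast
  have ann: "annihilates F u" using assms by (simp add: minimal_poly_def)
  then show "F \<in> poly_fam (crd d)" and *: "\<And>z. z \<in> Z \<Longrightarrow> poly (F (f z)) (u z) = 0"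
    by (auto simp: annihilates_def)
  show "degree (F x) = degree (F y)" "lead_coeff (F x) = 1" using e by auto
  show "F x dvd S x" if "annihilates S u" using assms that by (simp add: minimal_poly_def)
  show "degree (F x) \<noteq> 0"
  proof
    assume deg0: "degree (F x) = 0"
    obtain z where z: "z \<in> Z" using nonempty by blast
    have "degree (F (f z)) = 0" using deg0 e(1) by simp
    then obtain c where "F (f z) = [:c:]" by (rule degree_eq_zeroE)
    then show False using e(2)[of "f z"] *[OF z] by simp
  qed
qed

lemma minimal_poly_degree:
  assumes "minimal_poly F u" "annihilates S u" "degree (S x) < degree (F x)"
  shows "S x = 0"
  using minimal_polyD(6)[OF assms(1,2), of x] assms(3) dvd_imp_degree_le[of "F x" "S x"] by fastforce

section \<open>Lifting points and sequences\<close>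

text \<open>The sequence \<open>w z\<close> lists \<open>f z\<close>, then \<open>u z\<close>, then
  the coordinates of \<open>z\<close>. Starting from \<open>b\<close> and \<open>t\<close> the
  latter are adjoined one by one, keeping every polynomial relation that holds on the image of
  \<open>Z\<close>. The adjoined coordinates finally form a point of \<open>Z\<close>.\<close>

lemma lift_point:
  assumes u: "u \<in> fun_alg vcrd" and F: "minimal_poly F u" and root: "poly (F b) t = 0"
  shows "\<exists>z\<in>Z. (\<forall>i<d. f z i = b i) \<and> u z = t"
proof -
  obtain e :: "nat \<Rightarrow> 'n" and g where "\<forall>j. g j < CARD('n)" "\<forall>j. e (g j) = j"
    by (rule enumerate_finite_type)
  note g = this[rule_format]
  define w where "w z i = (if i < d then f z i else if i = d then u z else z $ e (i - Suc d))" for z i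
  have step: "\<exists>p. (\<forall>i<d. p i = b i) \<and> p d = t \<and>
    (\<forall>T\<in>fun_alg (crd (Suc d + j)). (\<forall>z\<in>Z. T (w z) = 0) \<longrightarrow> T p = 0)" for j
  proof (induction j)
    case 0
    \<comment> \<open>A relation between \<open>f\<close> and \<open>u\<close> is an annihilating
      family, and \<open>F b\<close> divides its specialization at \<open>b\<close>.\<close>
    have "T (b(d := t)) = 0" if T: "T \<in> fun_alg (crd (Suc d))" "\<forall>z\<in>Z. T (w z) = 0" for T
    proof -
      obtain S where S: "S \<in> poly_fam (crd d)" "\<And>x. T x = poly (S x) (x d)"
        using fun_alg_insert[OF T(1)[unfolded crd_Suc]] by blast
      have "S (w z) = S (f z)" for z by (rule poly_fam_crd_local[OF S(1)]) (simp add: w_def)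
      then have "poly (S (f z)) (u z) = 0" if "z \<in> Z" for z
        using T(2) that S(2)[of "w z"] by (simp add: w_def)
      then have "annihilates S u" using S(1) by (simp add: annihilates_def)
      then have "F b dvd S b" by (rule minimal_polyD(6)[OF F])
      then have "poly (S b) t = 0" using root by (metis dvdE mult_zero_left poly_mult)
      moreover have "S (b(d := t)) = S b" by (rule poly_fam_crd_local[OF S(1)]) simp
      ultimately show ?thesis using S(2)[of "b(d := t)"] by simp
    qed
    then have *: "\<forall>T\<in>fun_alg (crd (Suc d + 0)). (\<forall>z\<in>Z. T (w z) = 0) \<longrightarrow> T (b(d := t)) = 0"
      unfolding add_0_right by blast
    show ?case
    proof (intro exI conjI)
      show "\<forall>i<d. (b(d := t)) i = b i" "(b(d := t)) d = t" by auto
    qed (rule *)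
  next
    case (Suc j)
    then obtain p where "\<forall>i<d. p i = b i" "p d = t"
      "\<forall>T\<in>fun_alg (crd (Suc d + j)). (\<forall>z\<in>Z. T (w z) = 0) \<longrightarrow> T p = 0" by (elim exE conjE)
    note p = this[rule_format]
    let ?k = "Suc d + j"
    \<comment> \<open>The next coordinate of \<open>z\<close> is integral over \<open>f\<close>,
      hence over the variables already present.\<close>
    obtain G N where G: "G \<in> poly_fam (crd d)" "\<And>x. degree (G x) = N" "\<And>x. lead_coeff (G x) = 1"
      "\<And>z. z \<in> Z \<Longrightarrow> poly (G (f z)) (z $ e j) = 0"
      using module_finite_integral[OF fin vcrd_var] by blast
    have Gk: "G \<in> poly_fam (crd ?k)" by (rule poly_fam_mono[OF G(1) crd_mono]) simp
    have "\<exists>\<zeta>. \<forall>T\<in>fun_alg (crd (Suc ?k)). (\<forall>v\<in>w ` Z. T v = 0) \<longrightarrow> T (p(?k := \<zeta>)) = 0"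
    proof (rule integral_projection_closed[OF Gk G(2,3)])
      fix v assume "v \<in> w ` Z"
      then obtain z where z: "z \<in> Z" "v = w z" by blast
      have "G (w z) = G (f z)" by (rule poly_fam_crd_local[OF G(1)]) (simp add: w_def)
      then show "poly (G v) (v ?k) = 0" using G(4)[OF z(1)] by (simp add: z(2) w_def)
    next
      show "T p = 0" if "T \<in> fun_alg (crd ?k)" "\<And>v. v \<in> w ` Z \<Longrightarrow> T v = 0" for T
        by (rule p(3)[OF that(1)]) (rule that(2), rule imageI)
    qed
    then obtain \<zeta> where "\<forall>T\<in>fun_alg (crd (Suc ?k)). (\<forall>v\<in>w ` Z. T v = 0) \<longrightarrow> T (p(?k := \<zeta>)) = 0"
      by (elim exE)
    then have *: "\<forall>T\<in>fun_alg (crd (Suc d + Suc j)). (\<forall>z\<in>Z. T (w z) = 0) \<longrightarrow> T (p(?k := \<zeta>)) = 0"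
      unfolding add_Suc_right ball_simps .
    show ?case
    proof (intro exI conjI)
      show "\<forall>i<d. (p(?k := \<zeta>)) i = b i" "(p(?k := \<zeta>)) d = t" using p(1,2) by auto
    qed (rule *)
  qed
  obtain p where "\<forall>i<d. p i = b i" "p d = t"
    "\<forall>T\<in>fun_alg (crd (Suc d + CARD('n))). (\<forall>z\<in>Z. T (w z) = 0) \<longrightarrow> T p = 0"
    using step[of "CARD('n)"] by (elim exE conjE)
  note p = this[rule_format]
  define c where "c x = (\<chi> j. x (Suc d + g j))" for x :: "nat \<Rightarrow> complex"
  have cw: "c (w z) = z" for z by (simp add: c_def w_def g vec_eq_iff)
  have comp: "(\<lambda>x. q (c x)) \<in> fun_alg (crd (Suc d + CARD('n)))" if "q \<in> fun_alg vcrd" for q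
    by (rule fun_alg_compose[OF that]) (auto simp: vcrd_def c_def g intro!: crd_var)
  have van: "q (c p) = 0" if "q \<in> fun_alg vcrd" "\<And>z. z \<in> Z \<Longrightarrow> q z = 0" for q
    using p(3)[OF comp[OF that(1)]] that(2) unfolding cw by blast
  have "c p \<in> Z"
  proof (rule ccontr)
    assume "c p \<notin> Z"
    then obtain q where "q \<in> fun_alg vcrd" "\<And>z. z \<in> Z \<Longrightarrow> q z = 0" "q (c p) \<noteq> 0"
      using affine_variety_separate[OF affine] by blast
    then show False using van by blast
  qed
  moreover have "f (c p) i = b i" if "i < d" for i
  proof -
    have "(\<lambda>x. f (c x) i - x i) \<in> fun_alg (crd (Suc d + CARD('n)))"
      using that by (intro fun_alg_diff comp[OF module_finite_vcrd[OF fin]] crd_var) auto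
    moreover have "f (c (w z)) i - w z i = 0" for z using that unfolding cw by (simp add: w_def)
    ultimately have "f (c p) i - p i = 0" by (rule p(3))
    then show ?thesis using p(1)[OF that] by simp
  qed
  moreover have "u (c p) = t"
  proof -
    have "(\<lambda>x. u (c x) - x d) \<in> fun_alg (crd (Suc d + CARD('n)))"
      by (intro fun_alg_diff comp[OF u] crd_var) auto
    moreover have "u (c (w z)) - w z d = 0" for z unfolding cw by (simp add: w_def)
    ultimately have "u (c p) - p d = 0" by (rule p(3))
    then show ?thesis using p(2) by simp
  qed
  ultimately show ?thesis by blast
qed

end

section \<open>Lifting sequences through finite fibres\<close>

lemma vcrd_continuous: "u \<in> fun_alg vcrd \<Longrightarrow> continuous_on UNIV u"
  by (erule fun_alg_continuous) (auto simp: vcrd_def intro: continuous_intros)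

lemma vcrd_tendsto:
  assumes "u \<in> fun_alg vcrd" "(z \<longlongrightarrow> a) F"
  shows "((\<lambda>k. u (z k)) \<longlongrightarrow> u a) F"
proof -
  have "isCont u a" using vcrd_continuous[OF assms(1)] by (simp add: continuous_on_eq_continuous_at)
  then show ?thesis using assms(2) by (rule isCont_tendsto_compose)
qed

text \<open>By compactness a subsequence staying away from \<open>a\<close> would have a cluster
  point other than \<open>a\<close>.\<close>

lemma tendsto_by_subsequences:
  fixes z :: "nat \<Rightarrow> 'a::heine_borel"
  assumes "bounded (range z)"
    and "\<And>r l. strict_mono r \<Longrightarrow> (z \<circ> r) \<longlonglongrightarrow> l \<Longrightarrow> l = a"
  shows "z \<longlonglongrightarrow> a"
proof (rule ccontr)
  assume "\<not> ?thesis"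
  then obtain \<epsilon> where \<epsilon>: "\<epsilon> > 0" "\<not> (\<forall>\<^sub>F k in sequentially. dist (z k) a < \<epsilon>)"
    by (auto simp: tendsto_iff)
  then have "\<exists>\<^sub>F k in sequentially. dist (z k) a \<ge> \<epsilon>" by (simp add: frequently_def not_less not_le)
  then have "infinite {k. dist (z k) a \<ge> \<epsilon>}"
    by (simp add: frequently_cofinite cofinite_eq_sequentially[symmetric])
  from infinite_enumerate[OF this] have "\<exists>r :: nat \<Rightarrow> nat. strict_mono r \<and> (\<forall>k. dist (z (r k)) a \<ge> \<epsilon>)"
    by simp
  then obtain r :: "nat \<Rightarrow> nat" where r: "strict_mono r" "\<forall>k. dist (z (r k)) a \<ge> \<epsilon>"
    by blast
  then have r2: "dist (z (r k)) a \<ge> \<epsilon>" for k by simp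
  have "bounded (range (z \<circ> r))" by (rule bounded_subset[OF assms(1)]) auto
  then obtain l r' where l: "strict_mono r'" "((z \<circ> r) \<circ> r') \<longlonglongrightarrow> l"
    using bounded_imp_convergent_subsequence by blast
  have "l = a"
    by (rule assms(2)[of "r \<circ> r'"]) (use l r(1) strict_mono_o[of r r'] in \<open>simp_all add: o_assoc\<close>)
  with tendsto_dist_iff[THEN iffD1, OF l(2)]
  have "(\<lambda>k. dist (((z \<circ> r) \<circ> r') k) a) \<longlonglongrightarrow> 0" by simp
  then have "\<epsilon> \<le> 0" by (rule LIMSEQ_le_const) (use r2 in auto)
  then show False using \<epsilon>(1) by simp
qed

context normalized_variety
begin

text \<open>Over a fixed \<open>b\<close> each coordinate of \<open>z\<close> is a root of a monic
  polynomial.\<close>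

lemma fibre_finite: "finite {z \<in> Z. \<forall>i<d. f z i = b i}"
proof -
  have "\<forall>j. \<exists>G. G \<in> poly_fam (crd d) \<and> (\<forall>x. lead_coeff (G x) = 1) \<and> (\<forall>z\<in>Z. poly (G (f z)) (z $ j) = 0)"
    using module_finite_integral[OF fin vcrd_var] by (metis (no_types, lifting))
  from choice[OF this] obtain G where G: "\<And>j. G j \<in> poly_fam (crd d)" "\<And>j x. lead_coeff (G j x) = 1"
    "\<And>j z. z \<in> Z \<Longrightarrow> poly (G j (f z)) (z $ j) = 0" by blast
  define R where "R j = {t. poly (G j b) t = 0}" for j
  have "finite (R j)" for j
    unfolding R_def using G(2)[of j b] by (intro poly_roots_finite) auto
  then have "finite (PiE UNIV R)" by (intro finite_PiE) auto
  moreover have "{z \<in> Z. \<forall>i<d. f z i = b i} \<subseteq> (\<lambda>g. \<chi> j. g j) ` PiE UNIV R"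
  proof
    fix z assume z: "z \<in> {z \<in> Z. \<forall>i<d. f z i = b i}"
    have "z $ j \<in> R j" for j
    proof -
      have "G j (f z) = G j b" using z by (intro poly_fam_crd_local[OF G(1)]) auto
      then show ?thesis using G(3)[of z j] z by (simp add: R_def)
    qed
    then have "($) z \<in> PiE UNIV R" by (auto simp: PiE_def)
    then show "z \<in> (\<lambda>g. \<chi> j. g j) ` PiE UNIV R" by (intro image_eqI[of _ _ "($) z"]) auto
  qed
  ultimately show ?thesis by (meson finite_imageI finite_subset)
qed

text \<open>In the product, the factor for \<open>\<zeta>\<close> is 1 at \<open>a\<close> and 0 at
  \<open>\<zeta>\<close>. The zero of \<open>h\<close> thus singles out \<open>a\<close> in its
  fibre.\<close>

lemma exists_separating_function:
  assumes "a \<in> Z"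
  shows "\<exists>h\<in>fun_alg vcrd. h a = 0 \<and> (\<forall>z\<in>Z. (\<forall>i<d. f z i = f a i) \<longrightarrow> z \<noteq> a \<longrightarrow> h z = 1)"
proof -
  define \<Phi> where "\<Phi> = {z \<in> Z. \<forall>i<d. f z i = f a i} - {a}"
  have fin\<Phi>: "finite \<Phi>" using fibre_finite by (simp add: \<Phi>_def)
  have "\<exists>j. z $ j \<noteq> a $ j" if "z \<noteq> a" for z using that by (simp add: Finite_Cartesian_Product.vec_eq_iff)
  then have "\<forall>z. \<exists>j. z \<in> \<Phi> \<longrightarrow> z $ j \<noteq> a $ j" by (simp add: \<Phi>_def)
  from choice[OF this] obtain j where j: "\<And>z. z \<in> \<Phi> \<Longrightarrow> z $ j z \<noteq> a $ j z" by blast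
  define h where "h z = 1 - (\<Prod>\<zeta>\<in>\<Phi>. 1 - (z $ j \<zeta> - a $ j \<zeta>) * (1 / (\<zeta> $ j \<zeta> - a $ j \<zeta>)))" for z
  have "h \<in> fun_alg vcrd" unfolding h_def
    by (intro fun_alg_diff fun_alg_prod fun_alg.mult fun_alg.const vcrd_var)
  moreover have "h a = 0" by (simp add: h_def)
  moreover have "h z = 1" if "z \<in> Z" "\<forall>i<d. f z i = f a i" "z \<noteq> a" for z
  proof -
    have z: "z \<in> \<Phi>" using that by (simp add: \<Phi>_def)
    then have "1 - (z $ j z - a $ j z) * (1 / (z $ j z - a $ j z)) = 0" using j by simp
    then have "(\<Prod>\<zeta>\<in>\<Phi>. 1 - (z $ j \<zeta> - a $ j \<zeta>) * (1 / (\<zeta> $ j \<zeta> - a $ j \<zeta>))) = 0"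
      by (intro prod_zero[OF fin\<Phi>] bexI[OF _ z])
    then show ?thesis unfolding h_def by simp
  qed
  ultimately show ?thesis by blast
qed

text \<open>The constant term of the minimal polynomial of \<open>h\<close> is 0 at
  \<open>f a\<close>, so it tends to 0 along \<open>x\<close> and there are roots \<open>t k\<close>
  tending to 0. They lift to points of \<open>Z\<close> with bounded coordinates; a cluster point
  lies over \<open>f a\<close> and has \<open>h = 0\<close>, so it is \<open>a\<close>.\<close>

lemma lift_sequence:
  assumes a: "a \<in> Z" and x: "\<And>i. i < d \<Longrightarrow> (\<lambda>k. x k i) \<longlonglongrightarrow> f a i"
  shows "\<exists>z. (\<forall>k. z k \<in> Z \<and> (\<forall>i<d. f (z k) i = x k i)) \<and> z \<longlonglongrightarrow> a"
proof -
  obtain h where h: "h \<in> fun_alg vcrd" "h a = 0"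
    "\<And>z. z \<in> Z \<Longrightarrow> \<forall>i<d. f z i = f a i \<Longrightarrow> z \<noteq> a \<Longrightarrow> h z = 1"
    using exists_separating_function[OF a] by blast
  obtain F where F: "minimal_poly F h" using exists_minimal_poly[OF h(1)] by blast
  define e where "e = degree (F (f a))"
  have deg: "degree (F y) = e" for y using minimal_polyD(3)[OF F] by (simp add: e_def)
  have "e \<noteq> 0" using minimal_polyD(5)[OF F] by (simp add: e_def)
  define c where "c y = coeff (F y) 0" for y
  have "c (f a) = 0" using minimal_polyD(2)[OF F a] by (simp add: c_def h(2) poly_0_coeff_0)
  moreover have "(\<lambda>k. c (x k)) \<longlonglongrightarrow> c (f a)" unfolding c_def
    by (rule crd_tendsto[OF poly_fam_coeff[OF minimal_polyD(1)[OF F]] x])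
  ultimately have c0: "(\<lambda>k. norm (c (x k))) \<longlonglongrightarrow> 0" by (simp add: tendsto_norm_zero)
  have "\<forall>k. \<exists>t. poly (F (x k)) t = 0 \<and> norm t ^ e \<le> norm (c (x k))"
    using small_root[OF minimal_polyD(4,5)[OF F]] unfolding deg c_def by blast
  from choice[OF this] obtain t where t: "\<And>k. poly (F (x k)) (t k) = 0" "\<And>k. norm (t k) ^ e \<le> norm (c (x k))"
    by blast
  have t0: "t \<longlonglongrightarrow> 0"
  proof (rule Lim_null_comparison)
    have "norm (t k) \<le> root e (norm (c (x k)))" for k
      using \<open>e \<noteq> 0\<close> t(2)[of k] real_root_le_mono[of e "norm (t k) ^ e" "norm (c (x k))"]
      by (simp add: real_root_power_cancel)
    then show "\<forall>\<^sub>F k in sequentially. norm (t k) \<le> root e (norm (c (x k)))" by simp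
    have "(\<lambda>k. root e (norm (c (x k)))) \<longlonglongrightarrow> root e 0" by (intro tendsto_real_root c0)
    then show "(\<lambda>k. root e (norm (c (x k)))) \<longlonglongrightarrow> 0" by simp
  qed
  have "\<forall>k. \<exists>z. z \<in> Z \<and> (\<forall>i<d. f z i = x k i) \<and> h z = t k"
    using lift_point[OF h(1) F t(1)] by blast
  from choice[OF this] obtain z where z: "\<And>k. z k \<in> Z" "\<And>k i. i < d \<Longrightarrow> f (z k) i = x k i"
    "\<And>k. h (z k) = t k" by blast
  have "bounded (range z)"
  proof -
    have "\<exists>B. \<forall>k. norm (z k $ j) \<le> B" for j
    proof -
      obtain G N where G: "G \<in> poly_fam (crd d)" "\<And>x. degree (G x) = N" "\<And>x. lead_coeff (G x) = 1"
        "\<And>z. z \<in> Z \<Longrightarrow> poly (G (f z)) (z $ j) = 0"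
        using module_finite_integral[OF fin vcrd_var] by blast
      define \<beta> where "\<beta> k = 1 + (\<Sum>i<N. norm (coeff (G (x k)) i))" for k
      have "\<beta> \<longlonglongrightarrow> 1 + (\<Sum>i<N. norm (coeff (G (f a)) i))" unfolding \<beta>_def
        by (intro tendsto_intros crd_tendsto[OF poly_fam_coeff[OF G(1)] x])
      then have "Bseq \<beta>" using convergentI convergent_imp_Bseq by blast
      then obtain K where K: "\<And>k. norm (\<beta> k) \<le> K" using BseqE by blast
      have "norm (z k $ j) \<le> K" for k
      proof -
        have "G (f (z k)) = G (x k)" using z(2) by (intro poly_fam_crd_local[OF G(1)])
        then have "poly (G (x k)) (z k $ j) = 0" using G(4)[OF z(1)[of k]] by simp
        then have "norm (z k $ j) \<le> \<beta> k" using root_bound[OF G(3)] by (simp add: \<beta>_def G(2))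
        then show ?thesis using K[of k] by simp
      qed
      then show ?thesis by blast
    qed
    then have "\<forall>j. \<exists>B. \<forall>k. norm (z k $ j) \<le> B" by blast
    from choice[OF this] obtain B where B: "\<And>j k. norm (z k $ j) \<le> B j" by blast
    have "norm (z k) \<le> (\<Sum>j\<in>UNIV. B j)" for k
    proof -
      have "norm (z k) \<le> (\<Sum>j\<in>UNIV. norm (z k $ j))"
        unfolding norm_vec_def by (rule L2_set_le_sum) simp
      also have "\<dots> \<le> (\<Sum>j\<in>UNIV. B j)" by (rule sum_mono) (rule B)
      finally show ?thesis .
    qed
    then show ?thesis by (auto simp: bounded_iff)
  qed
  then have "z \<longlonglongrightarrow> a"
  proof (rule tendsto_by_subsequences)
    fix r l assume r: "strict_mono r" and l: "(z \<circ> r) \<longlonglongrightarrow> l"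
    have lim: "(\<lambda>k. u (z (r k))) \<longlonglongrightarrow> u l" if "u \<in> fun_alg vcrd" for u
      using vcrd_tendsto[OF that l] by simp
    have "l \<in> Z"
    proof (rule ccontr)
      assume "l \<notin> Z"
      then obtain u where u: "u \<in> fun_alg vcrd" "\<And>w. w \<in> Z \<Longrightarrow> u w = 0" "u l \<noteq> 0"
        using affine_variety_separate[OF affine] by blast
      have "(\<lambda>k. u (z (r k))) \<longlonglongrightarrow> u l" by (rule lim[OF u(1)])
      moreover have "(\<lambda>k. u (z (r k))) = (\<lambda>k. 0)" using u(2) z(1) by auto
      ultimately show False using u(3) LIMSEQ_unique tendsto_const by metis
    qed
    moreover have "f l i = f a i" if i: "i < d" for i
    proof (rule LIMSEQ_unique)
      show "(\<lambda>k. f (z (r k)) i) \<longlonglongrightarrow> f l i" by (rule lim[OF module_finite_vcrd[OF fin i]])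
      have "(\<lambda>k. x (r k) i) \<longlonglongrightarrow> f a i" using LIMSEQ_subseq_LIMSEQ[OF x[OF i] r] by (simp add: o_def)
      then show "(\<lambda>k. f (z (r k)) i) \<longlonglongrightarrow> f a i" using z(2)[OF i] by simp
    qed
    moreover have "h l = 0"
    proof (rule LIMSEQ_unique)
      show "(\<lambda>k. h (z (r k))) \<longlonglongrightarrow> h l" by (rule lim[OF h(1)])
      show "(\<lambda>k. h (z (r k))) \<longlonglongrightarrow> 0" using LIMSEQ_subseq_LIMSEQ[OF t0 r] z(3) by (simp add: o_def)
    qed
    ultimately show "l = a" using h(3)[of l] by fastforce
  qed
  then show ?thesis using z(1,2) by blast
qed

text \<open>The idea is that \<open>g\<close> divides its norm, which is a polynomial in \<open>f\<close>.\<close>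

lemma generic_sequence:
  assumes a: "a \<in> Z" and g: "g \<in> fun_alg vcrd" "\<exists>z\<in>Z. g z \<noteq> 0"
  shows "\<exists>z. (\<forall>k. z k \<in> Z \<and> g (z k) \<noteq> 0) \<and> z \<longlonglongrightarrow> a"
proof -
  obtain F where F: "minimal_poly F g" using exists_minimal_poly[OF g(1)] by blast
  define c where "c y = coeff (F y) 0" for y
  have c: "c \<in> fun_alg (crd d)"
    unfolding c_def[abs_def] by (rule poly_fam_coeff[OF minimal_polyD(1)[OF F]])
  \<comment> \<open>Otherwise the variable divides \<open>F\<close>, and cancelling \<open>g\<close>
    on \<open>Z\<close> leaves an annihilating family of smaller degree.\<close>
  have "\<not> (\<forall>y. c y = 0)"
  proof
    assume c0: "\<forall>y. c y = 0"
    have "\<exists>Q\<in>poly_fam (crd d). \<exists>R\<in>poly_fam (crd d). \<forall>x. F x = Q x * [:0, 1:] + R x \<and> (\<forall>i\<ge>1. coeff (R x) i = 0)"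
      by (rule poly_fam_divide_monic[OF poly_fam_const minimal_polyD(1)[OF F]]) auto
    then obtain Q R where QR: "Q \<in> poly_fam (crd d)" "\<And>x. F x = Q x * [:0, 1:] + R x"
      "\<And>x i. i \<ge> 1 \<Longrightarrow> coeff (R x) i = 0" by blast
    have "R x = 0" for x
    proof (rule poly_eqI)
      fix i
      have "coeff (R x) 0 = coeff (F x) 0" by (simp add: QR(2))
      then show "coeff (R x) i = coeff 0 i" using c0 QR(3)[of i x] by (cases i) (auto simp: c_def)
    qed
    then have FQ: "F x = Q x * [:0, 1:]" for x using QR(2)[of x] by simp
    have "(\<forall>z\<in>Z. poly (Q (f z)) (g z) = 0) \<or> (\<forall>z\<in>Z. g z = 0)"
    proof (rule irreducible_no_zero_divisors[OF irred poly_fam_vcrd[OF QR(1) g(1)] g(1)])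
      fix z assume "z \<in> Z"
      from minimal_polyD(2)[OF F this] show "poly (Q (f z)) (g z) * g z = 0"
        unfolding FQ poly_mult by simp
    qed
    then have "annihilates Q g" using g(2) QR(1) by (auto simp: annihilates_def)
    \<comment> \<open>\<open>undefined\<close> stands for an arbitrary point, since
      \<open>degree (F x)\<close> is the same nonzero number everywhere.\<close>
    moreover have "Q undefined \<noteq> 0" using minimal_polyD(5)[OF F, of undefined] by (auto simp: FQ)
    moreover from this have "degree (Q undefined) < degree (F undefined)"
      using degree_mult_eq[of "Q undefined" "[:0, 1:]"] by (simp add: FQ del: mult_pCons_right)
    ultimately show False using minimal_poly_degree[OF F] by blast
  qed
  then obtain y where "c y \<noteq> 0" by blast
  then obtain s where s: "\<And>k. c (s k) \<noteq> 0" "s \<longlonglongrightarrow> f a"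
    using crd_generic_sequence[where d = d and u = c and y = y and x = "f a"] c by blast
  have "(\<lambda>k. s k i) \<longlonglongrightarrow> f a i" for i
  proof -
    have "isCont (\<lambda>x :: nat \<Rightarrow> complex. x i) (f a)"
    proof -
      have "\<forall>y\<in>UNIV. isCont (\<lambda>x :: nat \<Rightarrow> complex. x i) y"
        unfolding continuous_on_eq_continuous_at[OF open_UNIV, symmetric]
        by (rule continuous_on_product_coordinates)
      then show ?thesis by blast
    qed
    then show ?thesis using s(2) by (rule isCont_tendsto_compose)
  qed
  then obtain z where z: "\<And>k. z k \<in> Z" "\<And>k i. i < d \<Longrightarrow> f (z k) i = s k i" "z \<longlonglongrightarrow> a"
    using lift_sequence[OF a, of s] by blast
  have "g (z k) \<noteq> 0" for k
  proof
    assume "g (z k) = 0"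
    have "c (s k) = c (f (z k))" using z(2) by (intro crd_local[OF c]) simp
    also have "\<dots> = 0" using minimal_polyD(2)[OF F z(1)[of k]] \<open>g (z k) = 0\<close> by (simp add: c_def poly_0_coeff_0)
    finally show False using s(1) by simp
  qed
  then show ?thesis using z(1,3) by blast
qed

end

section \<open>Tangent spaces at generic points\<close>

definition pd :: "'n::finite \<Rightarrow> (complex^'n \<Rightarrow> complex) \<Rightarrow> complex^'n \<Rightarrow> complex" where
  "pd j u a = deriv (\<lambda>t. u (a + axis j t)) 0"

lemma axis_zero: "axis j (0::'a::zero) = 0"
  by (simp add: axis_def Finite_Cartesian_Product.vec_eq_iff)

text \<open>Along axis \<open>j\<close> the factor \<open>A j\<close> is a difference quotient; its
  continuity identifies the diagonal value with the derivative.\<close>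

lemma hadamard_vcrd:
  fixes u :: "complex^'n::finite \<Rightarrow> complex"
  assumes "u \<in> fun_alg vcrd"
  obtains A where "\<And>j. continuous_on UNIV (A j)"
    "\<And>x y. u x - u y = (\<Sum>j\<in>UNIV. (x $ j - y $ j) * A j (x, y))" "\<And>j z. A j (z, z) = pd j u z"
proof -
  have "\<exists>A. (\<forall>j\<in>UNIV. continuous_on UNIV (A j)) \<and>
    (\<forall>x y. u x - u y = (\<Sum>j\<in>UNIV. (x $ j - y $ j) * A j (x, y)))"
    using assms unfolding vcrd_def
    by (rule fun_alg_hadamard) (auto intro: continuous_intros)
  then obtain A where "\<forall>j\<in>UNIV. continuous_on UNIV (A j)"
    and A2: "\<forall>x y. u x - u y = (\<Sum>j\<in>UNIV. (x $ j - y $ j) * A j (x, y))"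
    by (elim exE conjE)
  then have A: "continuous_on UNIV (A j)"
    "u x - u y = (\<Sum>j\<in>UNIV. (x $ j - y $ j) * A j (x, y))" for j x y
    by blast+
  have "A j (z, z) = pd j u z" for j z
  proof -
    have diff: "u (z + axis j t) - u z = t * A j (z + axis j t, z)" for t
    proof -
      have "u (z + axis j t) - u z = (\<Sum>i\<in>UNIV. if i = j then t * A j (z + axis j t, z) else 0)"
        unfolding A(2) by (rule sum.cong[OF refl]) (simp add: axis_def)
      then show ?thesis by simp
    qed
    have "(\<lambda>t. z + axis j t) \<midarrow>0\<rightarrow> z"
    proof (rule vec_tendstoI)
      fix i
      have "(\<lambda>t. if i = j then t else 0 :: complex) \<midarrow>0\<rightarrow> 0" by (cases "i = j") simp_all
      then have "(\<lambda>t. z $ i + (if i = j then t else 0)) \<midarrow>0\<rightarrow> z $ i + 0"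
        by (rule tendsto_add[OF tendsto_const])
      then show "(\<lambda>t. (z + axis j t) $ i) \<midarrow>0\<rightarrow> z $ i" by (simp add: axis_def)
    qed
    then have "(\<lambda>t. (z + axis j t, z)) \<midarrow>0\<rightarrow> (z, z)" by (rule tendsto_Pair[OF _ tendsto_const])
    moreover have "isCont (A j) (z, z)" using A(1) by (simp add: continuous_on_eq_continuous_at)
    ultimately have "(\<lambda>t. A j (z + axis j t, z)) \<midarrow>0\<rightarrow> A j (z, z)"
      by (rule isCont_tendsto_compose[rotated])
    then have "(\<lambda>t. (u (z + axis j t) - u z) / t) \<midarrow>0\<rightarrow> A j (z, z)"
      by (rule Lim_transform_eventually) (auto simp: eventually_at_filter diff)
    then have "((\<lambda>t. u (z + axis j t)) has_field_derivative A j (z, z)) (at 0)"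
      by (simp add: DERIV_def axis_zero)
    then show ?thesis unfolding pd_def by (rule DERIV_imp_deriv[symmetric])
  qed
  with A show ?thesis by (rule that)
qed

text \<open>A chain rule along sequences instead of curves, because lifting provides sequences of
  points. The limit is taken factor by factor in Hadamard's formula.\<close>

lemma difference_quotient_tendsto:
  fixes z :: "complex^'n::finite"
  assumes u: "u \<in> fun_alg vcrd" and zk: "zk \<longlonglongrightarrow> z"
    and w: "\<And>j. (\<lambda>k. (zk k $ j - z $ j) / s k) \<longlonglongrightarrow> w $ j"
  shows "(\<lambda>k. (u (zk k) - u z) / s k) \<longlonglongrightarrow> (\<Sum>j\<in>UNIV. pd j u z * w $ j)"
proof -
  obtain A where A: "\<And>j. continuous_on UNIV (A j)"
    "\<And>x y. u x - u y = (\<Sum>j\<in>UNIV. (x $ j - y $ j) * A j (x, y))" "\<And>j z. A j (z, z) = pd j u z"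
    using hadamard_vcrd[OF u] by blast
  have "(\<lambda>k. A j (zk k, z)) \<longlonglongrightarrow> A j (z, z)" for j
  proof -
    have "isCont (A j) (z, z)" using A(1) by (simp add: continuous_on_eq_continuous_at)
    moreover have "(\<lambda>k. (zk k, z)) \<longlonglongrightarrow> (z, z)" by (intro tendsto_intros zk)
    ultimately show ?thesis by (rule isCont_tendsto_compose)
  qed
  then have "(\<lambda>k. \<Sum>j\<in>UNIV. A j (zk k, z) * ((zk k $ j - z $ j) / s k)) \<longlonglongrightarrow>
    (\<Sum>j\<in>UNIV. A j (z, z) * w $ j)"
    by (intro tendsto_intros w)
  moreover have "(\<Sum>j\<in>UNIV. A j (zk k, z) * ((zk k $ j - z $ j) / s k)) = (u (zk k) - u z) / s k" for k
    unfolding A(2) by (simp add: sum_divide_distrib mult.commute)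
  ultimately show ?thesis by (simp add: A(3))
qed

text \<open>The entry \<open>x d\<close> is the argument of the polynomial and the earlier ones are
  its parameters. The diagonal value of \<open>A d\<close> is where separability will enter.\<close>

lemma hadamard_poly_fam:
  assumes F: "F \<in> poly_fam (crd d)"
  obtains A where "\<And>i. i < Suc d \<Longrightarrow> continuous_on UNIV (A i)"
    "\<And>x y. poly (F x) (x d) - poly (F y) (y d) = (\<Sum>i<d. (x i - y i) * A i (x, y)) + (x d - y d) * A d (x, y)"
    "\<And>y. A d (y, y) = poly (pderiv (F y)) (y d)"
proof -
  have "(\<lambda>x. poly (F x) (x d)) \<in> fun_alg ((\<lambda>i x. x i) ` {..<Suc d})"
    using poly_fam_eval[OF poly_fam_mono[OF F crd_mono[of d "Suc d"]] crd_var[of d "Suc d"]]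
    by (simp add: crd_def)
  then have "\<exists>A. (\<forall>i\<in>{..<Suc d}. continuous_on UNIV (A i)) \<and>
    (\<forall>x y. poly (F x) (x d) - poly (F y) (y d) = (\<Sum>i<Suc d. (x i - y i) * A i (x, y)))"
    by (rule fun_alg_hadamard) (auto intro: continuous_on_product_coordinates)
  then obtain A where A0: "\<forall>i\<in>{..<Suc d}. continuous_on UNIV (A i)" and
    A1: "\<forall>x y. poly (F x) (x d) - poly (F y) (y d) = (\<Sum>i<Suc d. (x i - y i) * A i (x, y))"
    by (elim exE conjE)
  have A: "continuous_on UNIV (A i)" if "i < Suc d" for i using A0 that by simp
  have A2: "poly (F x) (x d) - poly (F y) (y d) = (\<Sum>i<d. (x i - y i) * A i (x, y)) + (x d - y d) * A d (x, y)" for x y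
    using A1[rule_format, of x y] unfolding sum.lessThan_Suc .
  have "A d (y, y) = poly (pderiv (F y)) (y d)" for y
  proof -
    define \<gamma> where "\<gamma> t = y(d := y d + t)" for t
    have F\<gamma>: "F (\<gamma> t) = F y" for t by (rule poly_fam_crd_local[OF F]) (simp add: \<gamma>_def)
    have diff: "poly (F y) (y d + t) - poly (F y) (y d) = t * A d (\<gamma> t, y)" for t
    proof -
      have "\<gamma> t i = y i" if "i < d" for i using that by (simp add: \<gamma>_def)
      moreover have "\<gamma> t d = y d + t" by (simp add: \<gamma>_def)
      ultimately show ?thesis using A2[of "\<gamma> t" y] by (simp add: F\<gamma>)
    qed
    have "\<gamma> \<midarrow>0\<rightarrow> y"
    proof (rule tendsto_fun_coordinatewise)
      fix i
      have "(\<lambda>t. y d + t) \<midarrow>0\<rightarrow> y d + 0" by (intro tendsto_intros)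
      then show "(\<lambda>t. \<gamma> t i) \<midarrow>0\<rightarrow> y i" by (cases "i = d") (auto simp: \<gamma>_def)
    qed
    then have "(\<lambda>t. (\<gamma> t, y)) \<midarrow>0\<rightarrow> (y, y)" by (rule tendsto_Pair[OF _ tendsto_const])
    moreover have "isCont (A d) (y, y)" using A[of d] by (simp add: continuous_on_eq_continuous_at)
    ultimately have "(\<lambda>t. A d (\<gamma> t, y)) \<midarrow>0\<rightarrow> A d (y, y)"
      by (rule isCont_tendsto_compose[rotated])
    then have "(\<lambda>t. (poly (F y) (y d + t) - poly (F y) (y d)) / t) \<midarrow>0\<rightarrow> A d (y, y)"
      by (rule Lim_transform_eventually) (auto simp: eventually_at_filter diff)
    then have "DERIV (poly (F y)) (y d) :> A d (y, y)" by (simp add: DERIV_def)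
    then show ?thesis using poly_DERIV by (rule DERIV_unique)
  qed
  from that[OF A A2 this] show ?thesis .
qed

context normalized_variety
begin

text \<open>As \<open>b d\<close> is the derivative in the coordinate \<open>l\<close>, the
  increment of that coordinate can be solved for when it is nonzero. The points \<open>zk k\<close>
  may leave \<open>Z\<close>, so that lifted sequences and straight lines are both covered.\<close>

lemma secant_expansion:
  assumes F: "minimal_poly F (\<lambda>z. z $ l)" and zk: "zk \<longlonglongrightarrow> z"
  obtains B b where "\<forall>i<Suc d. B i \<longlonglongrightarrow> b i" "b d = poly (pderiv (F (f z))) (z $ l)"
    "\<forall>k. poly (F (f (zk k))) (zk k $ l) - poly (F (f z)) (z $ l) =
      (\<Sum>i<d. (f (zk k) i - f z i) * B i k) + (zk k $ l - z $ l) * B d k"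
proof -
  obtain A where A: "\<And>i. i < Suc d \<Longrightarrow> continuous_on UNIV (A i)"
    "\<And>x y. poly (F x) (x d) - poly (F y) (y d) =
      (\<Sum>i<d. (x i - y i) * A i (x, y)) + (x d - y d) * A d (x, y)"
    "\<And>y. A d (y, y) = poly (pderiv (F y)) (y d)"
    using hadamard_poly_fam[OF minimal_polyD(1)[OF F]] by blast
  define p where "p y i = (if i < d then f y i else if i = d then y $ l else 0)" for y i
  have p: "p y i = f y i" if "i < d" for y i using that by (simp add: p_def)
  have pd: "p y d = y $ l" for y by (simp add: p_def)
  have Fp: "F (p y) = F (f y)" for y
    by (rule poly_fam_crd_local[OF minimal_polyD(1)[OF F]]) (rule p)
  have "(\<lambda>k. p (zk k)) \<longlonglongrightarrow> p z"
  proof (rule tendsto_fun_coordinatewise)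
    show "(\<lambda>k. p (zk k) i) \<longlonglongrightarrow> p z i" for i
      using vcrd_tendsto[OF module_finite_vcrd[OF fin] zk, of i] vcrd_tendsto[OF vcrd_var zk, of l]
      by (auto simp: p_def)
  qed
  then have pair: "(\<lambda>k. (p (zk k), p z)) \<longlonglongrightarrow> (p z, p z)" by (intro tendsto_intros)
  show ?thesis
  proof (rule that[of "\<lambda>i k. A i (p (zk k), p z)" "\<lambda>i. A i (p z, p z)"])
    show "\<forall>i<Suc d. (\<lambda>k. A i (p (zk k), p z)) \<longlonglongrightarrow> A i (p z, p z)"
    proof (intro allI impI)
      fix i assume "i < Suc d"
      then have "isCont (A i) (p z, p z)" using A(1) by (simp add: continuous_on_eq_continuous_at)
      then show "(\<lambda>k. A i (p (zk k), p z)) \<longlonglongrightarrow> A i (p z, p z)"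
        using pair by (rule isCont_tendsto_compose)
    qed
    show "A d (p z, p z) = poly (pderiv (F (f z))) (z $ l)" by (simp add: A(3) Fp pd)
    have "poly (F (f (zk k))) (zk k $ l) - poly (F (f z)) (z $ l) =
      (\<Sum>i<d. (f (zk k) i - f z i) * A i (p (zk k), p z)) + (zk k $ l - z $ l) * A d (p (zk k), p z)" for k
      using A(2)[of "p (zk k)" "p z"] by (simp add: Fp pd p)
    then show "\<forall>k. poly (F (f (zk k))) (zk k $ l) - poly (F (f z)) (z $ l) =
      (\<Sum>i<d. (f (zk k) i - f z i) * A i (p (zk k), p z)) + (zk k $ l - z $ l) * A d (p (zk k), p z)" ..
  qed
qed

text \<open>The tangent vector is the limit of secants through the points over \<open>f z + s v\<close>.\<close>

lemma tangent_vector_over: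
  assumes z: "z \<in> Z" and F: "\<And>l. minimal_poly (F l) (\<lambda>z. z $ l)"
    and sep: "\<And>l. poly (pderiv (F l (f z))) (z $ l) \<noteq> 0"
  shows "\<exists>w. (\<forall>q\<in>fun_alg vcrd. (\<forall>y\<in>Z. q y = 0) \<longrightarrow> (\<Sum>j\<in>UNIV. pd j q z * w $ j) = 0) \<and>
    (\<forall>i<d. (\<Sum>j\<in>UNIV. pd j (\<lambda>z. f z i) z * w $ j) = v i)"
proof -
  define s :: "nat \<Rightarrow> complex" where "s k = inverse (of_nat (Suc k))" for k
  have s0: "s k \<noteq> 0" for k unfolding s_def by (simp del: of_nat_Suc)
  have slim: "s \<longlonglongrightarrow> 0" unfolding s_def by (rule inverse_Suc_tendsto_zero)
  define x where "x k i = f z i + s k * v i" for k i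
  have "(\<lambda>k. x k i) \<longlonglongrightarrow> f z i" for i
  proof -
    have "(\<lambda>k. x k i) \<longlonglongrightarrow> f z i + 0 * v i" unfolding x_def by (intro tendsto_intros slim)
    then show ?thesis by simp
  qed
  then obtain zk where zk: "\<And>k. zk k \<in> Z" "\<And>k i. i < d \<Longrightarrow> f (zk k) i = x k i" "zk \<longlonglongrightarrow> z"
    using lift_sequence[OF z, of x] by blast
  have "\<exists>w. (\<lambda>k. (zk k $ l - z $ l) / s k) \<longlonglongrightarrow> w" for l
  proof -
    obtain B b where "\<forall>i<Suc d. B i \<longlonglongrightarrow> b i" "b d = poly (pderiv (F l (f z))) (z $ l)"
      "\<forall>k. poly (F l (f (zk k))) (zk k $ l) - poly (F l (f z)) (z $ l) =
        (\<Sum>i<d. (f (zk k) i - f z i) * B i k) + (zk k $ l - z $ l) * B d k"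
      by (rule secant_expansion[OF F[of l] zk(3)])
    note B = this[rule_format]
    have bd: "b d \<noteq> 0" using sep[of l] by (simp add: B(2))
    \<comment> \<open>Both ends lie on \<open>Z\<close>, where the relation vanishes, so the
      expansion is a linear equation for the increment of coordinate \<open>l\<close>.\<close>
    have eq: "(zk k $ l - z $ l) * B d k = - (s k * (\<Sum>i<d. v i * B i k))" for k
    proof -
      have "(\<Sum>i<d. (f (zk k) i - f z i) * B i k) = s k * (\<Sum>i<d. v i * B i k)"
        unfolding sum_distrib_left by (rule sum.cong[OF refl]) (simp add: zk(2) x_def)
      then show ?thesis
        using B(3)[of k] minimal_polyD(2)[OF F zk(1), of l] minimal_polyD(2)[OF F z, of l]
        by (simp add: add_eq_0_iff)
    qed
    have "(\<lambda>k. - (\<Sum>i<d. v i * B i k) / B d k) \<longlonglongrightarrow>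
      - (\<Sum>i<d. v i * b i) / b d"
      by (intro tendsto_intros B(1) bd) auto
    moreover have "\<forall>\<^sub>F k in sequentially. B d k \<noteq> 0"
      by (rule tendsto_imp_eventually_ne[OF B(1) bd]) simp
    then have "\<forall>\<^sub>F k in sequentially. - (\<Sum>i<d. v i * B i k) / B d k =
      (zk k $ l - z $ l) / s k"
    proof eventually_elim
      case (elim k)
      then show ?case using eq[of k] s0[of k] by (simp add: field_simps)
    qed
    ultimately have "(\<lambda>k. (zk k $ l - z $ l) / s k) \<longlonglongrightarrow> - (\<Sum>i<d. v i * b i) / b d"
      by (rule Lim_transform_eventually)
    then show ?thesis by blast
  qed
  then have "\<forall>l. \<exists>w. (\<lambda>k. (zk k $ l - z $ l) / s k) \<longlonglongrightarrow> w" by blast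
  from choice[OF this] obtain w' where w': "\<And>l. (\<lambda>k. (zk k $ l - z $ l) / s k) \<longlonglongrightarrow> w' l" by blast
  define w where "w = (\<chi> l. w' l)"
  have w: "(\<lambda>k. (zk k $ l - z $ l) / s k) \<longlonglongrightarrow> w $ l" for l using w' by (simp add: w_def)
  note dq = difference_quotient_tendsto[OF _ zk(3) w]
  have "(\<Sum>j\<in>UNIV. pd j q z * w $ j) = 0" if q: "q \<in> fun_alg vcrd" "\<forall>y\<in>Z. q y = 0" for q
  proof (rule LIMSEQ_unique[OF dq[OF q(1)]])
    show "(\<lambda>k. (q (zk k) - q z) / s k) \<longlonglongrightarrow> 0" using q(2) zk(1) z by simp
  qed
  moreover have "(\<Sum>j\<in>UNIV. pd j (\<lambda>z. f z i) z * w $ j) = v i" if i: "i < d" for i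
  proof (rule LIMSEQ_unique[OF dq[OF module_finite_vcrd[OF fin i]]])
    show "(\<lambda>k. (f (zk k) i - f z i) / s k) \<longlonglongrightarrow> v i" using s0 by (simp add: zk(2)[OF i] x_def)
  qed
  ultimately show ?thesis by blast
qed

text \<open>Along the line in direction \<open>w\<close> the increments of the \<open>f i\<close>
  and of the relation for coordinate \<open>l\<close> are \<open>o(s)\<close>, so the expansion
  leaves \<open>w $ l\<close> times a nonzero derivative. The factor \<open>g\<close> is there
  because, on a reducible variety, only the product of \<open>g\<close> with the relation vanishes
  everywhere.\<close>

lemma tangent_vector_unique:
  assumes z: "z \<in> Z" and F: "\<And>l. minimal_poly (F l) (\<lambda>z. z $ l)"
    and sep: "\<And>l. poly (pderiv (F l (f z))) (z $ l) \<noteq> 0"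
    and g: "g \<in> fun_alg vcrd" "g z \<noteq> 0"
    and w: "\<And>l. (\<Sum>j\<in>UNIV. pd j (\<lambda>y. g y * poly (F l (f y)) (y $ l)) z * w $ j) = 0"
    and fw: "\<And>i. i < d \<Longrightarrow> (\<Sum>j\<in>UNIV. pd j (\<lambda>z. f z i) z * w $ j) = 0"
  shows "w = 0"
proof -
  define s :: "nat \<Rightarrow> complex" where "s k = inverse (of_nat (Suc k))" for k
  have s0: "s k \<noteq> 0" for k unfolding s_def by (simp del: of_nat_Suc)
  have slim: "s \<longlonglongrightarrow> 0" unfolding s_def by (rule inverse_Suc_tendsto_zero)
  define zk where "zk k = (\<chi> j. z $ j + s k * w $ j)" for k
  have "zk \<longlonglongrightarrow> z"
  proof (rule vec_tendstoI)
    fix j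
    have "(\<lambda>k. z $ j + s k * w $ j) \<longlonglongrightarrow> z $ j + 0 * w $ j" by (intro tendsto_intros slim)
    then show "(\<lambda>k. zk k $ j) \<longlonglongrightarrow> z $ j" by (simp add: zk_def)
  qed
  note zk = this
  have wk: "(\<lambda>k. (zk k $ j - z $ j) / s k) \<longlonglongrightarrow> w $ j" for j
    using s0 by (simp add: zk_def)
  note dq = difference_quotient_tendsto[OF _ zk wk]
  have "w $ l = 0" for l
  proof -
    obtain B b where "\<forall>i<Suc d. B i \<longlonglongrightarrow> b i" "b d = poly (pderiv (F l (f z))) (z $ l)"
      "\<forall>k. poly (F l (f (zk k))) (zk k $ l) - poly (F l (f z)) (z $ l) =
        (\<Sum>i<d. (f (zk k) i - f z i) * B i k) + (zk k $ l - z $ l) * B d k"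
      by (rule secant_expansion[OF F[of l] zk])
    note B = this[rule_format]
    define \<psi> where "\<psi> y = poly (F l (f y)) (y $ l)" for y
    have \<psi>: "\<psi> \<in> fun_alg vcrd" unfolding \<psi>_def
      by (rule poly_fam_vcrd[OF minimal_polyD(1)[OF F] vcrd_var])
    have \<psi>z: "\<psi> z = 0" using minimal_polyD(2)[OF F z, of l] by (simp add: \<psi>_def)
    have "(\<lambda>k. (g (zk k) * \<psi> (zk k) - g z * \<psi> z) / s k) \<longlonglongrightarrow>
      (\<Sum>j\<in>UNIV. pd j (\<lambda>y. g y * \<psi> y) z * w $ j)"
      by (rule dq[OF fun_alg.mult[OF g(1) \<psi>]])
    then have "(\<lambda>k. g (zk k) * \<psi> (zk k) / s k) \<longlonglongrightarrow> 0" using w[of l] by (simp add: \<psi>_def[symmetric] \<psi>z)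
    moreover have glim: "(\<lambda>k. g (zk k)) \<longlonglongrightarrow> g z" by (rule vcrd_tendsto[OF g(1) zk])
    ultimately have "(\<lambda>k. g (zk k) * \<psi> (zk k) / s k / g (zk k)) \<longlonglongrightarrow> 0 / g z"
      using g(2) by (intro tendsto_divide)
    moreover have "\<forall>\<^sub>F k in sequentially. g (zk k) \<noteq> 0"
      by (rule tendsto_imp_eventually_ne[OF glim g(2)])
    then have "\<forall>\<^sub>F k in sequentially. g (zk k) * \<psi> (zk k) / s k / g (zk k) = \<psi> (zk k) / s k"
      by eventually_elim simp
    ultimately have lim1: "(\<lambda>k. \<psi> (zk k) / s k) \<longlonglongrightarrow> 0 / g z" by (rule Lim_transform_eventually)
    have "(\<lambda>k. (\<Sum>i<d. ((f (zk k) i - f z i) / s k) * B i k) + w $ l * B d k)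
      \<longlonglongrightarrow> (\<Sum>i<d. 0 * b i) + w $ l * b d"
    proof (intro tendsto_add tendsto_sum tendsto_mult tendsto_const B(1))
      fix i assume "i \<in> {..<d}"
      then show "(\<lambda>k. (f (zk k) i - f z i) / s k) \<longlonglongrightarrow> 0"
        using dq[OF module_finite_vcrd[OF fin, of i]] fw[of i] by simp
    qed auto
    moreover have "(\<Sum>i<d. ((f (zk k) i - f z i) / s k) * B i k) + w $ l * B d k =
      \<psi> (zk k) / s k" for k
    proof -
      have "\<psi> (zk k) = (\<Sum>i<d. (f (zk k) i - f z i) * B i k) + s k * w $ l * B d k"
        using B(3)[of k] \<psi>z unfolding \<psi>_def by (simp add: zk_def)
      then show ?thesis using s0[of k] by (simp add: add_divide_distrib sum_divide_distrib)
    qed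
    ultimately have "(\<lambda>k. \<psi> (zk k) / s k) \<longlonglongrightarrow> w $ l * b d" by simp
    then have "w $ l * b d = 0 / g z" using lim1 by (rule LIMSEQ_unique)
    moreover have "b d \<noteq> 0" using sep[of l] by (simp add: B(2))
    ultimately show ?thesis by simp
  qed
  then show ?thesis by (simp add: Finite_Cartesian_Product.vec_eq_iff)
qed

end

section \<open>Transcendence degree\<close>

text \<open>Gaussian elimination: equation \<open>j0\<close> is solved for a pivot unknown
  \<open>i0\<close> and substituted into the others.\<close>

lemma underdetermined_system:
  fixes c :: "'i \<Rightarrow> 'j \<Rightarrow> complex"
  assumes "finite J" "finite I" "card J < card I"
  shows "\<exists>l. (\<exists>i\<in>I. l i \<noteq> 0) \<and> (\<forall>j\<in>J. (\<Sum>i\<in>I. l i * c i j) = 0)"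
  using assms
proof (induction J arbitrary: I c rule: finite_induct)
  case empty
  then have "I \<noteq> {}" by auto
  then show ?case by (intro exI[of _ "\<lambda>_. 1"]) auto
next
  case (insert j0 J)
  have cardI: "card J < card I - 1" using insert.hyps insert.prems by simp
  show ?case
  proof (cases "\<forall>i\<in>I. c i j0 = 0")
    case True
    have "card J < card I" using cardI by simp
    from insert.IH[OF insert.prems(1) this] obtain l where
      "\<exists>i\<in>I. l i \<noteq> 0" "\<forall>j\<in>J. (\<Sum>i\<in>I. l i * c i j) = 0" by blast
    then show ?thesis using True by (intro exI[of _ l]) simp
  next
    case False
    then obtain i0 where i0: "i0 \<in> I" "c i0 j0 \<noteq> 0" by blast
    have "card J < card (I - {i0})" using cardI i0(1) by simp
    from insert.IH[OF _ this, of "\<lambda>i j. c i j - c i j0 / c i0 j0 * c i0 j"] insert.prems(1) obtain l where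
      l: "\<exists>i\<in>I - {i0}. l i \<noteq> 0"
      "\<forall>j\<in>J. (\<Sum>i\<in>I - {i0}. l i * (c i j - c i j0 / c i0 j0 * c i0 j)) = 0" by auto
    define s where "s = - (\<Sum>i\<in>I - {i0}. l i * c i j0) / c i0 j0"
    define m where "m i = (if i = i0 then s else l i)" for i
    have split: "(\<Sum>i\<in>I. m i * c i j) = s * c i0 j + (\<Sum>i\<in>I - {i0}. l i * c i j)" for j
    proof -
      have "(\<Sum>i\<in>I. m i * c i j) = m i0 * c i0 j + (\<Sum>i\<in>I - {i0}. m i * c i j)"
        by (rule sum.remove[OF insert.prems(1) i0(1)])
      also have "(\<Sum>i\<in>I - {i0}. m i * c i j) = (\<Sum>i\<in>I - {i0}. l i * c i j)"
        by (rule sum.cong) (auto simp: m_def)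
      finally show ?thesis by (simp add: m_def)
    qed
    have "(\<Sum>i\<in>I. m i * c i j) = 0" if "j \<in> insert j0 J" for j
    proof (cases "j = j0")
      case True
      then show ?thesis using i0(2) by (simp add: split s_def)
    next
      case False
      then have "(\<Sum>i\<in>I - {i0}. l i * (c i j - c i j0 / c i0 j0 * c i0 j)) = 0" using that l(2) by blast
      moreover have "(\<Sum>i\<in>I - {i0}. l i * (c i j - c i j0 / c i0 j0 * c i0 j)) =
        (\<Sum>i\<in>I - {i0}. l i * c i j) - (\<Sum>i\<in>I - {i0}. l i * c i j0) / c i0 j0 * c i0 j"
        unfolding sum_divide_distrib sum_distrib_right sum_subtractf[symmetric]
        by (rule sum.cong[OF refl]) (simp add: algebra_simps)
      ultimately show ?thesis by (simp add: split s_def)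
    qed
    moreover have "\<exists>i\<in>I. m i \<noteq> 0" using l(1) by (auto simp: m_def)
    ultimately show ?thesis by blast
  qed
qed

text \<open>Degree at most \<open>M\<close> in each variable separately: the bounds add under
  multiplication, and there are exactly \<open>(M + 1) ^ d\<close> monomials.\<close>

inductive_set box_poly :: "nat \<Rightarrow> nat \<Rightarrow> ((nat \<Rightarrow> complex) \<Rightarrow> complex) set" for d M where
  monomial: "(\<And>i. \<alpha> i \<le> M) \<Longrightarrow> (\<lambda>x. c * (\<Prod>i<d. x i ^ \<alpha> i)) \<in> box_poly d M"
| add: "u \<in> box_poly d M \<Longrightarrow> v \<in> box_poly d M \<Longrightarrow> (\<lambda>x. u x + v x) \<in> box_poly d M"

lemma box_poly_mono: "u \<in> box_poly d M \<Longrightarrow> M \<le> N \<Longrightarrow> u \<in> box_poly d N"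
proof (induction rule: box_poly.induct)
  case (monomial \<alpha> c)
  then show ?case by (intro box_poly.monomial) (rule order_trans)
qed (auto intro: box_poly.add)

lemma box_poly_zero: "(\<lambda>_. 0) \<in> box_poly d M"
  using box_poly.monomial[of "\<lambda>_. 0" M 0 d] by simp

lemma box_poly_sum: "(\<And>i. i \<in> I \<Longrightarrow> u i \<in> box_poly d M) \<Longrightarrow> (\<lambda>x. \<Sum>i\<in>I. u i x) \<in> box_poly d M"
  by (induction I rule: infinite_finite_induct) (auto intro: box_poly_zero box_poly.add)

lemma box_poly_mult:
  assumes "u \<in> box_poly d M" "v \<in> box_poly d N"
  shows "(\<lambda>x. u x * v x) \<in> box_poly d (M + N)"
  using assms(1)
proof induction
  case (monomial \<alpha> c)
  note \<alpha> = this
  from assms(2) show ?case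
  proof induction
    case (monomial \<beta> b)
    have "(\<lambda>x. (c * b) * (\<Prod>i<d. x i ^ (\<alpha> i + \<beta> i))) \<in> box_poly d (M + N)"
      by (rule box_poly.monomial) (intro add_mono \<alpha> monomial)
    then show ?case by (simp add: power_add prod.distrib mult_ac)
  next
    case (add u v)
    then show ?case using box_poly.add by (simp add: distrib_left)
  qed
next
  case (add u v)
  then show ?case using box_poly.add by (simp add: distrib_right)
qed

lemma crd_imp_box_poly:
  assumes "u \<in> fun_alg (crd d)"
  shows "\<exists>M. u \<in> box_poly d M"
  using assms
proof induction
  case (const c)
  show ?case using box_poly.monomial[of "\<lambda>_. 0" 0 c d] by auto
next
  case (gen g)
  then obtain i where i: "i < d" "g = (\<lambda>x. x i)" by (auto simp: crd_def)
  have "(\<lambda>x. 1 * (\<Prod>j<d. x j ^ (if j = i then 1 else 0))) \<in> box_poly d 1"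
    by (rule box_poly.monomial) simp
  moreover have "(\<Prod>j<d. x j ^ (if j = i then 1 else 0)) = x i" for x :: "nat \<Rightarrow> complex"
  proof -
    have "(\<Prod>j<d. x j ^ (if j = i then 1 else 0)) = (\<Prod>j<d. if j = i then x j else 1)"
      by (rule prod.cong) auto
    then show ?thesis using i(1) by simp
  qed
  ultimately show ?case using i(2) by auto
next
  case (add u v)
  then obtain M N where "u \<in> box_poly d M" "v \<in> box_poly d N" by blast
  then have "u \<in> box_poly d (max M N)" "v \<in> box_poly d (max M N)"
    by (auto elim: box_poly_mono)
  then show ?case using box_poly.add by blast
next
  case (mult u v)
  then show ?case using box_poly_mult by blast
qed

lemma box_poly_coefficients:
  assumes "u \<in> box_poly d M"
  shows "\<exists>c. \<forall>x. u x = (\<Sum>\<alpha>\<in>PiE {..<d} (\<lambda>_. {..M}). c \<alpha> * (\<Prod>i<d. x i ^ \<alpha> i))"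
  using assms
proof induction
  case (monomial \<alpha> c)
  let ?\<alpha> = "restrict \<alpha> {..<d}"
  have mem: "?\<alpha> \<in> PiE {..<d} (\<lambda>_. {..M})" using monomial by auto
  have fin: "finite (PiE {..<d} (\<lambda>_. {..M}))" by (intro finite_PiE) auto
  have "c * (\<Prod>i<d. x i ^ \<alpha> i) =
    (\<Sum>\<beta>\<in>PiE {..<d} (\<lambda>_. {..M}). (if \<beta> = ?\<alpha> then c else 0) * (\<Prod>i<d. x i ^ \<beta> i))" for x :: "nat \<Rightarrow> complex"
  proof -
    have "(\<Sum>\<beta>\<in>PiE {..<d} (\<lambda>_. {..M}). (if \<beta> = ?\<alpha> then c else 0) * (\<Prod>i<d. x i ^ \<beta> i)) =
      (\<Sum>\<beta>\<in>PiE {..<d} (\<lambda>_. {..M}). if \<beta> = ?\<alpha> then c * (\<Prod>i<d. x i ^ \<beta> i) else 0)"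
      by (rule sum.cong) auto
    also have "\<dots> = c * (\<Prod>i<d. x i ^ ?\<alpha> i)" using mem fin by simp
    also have "(\<Prod>i<d. x i ^ ?\<alpha> i) = (\<Prod>i<d. x i ^ \<alpha> i)" by (rule prod.cong) auto
    finally show ?thesis by (rule sym)
  qed
  then show ?case by (intro exI[of _ "\<lambda>\<beta>. if \<beta> = ?\<alpha> then c else 0"] allI)
next
  case (add u v)
  then obtain a b where "\<forall>x. u x = (\<Sum>\<alpha>\<in>PiE {..<d} (\<lambda>_. {..M}). a \<alpha> * (\<Prod>i<d. x i ^ \<alpha> i))"
    "\<forall>x. v x = (\<Sum>\<alpha>\<in>PiE {..<d} (\<lambda>_. {..M}). b \<alpha> * (\<Prod>i<d. x i ^ \<alpha> i))" by blast
  then have "\<forall>x. u x + v x = (\<Sum>\<alpha>\<in>PiE {..<d} (\<lambda>_. {..M}). (a \<alpha> + b \<alpha>) * (\<Prod>i<d. x i ^ \<alpha> i))"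
    by (simp add: distrib_right sum.distrib)
  then show ?case by (intro exI[of _ "\<lambda>\<alpha>. a \<alpha> + b \<alpha>"])
qed

lemma finite_choice_bound:
  assumes "finite I" and "\<And>i. i \<in> I \<Longrightarrow> \<exists>M. a i \<in> box_poly d M"
  shows "\<exists>M. \<forall>i\<in>I. a i \<in> box_poly d M"
  using assms
proof (induction I rule: finite_induct)
  case (insert j I)
  then obtain M where M: "\<forall>i\<in>I. a i \<in> box_poly d M" by auto
  obtain N where N: "a j \<in> box_poly d N" using insert.prems by blast
  have "\<forall>i\<in>insert j I. a i \<in> box_poly d (max M N)"
    using M N by (auto intro: box_poly_mono[of _ _ M] box_poly_mono[of _ _ N])
  then show ?case by (rule exI)
qed auto

text \<open>
  The monomials of degree less than \<open>n\<close> in each of \<open>d + 1\<close> functions are \<open>n ^ (d + 1)\<close> many, and they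
  lie in a space whose dimension grows like \<open>n ^ d\<close>.
\<close>

lemma (in normalized_variety) algebraic_relation:
  fixes g :: "nat \<Rightarrow> complex^'n \<Rightarrow> complex"
  assumes g: "\<And>i. g i \<in> fun_alg vcrd"
  shows "\<exists>q\<in>fun_alg (crd (Suc d)). (\<exists>x. q x \<noteq> 0) \<and> (\<forall>z\<in>Z. q (\<lambda>i. g i z) = 0)"
proof -
  obtain N :: nat and a m b where
    "\<forall>i. \<forall>k<N. \<forall>l<N. a i k l \<in> fun_alg (crd d)"
    "\<forall>i. \<forall>k<N. \<forall>z\<in>Z. g i z * m k z = (\<Sum>l<N. a i k l (f z) * m l z)"
    "\<forall>k<N. b k \<in> fun_alg (crd d)" "\<forall>z\<in>Z. 1 = (\<Sum>k<N. b k (f z) * m k z)"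
    by (rule module_finite_action[OF fin, of g, OF g])
  note a = this(1)[rule_format] and am = this(2)[rule_format] and b0 = this(3) and b = this(4)
  have "\<exists>M. \<forall>p\<in>{..d} \<times> ({..<N} \<times> {..<N}). (case p of (i, k, l) \<Rightarrow> a i k l) \<in> box_poly d M"
    by (rule finite_choice_bound) (auto intro!: crd_imp_box_poly a)
  then obtain M1 where M1: "\<And>i k l. i \<le> d \<Longrightarrow> k < N \<Longrightarrow> l < N \<Longrightarrow> a i k l \<in> box_poly d M1" by fastforce
  have "\<exists>M. \<forall>k\<in>{..<N}. b k \<in> box_poly d M"
    by (rule finite_choice_bound) (use b0 in \<open>auto intro!: crd_imp_box_poly\<close>)
  then obtain M2 where M2: "\<And>k. k < N \<Longrightarrow> b k \<in> box_poly d M2" by blast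
  define C where "C = max M1 M2"
  have aC: "a i k l \<in> box_poly d C" if "i \<le> d" "k < N" "l < N" for i k l
    by (rule box_poly_mono[OF M1[OF that]]) (simp add: C_def)
  have bC: "b k \<in> box_poly d C" if "k < N" for k
    by (rule box_poly_mono[OF M2[OF that]]) (simp add: C_def)
  \<comment> \<open>A filtration by the degree of the coefficients: multiplying by a
    \<open>g i\<close> with \<open>i \<le> d\<close> raises the bound by \<open>C\<close>, which
    bounds the matrices of these \<open>g i\<close> and the expansion of 1.\<close>
  define rep where "rep M u \<longleftrightarrow> (\<exists>b. (\<forall>k<N. b k \<in> box_poly d M) \<and>
    (\<forall>z\<in>Z. u z = (\<Sum>k<N. b k (f z) * m k z)))" for M u
  have rep1: "rep C (\<lambda>_. 1)" unfolding rep_def using bC b by (intro exI[of _ b]) simp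
  have rep_mult: "rep (M + C) (\<lambda>z. g i z * u z)" if i: "i \<le> d" and u: "rep M u" for i M u
  proof -
    obtain c where c: "\<forall>k<N. c k \<in> box_poly d M" "\<forall>z\<in>Z. u z = (\<Sum>k<N. c k (f z) * m k z)"
      using u unfolding rep_def by (elim exE conjE)
    have "g i z * u z = (\<Sum>l<N. (\<Sum>k<N. c k (f z) * a i k l (f z)) * m l z)" if z: "z \<in> Z" for z
    proof -
      have "g i z * u z = (\<Sum>k<N. c k (f z) * (g i z * m k z))"
        using c(2) z by (simp add: sum_distrib_left mult.left_commute)
      also have "\<dots> = (\<Sum>k<N. \<Sum>l<N. c k (f z) * a i k l (f z) * m l z)"
        by (rule sum.cong[OF refl]) (simp add: am[OF _ z] sum_distrib_left mult.assoc)
      also have "\<dots> = (\<Sum>l<N. \<Sum>k<N. c k (f z) * a i k l (f z) * m l z)" by (rule sum.swap)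
      finally show ?thesis by (simp add: sum_distrib_right)
    qed
    moreover have "(\<lambda>x. \<Sum>k<N. c k x * a i k l x) \<in> box_poly d (M + C)" if "l < N" for l
      using c(1) aC[OF i _ that] by (intro box_poly_sum box_poly_mult) auto
    ultimately show ?thesis unfolding rep_def
      by (intro exI[of _ "\<lambda>l x. \<Sum>k<N. c k x * a i k l x"]) auto
  qed
  have rep_power: "rep (M + k * C) (\<lambda>z. g i z ^ k * u z)" if "i \<le> d" "rep M u" for i M u k
  proof (induction k)
    case 0
    show ?case using that(2) by simp
  next
    case (Suc k)
    from rep_mult[OF that(1) this] show ?case by (simp add: mult.assoc add_ac)
  qed
  have rep_prod: "rep (C + (\<Sum>i<j. \<gamma> i) * C) (\<lambda>z. \<Prod>i<j. g i z ^ \<gamma> i)" if "j \<le> Suc d" for j \<gamma>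
    using that
  proof (induction j)
    case 0
    show ?case using rep1 by simp
  next
    case (Suc j)
    then have "rep (C + (\<Sum>i<j. \<gamma> i) * C + \<gamma> j * C) (\<lambda>z. g j z ^ \<gamma> j * (\<Prod>i<j. g i z ^ \<gamma> i))"
      by (intro rep_power) auto
    then show ?case by (simp add: algebra_simps)
  qed
  have rep_mono: "rep M' u" if "rep M u" "M \<le> M'" for M M' u
    using that(1) unfolding rep_def by (meson box_poly_mono[OF _ that(2)])
  \<comment> \<open>Products of powers below \<open>n\<close> of the \<open>d + 1\<close> functions
    have bound \<open>M\<close>, and \<open>Suc M \<le> L * n\<close>. They lie in the span of at
    most \<open>N * L ^ d * n ^ d\<close> elements, fewer than \<open>n ^ (d + 1)\<close> because
    \<open>n\<close> exceeds \<open>N * L ^ d\<close>.\<close>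
  define L where "L = C * (d + 2) + 1"
  define n where "n = N * L ^ d + 1"
  define M where "M = C + (d + 1) * n * C"
  define I where "I = PiE {..<Suc d} (\<lambda>_. {..<n})"
  define J where "J = {..<N} \<times> PiE {..<d} (\<lambda>_. {..M})"
  have finI: "finite I" unfolding I_def by (intro finite_PiE) auto
  have finJ: "finite J" unfolding J_def by (intro finite_cartesian_product finite_PiE) auto
  have "card J < card I"
  proof -
    have "card J = N * Suc M ^ d" by (simp add: J_def card_cartesian_product card_PiE)
    also have "Suc M \<le> L * n"
    proof -
      have "n \<ge> 1" by (simp add: n_def)
      then have "C \<le> C * n" "1 \<le> n" by simp_all
      moreover have "L * n = C * n + (d + 1) * n * C + n" by (simp add: L_def algebra_simps)
      ultimately show ?thesis unfolding M_def by linarith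
    qed
    then have "N * Suc M ^ d \<le> N * (L * n) ^ d" by (intro mult_left_mono power_mono) auto
    also have "\<dots> = (N * L ^ d) * n ^ d" by (simp add: power_mult_distrib)
    also have "\<dots> < n * n ^ d" by (intro mult_strict_right_mono) (auto simp: n_def)
    also have "\<dots> = card I" by (simp add: I_def card_PiE)
    finally show ?thesis .
  qed
  have "\<exists>c. \<forall>z\<in>Z. (\<Prod>i<Suc d. g i z ^ \<gamma> i) =
    (\<Sum>(k, \<alpha>)\<in>J. c (k, \<alpha>) * ((\<Prod>i<d. f z i ^ \<alpha> i) * m k z))" if \<gamma>: "\<gamma> \<in> I" for \<gamma>
  proof -
    have "(\<Sum>i<Suc d. \<gamma> i) \<le> (\<Sum>i<Suc d. n)"
      using \<gamma> by (intro sum_mono) (auto simp: I_def PiE_def Pi_def less_imp_le)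
    then have "(\<Sum>i<Suc d. \<gamma> i) * C \<le> (d + 1) * n * C" by (intro mult_right_mono) auto
    then have "rep M (\<lambda>z. \<Prod>i<Suc d. g i z ^ \<gamma> i)"
      by (intro rep_mono[OF rep_prod[of "Suc d" \<gamma>]]) (auto simp: M_def)
    then obtain h where h: "\<forall>k<N. h k \<in> box_poly d M"
      "\<forall>z\<in>Z. (\<Prod>i<Suc d. g i z ^ \<gamma> i) = (\<Sum>k<N. h k (f z) * m k z)"
      unfolding rep_def by (elim exE conjE)
    have "\<forall>k. \<exists>c. k < N \<longrightarrow> (\<forall>x. h k x = (\<Sum>\<alpha>\<in>PiE {..<d} (\<lambda>_. {..M}). c \<alpha> * (\<Prod>i<d. x i ^ \<alpha> i)))"
      using h(1) box_poly_coefficients by simp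
    from choice[OF this] obtain c where
      c: "\<And>k x. k < N \<Longrightarrow> h k x = (\<Sum>\<alpha>\<in>PiE {..<d} (\<lambda>_. {..M}). c k \<alpha> * (\<Prod>i<d. x i ^ \<alpha> i))" by blast
    have "(\<Prod>i<Suc d. g i z ^ \<gamma> i) = (\<Sum>(k, \<alpha>)\<in>J. c k \<alpha> * ((\<Prod>i<d. f z i ^ \<alpha> i) * m k z))"
      if "z \<in> Z" for z
    proof -
      have "(\<Prod>i<Suc d. g i z ^ \<gamma> i) = (\<Sum>k<N. h k (f z) * m k z)" using h(2) that by blast
      also have "\<dots> = (\<Sum>k<N. \<Sum>\<alpha>\<in>PiE {..<d} (\<lambda>_. {..M}). c k \<alpha> * ((\<Prod>i<d. f z i ^ \<alpha> i) * m k z))"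
        by (rule sum.cong[OF refl]) (simp add: c sum_distrib_right mult.assoc)
      also have "\<dots> = (\<Sum>(k, \<alpha>)\<in>J. c k \<alpha> * ((\<Prod>i<d. f z i ^ \<alpha> i) * m k z))"
        unfolding J_def by (rule sum.cartesian_product)
      finally show ?thesis .
    qed
    then show ?thesis by (intro exI[of _ "\<lambda>(k, \<alpha>). c k \<alpha>"]) simp
  qed
  then have "\<forall>\<gamma>. \<exists>c. \<gamma> \<in> I \<longrightarrow> (\<forall>z\<in>Z. (\<Prod>i<Suc d. g i z ^ \<gamma> i) =
    (\<Sum>(k, \<alpha>)\<in>J. c (k, \<alpha>) * ((\<Prod>i<d. f z i ^ \<alpha> i) * m k z)))" by blast
  from choice[OF this] obtain c where c: "\<And>\<gamma> z. \<gamma> \<in> I \<Longrightarrow> z \<in> Z \<Longrightarrow> (\<Prod>i<Suc d. g i z ^ \<gamma> i) =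
    (\<Sum>(k, \<alpha>)\<in>J. c \<gamma> (k, \<alpha>) * ((\<Prod>i<d. f z i ^ \<alpha> i) * m k z))" by blast
  from underdetermined_system[OF finJ finI \<open>card J < card I\<close>, of c] obtain l where
    l: "\<exists>\<gamma>\<in>I. l \<gamma> \<noteq> 0" "\<And>j. j \<in> J \<Longrightarrow> (\<Sum>\<gamma>\<in>I. l \<gamma> * c \<gamma> j) = 0" by blast
  define q where "q x = (\<Sum>\<gamma>\<in>I. l \<gamma> * (\<Prod>i<Suc d. x i ^ \<gamma> i))" for x
  have q: "q \<in> fun_alg (crd (Suc d))" unfolding q_def
    by (intro fun_alg_sum fun_alg.mult fun_alg.const fun_alg_prod fun_alg_power crd_var) simp
  have "\<exists>x. q x \<noteq> 0"
  proof (rule ccontr)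
    assume "\<not> ?thesis"
    then have q0: "\<And>x. q x = 0" by blast
    obtain \<gamma> where \<gamma>: "\<gamma> \<in> I" "l \<gamma> \<noteq> 0" using l(1) by blast
    have "l \<gamma> = 0"
    proof (rule monomials_independent[where V = "{..<Suc d}" and K = I and c = l and \<alpha> = \<gamma>])
      show "\<alpha> = \<beta>" if "\<alpha> \<in> I" "\<beta> \<in> I" "\<forall>i\<in>{..<Suc d}. \<alpha> i = \<beta> i" for \<alpha> \<beta>
        using that unfolding I_def by (intro PiE_ext[of \<alpha> "{..<Suc d}" "\<lambda>_. {..<n}" \<beta>]) auto
      show "(\<Sum>\<alpha>\<in>I. l \<alpha> * (\<Prod>i<Suc d. x i ^ \<alpha> i)) = 0" for x using q0[of x] by (simp only: q_def)
    qed (use finI \<gamma> in auto)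
    then show False using \<gamma>(2) by simp
  qed
  moreover have "q (\<lambda>i. g i z) = 0" if z: "z \<in> Z" for z
  proof -
    have "q (\<lambda>i. g i z) = (\<Sum>\<gamma>\<in>I. l \<gamma> * (\<Sum>(k, \<alpha>)\<in>J. c \<gamma> (k, \<alpha>) * ((\<Prod>i<d. f z i ^ \<alpha> i) * m k z)))"
      unfolding q_def by (rule sum.cong[OF refl]) (simp only: c[OF _ z])
    also have "\<dots> = (\<Sum>\<gamma>\<in>I. \<Sum>j\<in>J. l \<gamma> * c \<gamma> j * ((\<Prod>i<d. f z i ^ snd j i) * m (fst j) z))"
      by (simp add: sum_distrib_left case_prod_beta mult.assoc)
    also have "\<dots> = (\<Sum>j\<in>J. \<Sum>\<gamma>\<in>I. l \<gamma> * c \<gamma> j * ((\<Prod>i<d. f z i ^ snd j i) * m (fst j) z))"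
      by (rule sum.swap)
    also have "\<dots> = (\<Sum>j\<in>J. (\<Sum>\<gamma>\<in>I. l \<gamma> * c \<gamma> j) * ((\<Prod>i<d. f z i ^ snd j i) * m (fst j) z))"
      by (simp only: sum_distrib_right)
    also have "\<dots> = 0" by (rule sum.neutral) (simp add: l(2))
    finally show ?thesis .
  qed
  ultimately show ?thesis using q by blast
qed

text \<open>The \<open>f i\<close> are \<open>d\<close> independent functions. Among more than
  \<open>d\<close> functions, the first \<open>d + 1\<close> already satisfy a relation.\<close>

lemma (in normalized_variety) variety_dim_eq: "variety_dim Z = enat d"
proof (rule antisym)
  show "variety_dim Z \<le> enat d"
    unfolding variety_dim_def
  proof (rule Sup_least)
    fix x assume "x \<in> {enat e | e. \<exists>h. alg_independent_on Z e h}"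
    then obtain e h where x: "x = enat e" and ind: "alg_independent_on Z e h" by blast
    have "e \<le> d"
    proof (rule ccontr)
      assume "\<not> e \<le> d"
      then have sub: "{..<Suc d} \<subseteq> {..<e}" by auto
      have "\<exists>q\<in>fun_alg (crd (Suc d)). (\<exists>x. q x \<noteq> 0) \<and> (\<forall>z\<in>Z. q (\<lambda>i. peval (h i) (($) z)) = 0)"
        by (rule algebraic_relation) (rule peval_in_vcrd)
      then obtain q where q: "q \<in> fun_alg (crd (Suc d))" "\<exists>x. q x \<noteq> 0"
        "\<forall>z\<in>Z. q (\<lambda>i. peval (h i) (($) z)) = 0" by blast
      obtain p where p: "q = peval p" "\<forall>m\<in>Poly_Mapping.keys p. Poly_Mapping.keys m \<subseteq> {..<Suc d}"
        using fun_alg_imp_peval q(1) unfolding crd_def by blast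
      have keys: "\<forall>m\<in>Poly_Mapping.keys p. Poly_Mapping.keys m \<subseteq> {..<e}"
        using p(2) sub by (meson subset_trans)
      have "p = 0"
        using ind[unfolded alg_independent_on_def, THEN spec, THEN mp, THEN mp, OF keys q(3)[unfolded p(1)]] .
      then show False using q(2) p(1) by simp
    qed
    then show "x \<le> enat d" using x by simp
  qed
  have "\<forall>i. \<exists>p. i < d \<longrightarrow> (\<lambda>z. f z i) = (\<lambda>z. peval p (($) z))"
    using vcrd_imp_peval[OF module_finite_vcrd[OF fin]] by blast
  from choice[OF this] obtain h where h: "\<And>i. i < d \<Longrightarrow> (\<lambda>z. f z i) = (\<lambda>z. peval (h i) (($) z))" by blast
  have "alg_independent_on Z d h"
    unfolding alg_independent_on_def
  proof (intro allI impI)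
    fix q :: "nat cpoly"
    assume keys: "\<forall>m\<in>Poly_Mapping.keys q. Poly_Mapping.keys m \<subseteq> {..<d}"
      and van: "\<forall>x\<in>Z. peval q (\<lambda>j. peval (h j) (($) x)) = 0"
    have q: "peval q \<in> fun_alg (crd d)" unfolding crd_def by (rule peval_in_fun_alg) (use keys in blast)
    have "peval q (f z) = 0" if "z \<in> Z" for z
    proof -
      have "peval q (f z) = peval q (\<lambda>j. peval (h j) (($) z))"
        by (rule crd_local[OF q]) (rule fun_cong[OF h])
      then show ?thesis using van that by simp
    qed
    then have "peval q x = 0" for x by (rule indep[OF q])
    then show "q = 0" by (rule peval_eq_0_imp[OF keys])
  qed
  then show "enat d \<le> variety_dim Z" unfolding variety_dim_def by (intro Sup_upper) blast
qed

section \<open>Density of the nonsingular points\<close>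

lemma irreducible_prod_nonzero:
  fixes Z :: "(complex^'n::finite) set"
  assumes Z: "irreducible_variety Z" and "finite I"
    and "\<And>i. i \<in> I \<Longrightarrow> u i \<in> fun_alg vcrd" and "\<And>i. i \<in> I \<Longrightarrow> \<exists>z\<in>Z. u i z \<noteq> 0"
  shows "\<exists>z\<in>Z. (\<Prod>i\<in>I. u i z) \<noteq> 0"
  using assms(2-)
proof (induction I rule: finite_induct)
  case empty
  then show ?case using Z by (auto simp: irreducible_variety_def)
next
  case (insert j I)
  then have 1: "\<exists>z\<in>Z. u j z \<noteq> 0" "\<exists>z\<in>Z. (\<Prod>i\<in>I. u i z) \<noteq> 0" by simp_all
  show ?case
  proof (rule ccontr)
    assume "\<not> ?thesis"
    then have "\<And>z. z \<in> Z \<Longrightarrow> u j z * (\<Prod>i\<in>I. u i z) = 0" using insert.hyps by simp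
    then have "(\<forall>z\<in>Z. u j z = 0) \<or> (\<forall>z\<in>Z. (\<Prod>i\<in>I. u i z) = 0)"
      using insert.prems(1) by (intro irreducible_no_zero_divisors[OF Z] fun_alg_prod) auto
    then show False using 1 by blast
  qed
qed

lemma tangent_space_iff:
  fixes X :: "(complex^'n::finite) set"
  shows "w \<in> tangent_space X z \<longleftrightarrow>
    (\<forall>u\<in>fun_alg vcrd. (\<forall>x\<in>X. u x = 0) \<longrightarrow> (\<Sum>j\<in>UNIV. pd j u z * w $ j) = 0)"
proof -
  have eq: "partial i p z = pd i (\<lambda>z. peval p (($) z)) z" for i p
    by (simp add: partial_def pd_def)
  show ?thesis
  proof
    assume L: "w \<in> tangent_space X z"
    show "\<forall>u\<in>fun_alg vcrd. (\<forall>x\<in>X. u x = 0) \<longrightarrow> (\<Sum>j\<in>UNIV. pd j u z * w $ j) = 0"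
    proof (intro ballI impI)
      fix u :: "complex^'n \<Rightarrow> complex" assume u: "u \<in> fun_alg vcrd" "\<forall>x\<in>X. u x = 0"
      obtain p where p: "u = (\<lambda>z. peval p (($) z))" using vcrd_imp_peval[OF u(1)] by blast
      then have "p \<in> vanishing_ideal X" using u(2) by (simp add: vanishing_ideal_def)
      then have "(\<Sum>i\<in>UNIV. partial i p z * w $ i) = 0" using L by (simp add: tangent_space_def)
      then show "(\<Sum>j\<in>UNIV. pd j u z * w $ j) = 0" by (simp add: eq p)
    qed
  next
    assume R: "\<forall>u\<in>fun_alg vcrd. (\<forall>x\<in>X. u x = 0) \<longrightarrow> (\<Sum>j\<in>UNIV. pd j u z * w $ j) = 0"
    show "w \<in> tangent_space X z"
      unfolding tangent_space_def
    proof (intro CollectI ballI)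
      fix p assume "p \<in> vanishing_ideal X"
      then have "\<forall>x\<in>X. peval p (($) x) = 0" by (simp add: vanishing_ideal_def)
      then show "(\<Sum>i\<in>UNIV. partial i p z * w $ i) = 0"
        using R[rule_format, OF peval_in_vcrd] by (simp add: eq)
    qed
  qed
qed

text \<open>The \<open>w i\<close> are dual to the coordinates \<open>\<phi> i\<close>: a vector
  minus its expansion in them is killed by all coordinates, hence 0.\<close>

lemma dim_by_coordinates:
  fixes T :: "(complex^'n::finite) set" and \<phi> :: "nat \<Rightarrow> complex^'n \<Rightarrow> complex"
  assumes T: "vec.subspace T" and lin: "\<And>i. i < d \<Longrightarrow> Vector_Spaces.linear (*s) (*) (\<phi> i)"
    and w: "\<And>i. i < d \<Longrightarrow> w i \<in> T" "\<And>i j. i < d \<Longrightarrow> j < d \<Longrightarrow> \<phi> i (w j) = (if i = j then 1 else 0)"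
    and inj: "\<And>v. v \<in> T \<Longrightarrow> (\<And>i. i < d \<Longrightarrow> \<phi> i v = 0) \<Longrightarrow> v = 0"
  shows "vec.dim T = d"
proof -
  have \<phi>sum: "\<phi> i (\<Sum>j<d. c j *s w j) = c i" if i: "i < d" for i c
  proof -
    interpret Vector_Spaces.linear "(*s) :: complex \<Rightarrow> complex^'n \<Rightarrow> complex^'n" "(*)" "\<phi> i"
      by (rule lin[OF i])
    have "\<phi> i (\<Sum>j<d. c j *s w j) = (\<Sum>j<d. if j = i then c j else 0)"
      unfolding sum scale using i by (intro sum.cong) (auto simp: w(2))
    then show ?thesis using i by simp
  qed
  have inj_w: "inj_on w {..<d}"
  proof (rule inj_onI)
    fix i j assume ij: "i \<in> {..<d}" "j \<in> {..<d}" "w i = w j"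
    then have "\<phi> i (w i) = \<phi> i (w j)" by simp
    then show "i = j" using ij w(2)[of i i] w(2)[of i j] by (auto split: if_splits)
  qed
  show ?thesis
  proof (rule vec.dim_unique[of "w ` {..<d}"])
    show "w ` {..<d} \<subseteq> T" using w(1) by blast
    show "T \<subseteq> vec.span (w ` {..<d})"
    proof
      fix v assume v: "v \<in> T"
      define v' where "v' = (\<Sum>j<d. \<phi> j v *s w j)"
      have v'T: "v' \<in> T" unfolding v'_def
        using w(1) by (intro vec.subspace_sum[OF T] vec.subspace_scale[OF T]) auto
      have "v - v' = 0"
      proof (rule inj)
        show "v - v' \<in> T" by (rule vec.subspace_diff[OF T v v'T])
        fix i assume i: "i < d"
        interpret Vector_Spaces.linear "(*s) :: complex \<Rightarrow> complex^'n \<Rightarrow> complex^'n" "(*)" "\<phi> i"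
          by (rule lin[OF i])
        show "\<phi> i (v - v') = 0" unfolding diff v'_def \<phi>sum[OF i] by simp
      qed
      then have "v = v'" by simp
      also have "\<dots> \<in> vec.span (w ` {..<d})" unfolding v'_def
        by (intro vec.span_sum vec.span_scale vec.span_base) auto
      finally show "v \<in> vec.span (w ` {..<d})" .
    qed
    show "vec.independent (w ` {..<d})"
    proof
      assume "vec.dependent (w ` {..<d})"
      then obtain u where u: "\<exists>v\<in>w ` {..<d}. u v \<noteq> 0" "(\<Sum>v\<in>w ` {..<d}. u v *s v) = 0"
        unfolding vec.dependent_finite[OF finite_imageI[OF finite_lessThan]] by blast
      then obtain i where i: "i < d" "u (w i) \<noteq> 0" by blast
      have "(\<Sum>j<d. u (w j) *s w j) = 0" using u(2) by (simp add: sum.reindex[OF inj_w])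
      then have "\<phi> i 0 = u (w i)" using \<phi>sum[OF i(1), of "\<lambda>j. u (w j)"] by simp
      interpret Vector_Spaces.linear "(*s) :: complex \<Rightarrow> complex^'n \<Rightarrow> complex^'n" "(*)" "\<phi> i"
        by (rule lin[OF i(1)])
      show False using \<open>\<phi> i 0 = u (w i)\<close> i(2) zero by simp
    qed
    show "card (w ` {..<d}) = d" by (simp add: card_image[OF inj_w])
  qed
qed

lemma directional_derivative_linear:
  "Vector_Spaces.linear (*s) (*) (\<lambda>w :: complex^'n::finite. \<Sum>j\<in>UNIV. pd j u z * w $ j)"
  by unfold_locales
     (simp_all add: algebra_simps sum.distrib sum_distrib_left)

lemma tangent_space_subspace: "vec.subspace (tangent_space X (z :: complex^'n::finite))"
  unfolding vec.subspace_def tangent_space_def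
  by (simp add: distrib_left sum.distrib mult.left_commute flip: sum_distrib_left)

theorem nonsingular_points_dense:
  fixes X :: "(complex^'n::finite) set"
  assumes X: "affine_variety X" and "a \<in> X"
  shows "\<exists>z. (\<forall>k. z k \<in> nonsingular_points X) \<and> z \<longlonglongrightarrow> a"
proof -
  obtain Z W where Z: "irreducible_component X Z" "a \<in> Z" and W: "affine_variety W" and
    XZW: "X = Z \<union> W" and ZW: "\<not> Z \<subseteq> W" and
    uniq: "\<And>z Z'. z \<in> Z - W \<Longrightarrow> irreducible_component X Z' \<Longrightarrow> z \<in> Z' \<Longrightarrow> Z' = Z"
    using component_through_point[OF assms] by blast
  have irr: "irreducible_variety Z" using Z(1) by (simp add: irreducible_component_def)
  then have "Z \<noteq> {}" by (simp add: irreducible_variety_def)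
  then obtain d f where df: "module_finite Z d f"
    "\<And>q x. q \<in> fun_alg (crd d) \<Longrightarrow> (\<And>z. z \<in> Z \<Longrightarrow> q (f z) = 0) \<Longrightarrow> q x = 0"
    using noether_normalization by blast
  interpret normalized_variety Z d f by unfold_locales (fact irr df)+
  have "\<forall>l. \<exists>F. minimal_poly F (\<lambda>z. z $ l)" using exists_minimal_poly[OF vcrd_var] by blast
  from choice[OF this] obtain F where F: "\<And>l. minimal_poly (F l) (\<lambda>z. z $ l)" by blast
  obtain z0 where "z0 \<in> Z" "z0 \<notin> W" using ZW by blast
  then obtain g where g: "g \<in> fun_alg vcrd" "\<And>z. z \<in> W \<Longrightarrow> g z = 0" "g z0 \<noteq> 0"
    using affine_variety_separate[OF W] by blast
  define s where "s l z = poly (pderiv (F l (f z))) (z $ l)" for l z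
  have s: "s l \<in> fun_alg vcrd" for l unfolding s_def[abs_def]
    by (rule poly_fam_vcrd[OF poly_fam_pderiv[OF minimal_polyD(1)[OF F]] vcrd_var])
  \<comment> \<open>The derivative of a minimal polynomial has smaller degree, and in characteristic
    0 it is nonzero, so it cannot annihilate the coordinate.\<close>
  have s_ne: "\<exists>z\<in>Z. s l z \<noteq> 0" for l
  proof (rule ccontr)
    assume "\<not> ?thesis"
    then have ann: "annihilates (\<lambda>x. pderiv (F l x)) (\<lambda>z. z $ l)"
      using poly_fam_pderiv[OF minimal_polyD(1)[OF F]] by (simp add: annihilates_def s_def)
    let ?x = "\<lambda>_. 0 :: complex"
    have deg: "degree (F l ?x) \<noteq> 0" by (rule minimal_polyD(5)[OF F])
    then have "degree (pderiv (F l ?x)) < degree (F l ?x)" by (simp add: degree_pderiv)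
    with F ann have "pderiv (F l ?x) = 0" by (rule minimal_poly_degree)
    then show False using deg by (simp add: pderiv_eq_0_iff)
  qed
  \<comment> \<open>A single function whose nonvanishing gives all generic conditions: lying off
    \<open>W\<close>, and separability in every coordinate.\<close>
  define D where "D z = g z * (\<Prod>l\<in>UNIV. s l z)" for z
  have D: "D \<in> fun_alg vcrd" unfolding D_def[abs_def] by (intro fun_alg.mult g(1) fun_alg_prod s)
  have "\<exists>z\<in>Z. D z \<noteq> 0"
  proof (rule ccontr)
    assume "\<not> ?thesis"
    then have "(\<forall>z\<in>Z. g z = 0) \<or> (\<forall>z\<in>Z. (\<Prod>l\<in>UNIV. s l z) = 0)"
      by (intro irreducible_no_zero_divisors[OF irr g(1) fun_alg_prod[OF s]]) (simp add: D_def)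
    moreover have "\<exists>z\<in>Z. (\<Prod>l\<in>UNIV. s l z) \<noteq> 0"
      by (rule irreducible_prod_nonzero[OF irr finite]) (rule s, rule s_ne)
    ultimately show False using g(3) \<open>z0 \<in> Z\<close> by blast
  qed
  then obtain z where z: "\<And>k. z k \<in> Z" "\<And>k. D (z k) \<noteq> 0" "z \<longlonglongrightarrow> a"
    using generic_sequence[OF Z(2) D] by blast
  have "y \<in> nonsingular_points X" if y: "y \<in> Z" "D y \<noteq> 0" for y
  proof -
    have gy: "g y \<noteq> 0" and sy: "\<And>l. s l y \<noteq> 0" using y(2) by (auto simp: D_def)
    have "y \<notin> W" using g(2) gy by blast
    then have "{variety_dim Z' | Z'. irreducible_component X Z' \<and> y \<in> Z'} = {variety_dim Z}"
      using uniq y(1) Z(1) by blast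
    then have local: "local_dim X y = enat d" by (simp add: local_dim_def variety_dim_eq)
    define \<phi> where "\<phi> i w = (\<Sum>j\<in>UNIV. pd j (\<lambda>z. f z i) y * w $ j)" for i and w :: "complex^'n"
    have "\<forall>i. \<exists>w. (\<forall>q\<in>fun_alg vcrd. (\<forall>y\<in>Z. q y = 0) \<longrightarrow> (\<Sum>j\<in>UNIV. pd j q y * w $ j) = 0) \<and>
      (\<forall>k<d. (\<Sum>j\<in>UNIV. pd j (\<lambda>z. f z k) y * w $ j) = (if k = i then 1 else 0))"
    proof
      fix i
      show "\<exists>w. (\<forall>q\<in>fun_alg vcrd. (\<forall>y\<in>Z. q y = 0) \<longrightarrow> (\<Sum>j\<in>UNIV. pd j q y * w $ j) = 0) \<and>
        (\<forall>k<d. (\<Sum>j\<in>UNIV. pd j (\<lambda>z. f z k) y * w $ j) = (if k = i then 1 else 0))"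
        by (rule tangent_vector_over[OF y(1) F sy[unfolded s_def], where v = "\<lambda>k. if k = i then 1 else 0"])
    qed
    from choice[OF this] obtain w where
      "\<forall>i. (\<forall>q\<in>fun_alg vcrd. (\<forall>y\<in>Z. q y = 0) \<longrightarrow> (\<Sum>j\<in>UNIV. pd j q y * w i $ j) = 0) \<and>
        (\<forall>k<d. (\<Sum>j\<in>UNIV. pd j (\<lambda>z. f z k) y * w i $ j) = (if k = i then 1 else 0))"
      by (elim exE)
    note w = this[THEN spec, THEN conjunct1, THEN bspec, THEN mp]
      this[THEN spec, THEN conjunct2, THEN spec, THEN mp]
    have "vec.dim (tangent_space X y) = d"
    proof (rule dim_by_coordinates[OF tangent_space_subspace])
      show "Vector_Spaces.linear (*s) (*) (\<phi> i)" for i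
        unfolding \<phi>_def[abs_def] by (rule directional_derivative_linear)
      \<comment> \<open>A function vanishing on \<open>X\<close> vanishes on \<open>Z\<close>, so
        vectors tangent to \<open>Z\<close> are tangent to \<open>X\<close>.\<close>
      show "w i \<in> tangent_space X y" for i
        unfolding tangent_space_iff using XZW by (intro ballI impI w(1)) auto
      show "\<phi> i (w j) = (if i = j then 1 else 0)" if "i < d" for i j
        unfolding \<phi>_def by (rule w(2)[OF that])
      fix v assume v: "v \<in> tangent_space X y" "\<And>i. i < d \<Longrightarrow> \<phi> i v = 0"
      show "v = 0"
      proof (rule tangent_vector_unique[OF y(1) F sy[unfolded s_def] g(1) gy])
        fix l
        have "(\<lambda>y. g y * poly (F l (f y)) (y $ l)) \<in> fun_alg vcrd"
          by (rule fun_alg.mult[OF g(1) poly_fam_vcrd[OF minimal_polyD(1)[OF F] vcrd_var]])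
        note v(1)[unfolded tangent_space_iff, THEN bspec, OF this, THEN mp]
        \<comment> \<open>The product vanishes on \<open>W\<close> through \<open>g\<close> and on
          \<open>Z\<close> through the minimal polynomial, so it constrains tangent vectors of all
          of \<open>X\<close>.\<close>
        moreover have "\<forall>x\<in>X. g x * poly (F l (f x)) (x $ l) = 0"
        proof
          fix x assume "x \<in> X"
          then consider "x \<in> W" | "x \<in> Z" unfolding XZW by blast
          then show "g x * poly (F l (f x)) (x $ l) = 0"
            by cases (simp_all add: g(2) minimal_polyD(2)[OF F])
        qed
        ultimately show "(\<Sum>j\<in>UNIV. pd j (\<lambda>y. g y * poly (F l (f y)) (y $ l)) y * v $ j) = 0" .
      next
        show "(\<Sum>j\<in>UNIV. pd j (\<lambda>z. f z i) y * v $ j) = 0" if "i < d" for i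
          using v(2)[OF that] by (simp add: \<phi>_def)
      qed
    qed
    then show ?thesis using y(1) XZW local by (simp add: nonsingular_points_def)
  qed
  then show ?thesis using z by blast
qed

section \<open>Nonsingular points in the halo\<close>

lemma coll_extension:
  assumes "superstructure E S h" "A \<subseteq> level E S k" "enat (Suc k) \<le> h"
  shows "E y (coll E S A) \<longleftrightarrow> y \<in> A" and "coll E S A \<in> level E S (Suc k)"
proof -
  have "\<exists>!x. x \<notin> S \<and> {y. E y x} = A" using assms by (simp add: superstructure_def)
  then have *: "coll E S A \<notin> S \<and> {y. E y (coll E S A)} = A"
    unfolding coll_def by (rule theI')
  then show "E y (coll E S A) \<longleftrightarrow> y \<in> A" by blast
  show "coll E S A \<in> level E S (Suc k)" using * assms(2) by simp
qed

theorem corollary4p3: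
  fixes E :: "'u \<Rightarrow> 'u \<Rightarrow> bool" and S :: "'u set"
    and E' :: "'v \<Rightarrow> 'v \<Rightarrow> bool" and S' :: "'v set"
    and h :: enat and star :: "'u \<Rightarrow> 'v"
    and c :: "complex \<Rightarrow> 'u" and idx :: "'n::finite \<Rightarrow> nat"
    and X :: "(complex^'n) set" and a :: "complex^'n"
  assumes "enlargement E S E' S' h star" and "5 \<le> h"
    and "inj c" and "range c \<subseteq> S"
    and "bij_betw idx (UNIV :: 'n set) {1..CARD('n)}"
    and "affine_variety X" and "a \<in> X"
  shows "\<exists>\<xi>. \<xi> \<in> star_set E S E' star c idx (nonsingular_points X) \<and>
             \<xi> \<in> halo E S E' star c idx X a"
proof -
  have sup: "superstructure E S h" using assms(1) by (simp add: enlargement_def)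
  have h: "enat (Suc k) \<le> h" if "k < 5" for k
  proof -
    have "enat (Suc k) \<le> 5" using that by (simp add: numeral_eq_enat)
    then show ?thesis using assms(2) by (rule order_trans)
  qed
  note coll = coll_extension[OF sup _ h]
  have atom: "c t \<in> level E S 0" for t using assms(4) by auto
  have "kpair E S (c s) (c t) \<in> level E S 2" for s t
  proof -
    have "coll E S {c s} \<in> level E S (Suc 0)" "coll E S {c s, c t} \<in> level E S (Suc 0)"
      using atom by (auto intro!: coll(2) simp del: level.simps)
    then have "kpair E S (c s) (c t) \<in> level E S (Suc (Suc 0))"
      unfolding kpair_def by (intro coll(2)) (auto simp del: level.simps)
    then show ?thesis by (simp only: numeral_2_eq_2)
  qed
  then have "point_code E S c idx x \<in> level E S (Suc 2)" for x
    unfolding point_code_def by (intro coll(2)) auto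
  then have sub: "point_code E S c idx ` A \<subseteq> level E S 3" for A by (auto simp: numeral_3_eq_3 simp del: level.simps)
  have set_code: "E y (set_code E S c idx A) \<longleftrightarrow> y \<in> point_code E S c idx ` A"
    "set_code E S c idx A \<in> level E S (Suc 3)" for y A
    unfolding set_code_def using coll[OF sub] by simp_all
  define \<U> where "\<U> = {U. openin (top_of_set X) U \<and> a \<in> U}"
  \<comment> \<open>A point common to the enlargements of all these sets is a nonsingular point in
    the halo.\<close>
  define \<F> where "\<F> = set_code E S c idx ` insert (nonsingular_points X) \<U>"
  have \<F>sub: "\<F> \<subseteq> level E S (Suc 3)" unfolding \<F>_def using set_code(2) by blast
  have ext: "E A (coll E S \<F>) \<longleftrightarrow> A \<in> \<F>" for A by (rule coll(1)[OF \<F>sub]) simp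
  \<comment> \<open>The family lies in level 5, and \<open>5 \<le> h\<close> puts it into the
    universe.\<close>
  have "coll E S \<F> \<in> level E S (Suc (Suc 3))" by (rule coll(2)[OF \<F>sub]) simp
  then have univ: "coll E S \<F> \<in> universe E S h"
    unfolding universe_def using h[of 4] by (intro UN_I[of "Suc (Suc 3)"]) auto
  obtain z where z: "\<And>k. z k \<in> nonsingular_points X" "z \<longlonglongrightarrow> a"
    using nonsingular_points_dense[OF assms(6,7)] by blast
  \<comment> \<open>Each member contains a tail of the sequence \<open>z\<close> of nonsingular
    points tending to \<open>a\<close>, so finitely many members share a term of it.\<close>
  have "fip E (coll E S \<F>)"
    unfolding fip_def ext
  proof (intro allI impI)
    fix G assume G: "G \<subseteq> {A. A \<in> \<F>}" "finite G"
    have "G \<subseteq> set_code E S c idx ` insert (nonsingular_points X) \<U>"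
      using G(1) unfolding \<F>_def Collect_mem_eq .
    from finite_subset_image[OF G(2) this] obtain \<V> where
      \<V>: "\<V> \<subseteq> insert (nonsingular_points X) \<U>" "finite \<V>" "G = set_code E S c idx ` \<V>" by blast
    have "\<forall>\<^sub>F k in sequentially. z k \<in> V" if "V \<in> \<V>" for V
    proof (cases "V = nonsingular_points X")
      case True
      then show ?thesis using z(1) by simp
    next
      case False
      then have "openin (top_of_set X) V" "a \<in> V" using that \<V>(1) by (auto simp: \<U>_def)
      then obtain O' where O': "open O'" "V = X \<inter> O'" "a \<in> O'" by (auto simp: openin_open)
      have "\<forall>\<^sub>F k in sequentially. z k \<in> O'" by (rule topological_tendstoD[OF z(2) O'(1,3)])
      moreover have "z k \<in> X" for k using z(1) by (simp add: nonsingular_points_def)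
      ultimately show ?thesis by (simp add: O'(2))
    qed
    then have "\<forall>\<^sub>F k in sequentially. \<forall>V\<in>\<V>. z k \<in> V"
      using \<V>(2) by (simp add: eventually_ball_finite_distrib)
    then obtain k where "\<forall>V\<in>\<V>. z k \<in> V" by (auto simp: eventually_sequentially)
    then show "\<exists>y. \<forall>A\<in>G. E y A"
      by (intro exI[of _ "point_code E S c idx (z k)"]) (auto simp: \<V>(3) set_code(1))
  qed
  then obtain \<xi> where \<xi>: "\<And>A. A \<in> \<F> \<Longrightarrow> E' \<xi> (star A)"
    using assms(1) univ ext unfolding enlargement_def by blast
  show ?thesis
    by (intro exI[of _ \<xi>]) (auto simp: star_set_def halo_def \<U>_def \<F>_def intro!: \<xi>)
qed

end
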